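(* Suppose that $w(1)+w(2)=1$, $P$-a.s., that $\sum_{i\in S}P(w(i)=1)<1$, and that there exists an $\varepsilon>0$ such that $P(w(i)>\varepsilon \text{ for all } i\in S)=1$. Then, $P$-a.s., the Hausdorff dimension of the random metric space $(T,R)$ satisfies $\dim_H(T)=\alpha$, where $\alpha$ is the unique positive solution of $E\left(\sum_{i\in S}w(i)^\alpha\right)=1$.
   Context: Addresses: $S:=\{1,2,3\}$; $\Sigma_n:=S^n$ (with $\Sigma_0:=\{\emptyset\}$), $\Sigma_*:=\bigcup_{n\ge0}\Sigma_n$; $ij$ denotes concatenation, $|i|$ the length of $i\in\Sigma_*$, and $i|m$ the truncation of $i$ to its first $m$ letters. Fractal: fix $c\in(0,1/2)$ and maps on $\mathbb{R}^2$: $\psi_1(x,y)=\frac12(1-x,y)$, $\psi_2(x,y)=\frac12(1+x,-y)$, $\psi_3(x,y)=(\frac12+cy,cx)$. $T$ is the unique non-empty compact subset of $\mathbb{R}^2$ with $T=\bigcup_{i\in S}\psi_i(T)$. For $i\in\Sigma_n$, $\psi_i:=\psi_{i_1}\circ\dots\circ\psi_{i_n}$ ($\psi_\emptyset$ is the identity). $V^0:=\{(0,0),(1,0)\}$, $V^n:=\bigcup_{i\in\Sigma_n}\psi_i(V^0)$, $V^*:=\bigcup_{n\ge0}V^n$. $T$ is the Euclidean closure of $V^*$. Cascade: $(w(i))_{i\in\Sigma_*\setminus\{\emptyset\}}$ are random variables on a probability space with measure $P$ (expectation $E$), with values in $[0,1]$ and non-zero $P$-a.s., such that the triples $(w(ij))_{j\in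 S}$, $i\in\Sigma_*$, are independent copies of $(w(j))_{j\in S}$ (no independence is assumed within a triple). $l(\emptyset):=1$, $l(i):=w(i|1)w(i|2)\cdots w(i)$. Under the condition $E(w(1)+w(2))=1$, the limits $R_i:=\lim_{n\to\infty}\sum_{j\in\{1,2\}^n}l(ij)/l(i)$, $i\in\Sigma_*$, exist in $(0,\infty)$ $P$-a.s. Random metric: for $f:V^n\to\mathbb{R}$ let $\mathcal{E}^n(f,f):=\sum_{i\in\Sigma_n}\frac{1}{l(i)R_i}\left(f(\psi_i(0,0))-f(\psi_i(1,0))\right)^2$. For $f:V^*\to\mathbb{R}$ let $\mathcal{E}^*(f,f):=\lim_{n\to\infty}\mathcal{E}^n(f|_{V^n},f|_{V^n})$, with domain $\mathcal{F}^*$ the set of $f$ for which this limit exists finitely. Define $R^*(x,x)=0$ and, for $x\ne y$ in $V^*$, $R^*(x,y)^{-1}:=\inf\{\mathcal{E}^*(f,f): f\in\mathcal{F}^*, f(x)=0, f(y)=1\}$; this is $P$-a.s. a metric on $V^*$. Under the conditions $E(w(1)+w(2))=1$ and $\sum_{i\in S}P(w(i)=1)<1$, $P$-a.s. $R(x,y):=\lim_{n\to\infty}R^*(x_n,y_n)$, for any $x_n,y_n\in V^*$ converging in Euclidean distance to $x,y\in T$, is a well-defined metric on $T$ inducing the Euclidean topology; the Hausdorff dimension $\dim_H(T)$ is taken with respect to $R$. These two conditions also guarantee that the equation $E(\sum_{i\in S}w(i)^\theta)=1$ has a unique positive solution $\theta=\alpha$, and $\alpha\in(1,\infty)$. *)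

theory Defs
  imports "HOL-Probability.Probability"
begin

definition letters :: "nat set" where
  "letters = {1, 2, 3}"

definition words :: "'b set \<Rightarrow> nat \<Rightarrow> 'b list set" where
  "words A n = {i. set i \<subseteq> A \<and> length i = n}"

text \<open>The value at letters outside \<open>{1, 2, 3}\<close> is irrelevant.\<close>

definition psi :: "real \<Rightarrow> nat \<Rightarrow> real \<times> real \<Rightarrow> real \<times> real" where
  "psi c a = (\<lambda>(x, y).
     if a = 1 then ((1 - x) / 2, y / 2)
     else if a = 2 then ((1 + x) / 2, - y / 2)
     else (1 / 2 + c * y, c * x))"

fun psi_word :: "real \<Rightarrow> nat list \<Rightarrow> real \<times> real \<Rightarrow> real \<times> real" where
  "psi_word c [] = id"
| "psi_word c (a # i) = psi c a \<circ> psi_word c i"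

definition fractal :: "real \<Rightarrow> (real \<times> real) set" where
  "fractal c = (THE T. T \<noteq> {} \<and> compact T \<and> T = (\<Union>a\<in>letters. psi c a ` T))"

definition V_level :: "real \<Rightarrow> nat \<Rightarrow> (real \<times> real) set" where
  "V_level c n = (\<Union>i\<in>words letters n. psi_word c i ` {(0, 0), (1, 0)})"

definition V_star :: "real \<Rightarrow> (real \<times> real) set" where
  "V_star c = (\<Union>n. V_level c n)"

text \<open>The finite addresses are \<open>lists letters\<close>; values of \<open>w\<close> at the empty word and at lists
  containing other numbers carry no constraint and are never used.\<close>

locale random_cascade = prob_space M for M :: "'a measure" +
  fixes w :: "nat list \<Rightarrow> 'a \<Rightarrow> real"
  assumes w_measurable: "\<And>i. i \<in> lists letters - {[]} \<Longrightarrow> w i \<in> borel_measurable M"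
    and w_range: "\<And>i \<omega>. i \<in> lists letters - {[]} \<Longrightarrow> \<omega> \<in> space M \<Longrightarrow> w i \<omega> \<in> {0..1}"
    and w_nonzero: "\<And>i. i \<in> lists letters - {[]} \<Longrightarrow> AE \<omega> in M. w i \<omega> \<noteq> 0"
    and triples_indep:
      "indep_vars (\<lambda>_. borel :: (real \<times> real \<times> real) measure)
         (\<lambda>i \<omega>. (w (i @ [1]) \<omega>, w (i @ [2]) \<omega>, w (i @ [3]) \<omega>)) (lists letters)"
    and triples_distr:
      "\<And>i. i \<in> lists letters \<Longrightarrow>
         distr M (borel :: (real \<times> real \<times> real) measure)
           (\<lambda>\<omega>. (w (i @ [1]) \<omega>, w (i @ [2]) \<omega>, w (i @ [3]) \<omega>)) =
         distr M borel (\<lambda>\<omega>. (w [1] \<omega>, w [2] \<omega>, w [3] \<omega>))"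

definition cascade_exponent :: "'a measure \<Rightarrow> (nat list \<Rightarrow> 'a \<Rightarrow> real) \<Rightarrow> real" where
  "cascade_exponent M w =
     (THE \<theta>. 0 < \<theta> \<and> integral\<^sup>L M (\<lambda>\<omega>. \<Sum>a\<in>letters. w [a] \<omega> powr \<theta>) = 1)"

text \<open>Below, \<open>u\<close> is one realization \<open>\<lambda>i. w i \<omega>\<close> of the cascade.\<close>

definition cell_length :: "(nat list \<Rightarrow> real) \<Rightarrow> nat list \<Rightarrow> real" where
  "cell_length u i = (\<Prod>m = 1..length i. u (take m i))"

definition cell_resistance :: "(nat list \<Rightarrow> real) \<Rightarrow> nat list \<Rightarrow> real" where
  "cell_resistance u i =
     lim (\<lambda>n. \<Sum>j\<in>words {1, 2} n. cell_length u (i @ j) / cell_length u i)"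

text \<open>Functions on \<open>V_level c n\<close> and on \<open>V_star c\<close> are represented by total functions on the plane;
  the energies depend only on their values on these sets.\<close>

definition level_energy ::
    "real \<Rightarrow> (nat list \<Rightarrow> real) \<Rightarrow> nat \<Rightarrow> (real \<times> real \<Rightarrow> real) \<Rightarrow> real" where
  "level_energy c u n f =
     (\<Sum>i\<in>words letters n. 1 / (cell_length u i * cell_resistance u i) *
        (f (psi_word c i (0, 0)) - f (psi_word c i (1, 0)))\<^sup>2)"

definition finite_energy :: "real \<Rightarrow> (nat list \<Rightarrow> real) \<Rightarrow> (real \<times> real \<Rightarrow> real) set" where
  "finite_energy c u = {f. convergent (\<lambda>n. level_energy c u n f)}"

definition energy :: "real \<Rightarrow> (nat list \<Rightarrow> real) \<Rightarrow> (real \<times> real \<Rightarrow> real) \<Rightarrow> real" where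
  "energy c u f = lim (\<lambda>n. level_energy c u n f)"

definition resistance_star ::
    "real \<Rightarrow> (nat list \<Rightarrow> real) \<Rightarrow> real \<times> real \<Rightarrow> real \<times> real \<Rightarrow> real" where
  "resistance_star c u x y =
     (if x = y then 0
      else inverse (Inf (energy c u ` {f \<in> finite_energy c u. f x = 0 \<and> f y = 1})))"

definition resistance_metric ::
    "real \<Rightarrow> (nat list \<Rightarrow> real) \<Rightarrow> real \<times> real \<Rightarrow> real \<times> real \<Rightarrow> real" where
  "resistance_metric c u x y =
     (THE r. \<forall>xs ys. range xs \<subseteq> V_star c \<longrightarrow> range ys \<subseteq> V_star c \<longrightarrow>
        xs \<longlonglongrightarrow> x \<longrightarrow> ys \<longlonglongrightarrow> y \<longrightarrow>
        (\<lambda>n. resistance_star c u (xs n) (ys n)) \<longlonglongrightarrow> r)"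

definition diam :: "('b \<Rightarrow> 'b \<Rightarrow> real) \<Rightarrow> 'b set \<Rightarrow> ennreal" where
  "diam d U = (SUP (x, y)\<in>U \<times> U. ennreal (d x y))"

text \<open>The bound \<open>\<delta>\<close> makes the diameters finite, so \<open>enn2real\<close> loses nothing.\<close>

definition hausdorff_content ::
    "'b set \<Rightarrow> ('b \<Rightarrow> 'b \<Rightarrow> real) \<Rightarrow> real \<Rightarrow> real \<Rightarrow> ennreal" where
  "hausdorff_content X d s \<delta> =
     (INF U\<in>{U :: nat \<Rightarrow> 'b set. (\<forall>k. U k \<subseteq> X \<and> diam d (U k) \<le> ennreal \<delta>) \<and> X \<subseteq> (\<Union>k. U k)}.
        \<Sum>k. ennreal (enn2real (diam d (U k)) powr s))"

definition hausdorff_measure :: "'b set \<Rightarrow> ('b \<Rightarrow> 'b \<Rightarrow> real) \<Rightarrow> real \<Rightarrow> ennreal" where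
  "hausdorff_measure X d s = (SUP \<delta>\<in>{0<..}. hausdorff_content X d s \<delta>)"

text \<open>Restricting to \<open>s > 0\<close> does not change the infimum and avoids a convention for \<open>0 powr 0\<close>;
  the infimum of the empty set is \<open>\<infinity>\<close>.\<close>

definition hausdorff_dim :: "'b set \<Rightarrow> ('b \<Rightarrow> 'b \<Rightarrow> real) \<Rightarrow> ereal" where
  "hausdorff_dim X d = Inf (ereal ` {s. 0 < s \<and> hausdorff_measure X d s = 0})"

end

theory Submission
  imports Defs "HOL-Library.Sublist"
begin

text \<open>Almost surely all \<open>R\<^sub>i\<close> are \<open>1\<close>, so the \<open>i\<close>-th cell is a resistor of resistance \<open>l(i)\<close> in a
  tree-like network. Write \<open>m(\<theta>)\<close> for the expectation of the sum of the \<open>w(a)\<^sup>\<theta>\<close>; then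
  \<open>m\<close> is strictly decreasing, and the \<open>l(i)\<^sup>\<theta>\<close> over the words of length \<open>n\<close> have an expected sum
  \<open>m(\<theta>)\<^sup>n\<close>.

  Upper bound: for \<open>\<theta> > \<alpha>\<close> these sums decay geometrically, and the diameter of a cell is controlled by the
  lengths of its descendants, so coverings by the cells of level \<open>n\<close> show that the \<open>\<theta>\<close>-dimensional
  Hausdorff measure vanishes.

  Lower bound: the harmonic function of a cell, extended by constants, has energy \<open>1 / l(i)\<close>, so two
  points separated by the cell have distance at least \<open>l(i)\<close>. As \<open>w > \<epsilon>\<close>, a set of diameter
  \<open>r\<close> therefore meets at most three cells of the cut into cells of length comparable to \<open>r\<close>, and
  it remains to bound from below the sums of \<open>l(i)\<^sup>s\<close>, \<open>s < \<alpha>\<close>, over finite cuts of the tree of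
  words. Such a sum dominates the level sums of exponent \<open>\<alpha>\<close> up to an error governed by the second
  moments of these sums, which are bounded because \<open>m(2 \<alpha>) < 1\<close>. Averaging over the \<open>3\<^sup>k\<close>
  independent subtrees of level \<open>k\<close> and letting \<open>k\<close> tend to infinity, Chebyshev's inequality gives a positive
  bound almost surely.\<close>

text \<open>The level sums of exponent \<alpha> form a martingale of mean 1, but no limit of it is
  taken. A finite cut can be compared with the level sum at any level below it, so for one level
  \<open>k\<close> it is enough to have small errors at infinitely many \<open>n\<close>, and this
  follows from bounds on expectations that are uniform in \<open>n\<close>.

  The comparison pairs the exponents s = \<alpha> - \<delta> and \<gamma> = \<alpha> + \<delta>.
  With S the level sum of the subtree at i, the product l(i)^\<alpha> S is l(i)^(s/2) times
  l(i)^(\<gamma>/2) S, and the squares of the two factors are a term of the cut sum and an error.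
  The errors from levels at least \<open>k\<close> have expectation of order m(\<gamma>)^k, so only
  deep cuts are controlled; the lower bound on the weights makes sets of small diameter produce deep
  cuts.

  No measure on the fractal is constructed: compactness turns an arbitrary countable covering into
  one finite cut, whose sum is too small if the covering is too cheap.\<close>

section \<open>Words and sums over words\<close>

lemma words_0 [simp]: "words A 0 = {[]}"
  by (auto simp: words_def)

lemma words_Suc: "words A (Suc n) = (\<lambda>(a, i). a # i) ` (A \<times> words A n)"
  by (auto simp: words_def image_iff length_Suc_conv)

lemma UN_words_Suc: "(\<Union>i\<in>words A (Suc n). g i) = (\<Union>a\<in>A. \<Union>i\<in>words A n. g (a # i))"
  by (auto simp: words_Suc)

lemma finite_letters [simp]: "finite letters" and card_letters [simp]: "card letters = 3"
  by (auto simp: letters_def)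

lemma finite_words [simp]: "finite A \<Longrightarrow> finite (words A n)"
  by (induction n) (auto simp: words_Suc)

lemma card_words: "finite A \<Longrightarrow> card (words A n) = card A ^ n"
  unfolding words_def by (rule card_lists_length_eq)

lemma sum_words_Suc: "sum g (words A (Suc n)) = (\<Sum>a\<in>A. \<Sum>i\<in>words A n. g (a # i))"
proof -
  have inj: "inj_on (\<lambda>(a, i). a # i) (A \<times> words A n)" by (auto simp: inj_on_def)
  show ?thesis
    unfolding words_Suc sum.reindex[OF inj] by (simp add: sum.cartesian_product case_prod_unfold)
qed

lemma sum_words_add:
  "sum g (words A (m + n)) = (\<Sum>i\<in>words A m. \<Sum>j\<in>words A n. g (i @ j))"
proof (induction m arbitrary: g)
  case 0
  show ?case by simp
next
  case (Suc m)
  show ?case using Suc[of "\<lambda>i. g (_ # i)"] by (simp add: sum_words_Suc)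
qed

lemma words_appendI: "i \<in> words A m \<Longrightarrow> j \<in> words A n \<Longrightarrow> i @ j \<in> words A (m + n)"
  by (auto simp: words_def)

lemma words_iff: "i \<in> words A n \<longleftrightarrow> i \<in> lists A \<and> length i = n"
  by (auto simp: words_def in_lists_conv_set)

lemma sum_letters: "sum g letters = g 1 + g 2 + g 3"
  by (simp add: letters_def add.assoc)

lemma one_in_letters [simp]: "Suc 0 \<in> letters" "1 \<in> letters" "2 \<in> letters" "3 \<in> letters"
  by (auto simp: letters_def)

section \<open>Geometry of the fractal\<close>

text \<open>The rhombus with vertices (0, 0), (1, 0), (1 / 2, c) and (1 / 2, -c). Every map sends it
  into itself, and images under different letters touch in one point only.\<close>

definition diamond :: "real \<Rightarrow> (real \<times> real) set" where
  "diamond c = {(x, y). \<bar>y\<bar> \<le> 2 * c * x \<and> \<bar>y\<bar> \<le> 2 * c * (1 - x)}"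

text \<open>An image of the rhombus instead of the fractal, so that intersections of cells are
  decided by linear inequalities.\<close>

definition cell :: "real \<Rightarrow> nat list \<Rightarrow> (real \<times> real) set" where
  "cell c i = psi_word c i ` diamond c"

abbreviation corners :: "(real \<times> real) set" where
  "corners \<equiv> {(0, 0), (1, 0)}"

lemma psi_origin [simp]: "psi c a (0, 0) = (1 / 2, 0)"
  by (simp add: psi_def)

lemma psi_1_right [simp]: "psi c (Suc 0) (1, 0) = (0, 0)" and psi_2_right [simp]: "psi c 2 (1, 0) = (1, 0)"
  by (simp_all add: psi_def)

lemma psi_word_append: "psi_word c (i @ j) = psi_word c i \<circ> psi_word c j"
  by (induction i) (auto simp: o_assoc)

locale fractal_parameter =
  fixes c :: real
  assumes c_pos: "0 < c" and c_less: "c < 1 / 2"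
begin

lemma diamond_iff: "(x, y) \<in> diamond c \<longleftrightarrow> \<bar>y\<bar> \<le> 2 * c * x \<and> \<bar>y\<bar> \<le> 2 * c * (1 - x)"
  by (simp add: diamond_def)

lemma diamond_bounds:
  assumes "(x, y) \<in> diamond c"
  shows "0 \<le> x" "x \<le> 1" "\<bar>y\<bar> \<le> x" "\<bar>y\<bar> \<le> 1 - x" "\<bar>y\<bar> \<le> 1 / 2"
proof -
  have *: "\<bar>y\<bar> \<le> 2 * c * x" "\<bar>y\<bar> \<le> 2 * c * (1 - x)" using assms by (auto simp: diamond_iff)
  have "0 \<le> 2 * c * x" "0 \<le> 2 * c * (1 - x)" using * by linarith+
  then show x: "0 \<le> x" "x \<le> 1" using c_pos by (auto simp: zero_le_mult_iff)
  have "2 * c * x \<le> 1 * x" "2 * c * (1 - x) \<le> 1 * (1 - x)"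
    using x c_less by (intro mult_right_mono; simp)+
  then show "\<bar>y\<bar> \<le> x" "\<bar>y\<bar> \<le> 1 - x"
    using *[THEN order_trans] by (simp_all only: mult_1)
  then show "\<bar>y\<bar> \<le> 1 / 2" by linarith
qed

lemma corners_diamond [simp]: "(0, 0) \<in> diamond c" "(1, 0) \<in> diamond c"
  using c_pos by (auto simp: diamond_iff)

lemma psi_inj [simp]: "psi c a p = psi c a q \<longleftrightarrow> p = q"
  using c_pos by (cases p; cases q) (auto simp: psi_def)

lemma dist_psi: "dist (psi c a p) (psi c a q) \<le> dist p q / 2"
proof -
  obtain x y x' y' where pq: "p = (x, y)" "q = (x', y')" by (cases p; cases q)
  have half: "sqrt ((d / 2)\<^sup>2 + (e / 2)\<^sup>2) = sqrt (d\<^sup>2 + e\<^sup>2) / 2" for d e :: real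
    by (simp add: power_divide add_divide_distrib[symmetric] real_sqrt_divide)
  have third: "sqrt ((c * e)\<^sup>2 + (c * d)\<^sup>2) \<le> sqrt (d\<^sup>2 + e\<^sup>2) / 2" for d e :: real
  proof -
    have "sqrt ((c * e)\<^sup>2 + (c * d)\<^sup>2) = c * sqrt (d\<^sup>2 + e\<^sup>2)"
      using c_pos by (simp add: power_mult_distrib distrib_left[symmetric] real_sqrt_mult add.commute)
    also have "\<dots> \<le> 1 / 2 * sqrt (d\<^sup>2 + e\<^sup>2)"
      using c_less by (intro mult_right_mono) auto
    finally show ?thesis by simp
  qed
  have "dist ((1 - x) / 2) ((1 - x') / 2) = dist x x' / 2" "dist (y / 2) (y' / 2) = dist y y' / 2"
    "dist ((1 + x) / 2) ((1 + x') / 2) = dist x x' / 2" "dist (- y / 2) (- y' / 2) = dist y y' / 2"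
    by (auto simp: dist_real_def abs_if field_simps)
  moreover have "dist (1 / 2 + c * y) (1 / 2 + c * y') = c * dist y y'" "dist (c * x) (c * x') = c * dist x x'"
    using c_pos by (auto simp: dist_real_def abs_mult right_diff_distrib[symmetric])
  ultimately show ?thesis
    using third[of "dist y y'" "dist x x'"]
    by (simp only: pq psi_def prod.case dist_Pair_Pair half split: if_split) simp
qed

lemma psi_diamond:
  assumes "p \<in> diamond c"
  shows "psi c a p \<in> diamond c"
proof -
  obtain x y where p: "p = (x, y)" by (cases p)
  have D: "\<bar>y\<bar> \<le> 2 * c * x" "\<bar>y\<bar> \<le> 2 * c * (1 - x)" using assms p by (auto simp: diamond_iff)
  note B = diamond_bounds[OF assms[unfolded p]]
  have cx: "0 \<le> c * x" "0 \<le> c * (1 - x)" "c * \<bar>y\<bar> \<le> c * (1 - x)" "c * \<bar>y\<bar> \<le> c * x"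
    using B c_pos by auto
  have cy: "\<bar>c * y\<bar> = c * \<bar>y\<bar>" using c_pos by (simp add: abs_mult)
  \<comment> \<open>For the third map the claim amounts to 2 c^2 |y| \<le> c (1 - x); both c < 1 / 2
    and |y| \<le> 1 - x enter here.\<close>
  have "2 * c * \<bar>c * y\<bar> \<le> 1 * \<bar>c * y\<bar>" using c_less by (intro mult_right_mono) auto
  then have k: "2 * c * \<bar>c * y\<bar> \<le> c * (1 - x)" using cx cy by linarith
  then have k': "\<bar>2 * c * (c * y)\<bar> \<le> c * (1 - x)"
    using c_pos by (simp add: abs_mult)
  have 1: "\<bar>y / 2\<bar> \<le> 2 * c * ((1 - x) / 2)" "\<bar>y / 2\<bar> \<le> 2 * c * (1 - (1 - x) / 2)"
    using D cx c_pos by (auto simp: field_simps)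
  have 2: "\<bar>- y / 2\<bar> \<le> 2 * c * ((1 + x) / 2)" "\<bar>- y / 2\<bar> \<le> 2 * c * (1 - (1 + x) / 2)"
    using D cx c_pos by (auto simp: field_simps)
  have "\<bar>c * x\<bar> = c * x" using cx by simp
  then have 3: "\<bar>c * x\<bar> \<le> 2 * c * (1 / 2 + c * y)" "\<bar>c * x\<bar> \<le> 2 * c * (1 - (1 / 2 + c * y))"
    using k' by (auto simp: algebra_simps)
  show ?thesis
    using 1 2 3 by (simp add: p psi_def diamond_iff)
qed

text \<open>The images for letters 1 and 2 lie on the two sides of the vertical line through 1 / 2.
  Against letter 3, equality forces x \<le> 2 c |y| \<le> 2 c x, and 2 c < 1 leaves only the
  origin.\<close>

lemma psi_meet:
  assumes ab: "a \<in> letters" "b \<in> letters" "a \<noteq> b" and pq: "p \<in> diamond c" "q \<in> diamond c"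
    and eq: "psi c a p = psi c b q"
  shows "p = (0, 0)" "q = (0, 0)"
proof -
  have 12: "p = (0, 0) \<and> q = (0, 0)"
    if "p \<in> diamond c" "q \<in> diamond c" "psi c 1 p = psi c 2 q" for p q
  proof -
    obtain x y x' y' where e: "p = (x, y)" "q = (x', y')" by (cases p; cases q)
    show ?thesis using that diamond_bounds[of x y] diamond_bounds[of x' y'] by (auto simp: e psi_def)
  qed
  have small: "x = 0 \<and> y = 0"
    if "(x, y) \<in> diamond c" "2 * c * x \<le> 2 * c * (2 * c * \<bar>y\<bar>)" for x y
  proof -
    note B = diamond_bounds[OF that(1)]
    have "x \<le> 2 * c * \<bar>y\<bar>" using that(2) c_pos by simp
    also have "\<dots> \<le> 2 * c * x" using B c_pos by simp
    finally have "(1 - 2 * c) * x \<le> 0" by (simp add: algebra_simps)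
    then have "x \<le> 0" using c_less by (simp add: mult_le_0_iff)
    then show ?thesis using B by auto
  qed
  have k3: "p = (0, 0) \<and> q = (0, 0)"
    if "p \<in> diamond c" "q \<in> diamond c" "k = 1 \<or> k = 2" "psi c 3 p = psi c k q" for p q k
  proof -
    obtain x y x' y' where e: "p = (x, y)" "q = (x', y')" by (cases p; cases q)
    note B = diamond_bounds[OF that(1)[unfolded e]] diamond_bounds[OF that(2)[unfolded e]]
    have "0 \<le> c * x" "c * \<bar>y\<bar> = \<bar>c * y\<bar>" using B c_pos by (auto simp: abs_mult)
    then have "\<bar>y'\<bar> = 2 * (c * x)" "x' = 2 * c * \<bar>y\<bar>"
      using that(3,4) B by (auto simp: e psi_def)
    moreover have "\<bar>y'\<bar> \<le> 2 * c * x'" using that(2) e by (auto simp: diamond_iff)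
    ultimately have "2 * c * x \<le> 2 * c * (2 * c * \<bar>y\<bar>)" by simp
    then have *: "x = 0 \<and> y = 0" using small that(1) e by blast
    then show ?thesis using \<open>\<bar>y'\<bar> = _\<close> \<open>x' = _\<close> e by simp
  qed
  have "a = 1 \<or> a = 2 \<or> a = 3" "b = 1 \<or> b = 2 \<or> b = 3" using ab by (auto simp: letters_def)
  then have "p = (0, 0) \<and> q = (0, 0)"
    using ab(3) 12[OF pq] 12[OF pq(2,1)] k3[OF pq] k3[OF pq(2,1)] eq by metis
  then show "p = (0, 0)" "q = (0, 0)" by auto
qed

lemma psi_eq_left:
  assumes "p \<in> diamond c" "psi c a p = (0, 0)"
  shows "a = 1" "p = (1, 0)"
proof -
  obtain x y where e: "p = (x, y)" by (cases p)
  note B = diamond_bounds[OF assms(1)[unfolded e]]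
  have "c * \<bar>y\<bar> \<le> c * (1 / 2)" using B c_pos by (intro mult_left_mono) auto
  also have "\<dots> < 1 / 2" using c_less by simp
  finally have "\<bar>c * y\<bar> < 1 / 2" using c_pos by (simp add: abs_mult)
  then show "a = 1" "p = (1, 0)"
    using assms(2) B by (auto simp: e psi_def split: if_splits)
qed

lemma psi_eq_right:
  assumes "p \<in> diamond c" "psi c a p = (1, 0)"
  shows "a = 2" "p = (1, 0)"
proof -
  obtain x y where e: "p = (x, y)" by (cases p)
  note B = diamond_bounds[OF assms(1)[unfolded e]]
  have "c * \<bar>y\<bar> \<le> c * (1 / 2)" using B c_pos by (intro mult_left_mono) auto
  also have "\<dots> < 1 / 2" using c_less by simp
  finally have "\<bar>c * y\<bar> < 1 / 2" using c_pos by (simp add: abs_mult)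
  then show "a = 2" "p = (1, 0)"
    using assms(2) B by (auto simp: e psi_def split: if_splits)
qed

lemma psi_word_inj [simp]: "psi_word c i p = psi_word c i q \<longleftrightarrow> p = q"
  by (induction i) auto

lemma psi_word_diamond: "p \<in> diamond c \<Longrightarrow> psi_word c i p \<in> diamond c"
  by (induction i) (auto intro: psi_diamond)

lemma dist_psi_word: "dist (psi_word c i p) (psi_word c i q) \<le> dist p q / 2 ^ length i"
proof (induction i)
  case (Cons a i)
  have "dist (psi_word c (a # i) p) (psi_word c (a # i) q) \<le> dist (psi_word c i p) (psi_word c i q) / 2"
    using dist_psi by simp
  also have "\<dots> \<le> dist p q / 2 ^ length i / 2" using Cons by simp
  finally show ?case by (simp add: mult.commute)
qed simp

lemma continuous_psi_word: "continuous_on A (psi_word c i)"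
proof (rule lipschitz_on_continuous_on[of 1], rule lipschitz_onI)
  fix p q :: "real \<times> real"
  have "dist p q / 2 ^ length i \<le> dist p q / 1" by (intro divide_left_mono) auto
  then show "dist (psi_word c i p) (psi_word c i q) \<le> 1 * dist p q" using dist_psi_word[of i p q] by simp
qed simp

end

section \<open>Cells and vertex sets\<close>

context fractal_parameter
begin

lemma cell_append: "cell c (i @ j) = psi_word c i ` cell c j"
  by (simp add: cell_def psi_word_append image_comp)

lemma cell_Nil [simp]: "cell c [] = diamond c"
  by (simp add: cell_def)

lemma cell_Cons: "cell c (a # i) = psi c a ` cell c i"
  by (simp add: cell_def image_comp)

lemma cell_subset_diamond: "cell c i \<subseteq> diamond c"
  by (auto simp: cell_def psi_word_diamond)

text \<open>Within the rhombus, a preimage of either corner under any map is the right corner, so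
  the induction never leaves the corners.\<close>

lemma corner_in_cell: "v \<in> corners \<Longrightarrow> v \<in> cell c i \<Longrightarrow> v \<in> psi_word c i ` corners"
proof (induction i arbitrary: v)
  case (Cons a i)
  then obtain q where q: "q \<in> cell c i" "v = psi c a q" by (auto simp: cell_Cons)
  have "q = (1, 0)"
    using psi_eq_left(2) psi_eq_right(2) q cell_subset_diamond Cons.prems(1) by blast
  then show ?case using Cons.IH[of q] q by auto
qed simp

text \<open>Two such cells can only meet in \<open>psi_word c k (1 / 2, 0)\<close>, where \<open>k\<close> is the longest common prefix
  of \<open>i\<close> and \<open>j\<close>.\<close>

lemma cell_Int_parallel:
  assumes "i \<parallel> j" "i \<in> lists letters" "j \<in> lists letters"
  shows "cell c i \<inter> cell c j \<subseteq> psi_word c i ` corners"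
proof
  fix p assume p: "p \<in> cell c i \<inter> cell c j"
  obtain as a bs b cs where *: "a \<noteq> b" "i = as @ a # bs" "j = as @ b # cs"
    using parallel_decomp[OF assms(1)] by blast
  obtain q r where q: "q \<in> cell c bs" "p = psi_word c as (psi c a q)"
    and r: "r \<in> cell c cs" "p = psi_word c as (psi c b r)"
    using p * by (auto simp: cell_append cell_Cons)
  have "q = (0, 0)"
    using psi_meet(1)[of a b q r] q r * assms(2,3) cell_subset_diamond by auto
  then have "q \<in> psi_word c bs ` corners" using corner_in_cell q by blast
  then show "p \<in> psi_word c i ` corners" using q * by (auto simp: psi_word_append)
qed

lemma V_level_0 [simp]: "V_level c 0 = corners"
  by (simp add: V_level_def)

lemma V_level_Suc: "V_level c (Suc n) = (\<Union>a\<in>letters. psi c a ` V_level c n)"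
  unfolding V_level_def UN_words_Suc psi_word.simps image_UN image_comp ..

lemma V_level_subset_Suc: "V_level c n \<subseteq> V_level c (Suc n)"
proof (induction n)
  case 0
  have "psi c 1 (1, 0) = (0, 0)" "psi c 2 (1, 0) = (1, 0)" by (auto simp: psi_def)
  then show ?case unfolding V_level_Suc V_level_0
    by (intro insert_subsetI UN_I[of 1] UN_I[of 2] image_eqI[of _ "psi c _" "(1, 0)"] empty_subsetI) auto
next
  case (Suc n)
  show ?case unfolding V_level_Suc[of "Suc n"] by (subst V_level_Suc) (intro UN_mono image_mono Suc order_refl)
qed

lemma V_level_mono: "m \<le> n \<Longrightarrow> V_level c m \<subseteq> V_level c n"
  by (rule lift_Suc_mono_le[of "V_level c"]) (use V_level_subset_Suc in auto)

lemma V_star_eq: "V_star c = (\<Union>a\<in>letters. psi c a ` V_star c)"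
proof
  show "V_star c \<subseteq> (\<Union>a\<in>letters. psi c a ` V_star c)"
  proof
    fix p assume "p \<in> V_star c"
    then obtain n where "p \<in> V_level c n" by (auto simp: V_star_def)
    then have "p \<in> V_level c (Suc n)" using V_level_subset_Suc by blast
    then show "p \<in> (\<Union>a\<in>letters. psi c a ` V_star c)"
      unfolding V_level_Suc V_star_def by blast
  qed
  show "(\<Union>a\<in>letters. psi c a ` V_star c) \<subseteq> V_star c"
  proof (intro subsetI, elim UN_E imageE)
    fix q a p assume "a \<in> letters" "p \<in> V_star c" and q: "q = psi c a p"
    then obtain n where "psi c a p \<in> V_level c (Suc n)" unfolding V_level_Suc V_star_def by blast
    then show "q \<in> V_star c" unfolding V_star_def q by blast
  qed
qed

lemma corners_V_star [simp]: "(0, 0) \<in> V_star c" "(1, 0) \<in> V_star c"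
  using V_level_0 by (auto simp: V_star_def simp del: V_level_0)

lemma psi_V_star: "a \<in> letters \<Longrightarrow> p \<in> V_star c \<Longrightarrow> psi c a p \<in> V_star c"
  using V_star_eq by blast

lemma psi_word_V_star: "i \<in> lists letters \<Longrightarrow> p \<in> V_star c \<Longrightarrow> psi_word c i p \<in> V_star c"
  by (induction i) (auto intro: psi_V_star)

lemma V_level_subset_diamond: "V_level c n \<subseteq> diamond c"
  by (auto simp: V_level_def psi_word_diamond)

lemma V_star_subset_diamond: "V_star c \<subseteq> diamond c"
  using V_level_subset_diamond by (auto simp: V_star_def)

text \<open>A priori the vertex may stem from another cell. But a point shared by the images for two
  letters is the image of the origin, which is itself a vertex.\<close>

lemma V_star_Int_cell:
  assumes "i \<in> lists letters" "p \<in> V_star c" "p \<in> cell c i"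
  shows "p \<in> psi_word c i ` V_star c"
  using assms
proof (induction i arbitrary: p)
  case (Cons a i)
  obtain q where q: "q \<in> cell c i" "p = psi c a q" using Cons.prems by (auto simp: cell_Cons)
  obtain b r where r: "b \<in> letters" "r \<in> V_star c" "p = psi c b r" using Cons.prems V_star_eq by blast
  have "q \<in> V_star c"
  proof (cases "a = b")
    case False
    have "q \<in> diamond c" "r \<in> diamond c"
      using q r cell_subset_diamond V_star_subset_diamond by blast+
    then have "q = (0, 0)" using psi_meet(1)[of a b q r] q r False Cons.hyps(1) by auto
    then show ?thesis by simp
  qed (use q r in auto)
  then have "q \<in> psi_word c i ` V_star c" using Cons q by auto
  then show ?case using q by auto
qed simp

lemma compact_diamond: "compact (diamond c)"
proof -
  have "diamond c = {p. \<bar>snd p\<bar> \<le> 2 * c * fst p} \<inter> {p. \<bar>snd p\<bar> \<le> 2 * c * (1 - fst p)}"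
    by (auto simp: diamond_iff)
  then have "closed (diamond c)"
    by (auto intro!: closed_Int closed_Collect_le continuous_intros)
  moreover have "diamond c \<subseteq> cbox (0, -1) (1, 1)"
  proof
    fix p assume "p \<in> diamond c"
    moreover obtain x y where "p = (x, y)" by (cases p)
    ultimately show "p \<in> cbox (0, -1) (1, 1)"
      using diamond_bounds[of x y] by (simp add: cbox_Pair_eq abs_le_iff)
  qed
  then have "bounded (diamond c)" using bounded_cbox bounded_subset by blast
  ultimately show ?thesis by (simp add: compact_eq_bounded_closed)
qed

lemma compact_cell: "compact (cell c i)"
  unfolding cell_def by (rule compact_continuous_image[OF continuous_psi_word compact_diamond])

text \<open>Two disjoint ones among finitely many compact cells have positive distance. This
  converts closeness in the plane into adjacency of cells, on which the continuity of the resistance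
  rests.\<close>

lemma cell_separation:
  "\<exists>d>0. \<forall>i\<in>words letters n. \<forall>j\<in>words letters n. \<forall>p\<in>cell c i. \<forall>q\<in>cell c j.
     dist p q < d \<longrightarrow> cell c i \<inter> cell c j \<noteq> {}"
proof -
  have "\<exists>d>0. \<forall>p\<in>cell c i. \<forall>q\<in>cell c j. dist p q < d \<longrightarrow> cell c i \<inter> cell c j \<noteq> {}" for i j
  proof (cases "cell c i \<inter> cell c j = {}")
    case True
    then obtain d where "d > 0" "\<forall>p\<in>cell c i. \<forall>q\<in>cell c j. d \<le> dist p q"
      using separate_compact_closed[OF compact_cell compact_imp_closed[OF compact_cell]] by metis
    then show ?thesis by (intro exI[of _ d]) force
  qed (auto intro: exI[of _ 1])
  then obtain d where d: "d i j > 0"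
    "\<forall>p\<in>cell c i. \<forall>q\<in>cell c j. dist p q < d i j \<longrightarrow> cell c i \<inter> cell c j \<noteq> {}" for i j
    by metis
  let ?d = "Min ((\<lambda>(i, j). d i j) ` (words letters n \<times> words letters n))"
  have ne: "words letters n \<noteq> {}"
    using card_words[of letters n] by auto
  show ?thesis
  proof (intro exI[of _ ?d] conjI ballI impI)
    show "?d > 0" using ne d(1) by (subst Min_gr_iff) auto
    fix i j p q assume *: "i \<in> words letters n" "j \<in> words letters n" "p \<in> cell c i" "q \<in> cell c j"
      "dist p q < ?d"
    have "?d \<le> d i j" using * by (intro Min_le) auto
    then show "cell c i \<inter> cell c j \<noteq> {}" using d(2) * by force
  qed
qed

section \<open>The fractal as the closure of the vertices\<close>

lemma invariant_words:
  assumes "T = (\<Union>a\<in>letters. psi c a ` T)"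
  shows "T = (\<Union>i\<in>words letters n. psi_word c i ` T)"
proof (induction n)
  case (Suc n)
  have "(\<Union>i\<in>words letters (Suc n). psi_word c i ` T) =
    (\<Union>a\<in>letters. psi c a ` (\<Union>i\<in>words letters n. psi_word c i ` T))"
    unfolding UN_words_Suc psi_word.simps image_UN image_comp ..
  then show ?case using Suc assms by simp
qed simp

text \<open>A point of T is the image of some x in T under a word of length n, and the image of a
  fixed q in T' under the same word is within dist q x / 2^n of it. Boundedness of T makes this
  uniformly small, and closedness of T' absorbs the limit. Used in both directions, it gives
  uniqueness of the fractal.\<close>

lemma invariant_subset:
  assumes T: "T = (\<Union>a\<in>letters. psi c a ` T)" "bounded T"
    and T': "T' = (\<Union>a\<in>letters. psi c a ` T')" "T' \<noteq> {}" "closed T'"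
  shows "T \<subseteq> T'"
proof
  fix p assume p: "p \<in> T"
  obtain q where q: "q \<in> T'" using T' by blast
  obtain e where e: "\<And>x. x \<in> T \<Longrightarrow> dist x q \<le> e"
    using T(2) bounded_any_center[of T q] by (auto simp: dist_commute)
  have "\<exists>r\<in>T'. dist r p < \<epsilon>" if "\<epsilon> > 0" for \<epsilon>
  proof -
    obtain n where "norm (e / 2 ^ n - 0) < \<epsilon>"
      using LIMSEQ_D[OF LIMSEQ_divide_realpow_zero[of 2 e] \<open>\<epsilon> > 0\<close>] by auto
    then have n: "e / 2 ^ n < \<epsilon>" by (simp only: diff_0_right real_norm_def abs_less_iff)
    obtain i x where i: "i \<in> words letters n" "x \<in> T" "p = psi_word c i x"
      using p invariant_words[OF T(1), of n] by blast
    have "dist (psi_word c i q) p \<le> dist q x / 2 ^ n"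
      using dist_psi_word[of i q x] i by (auto simp: words_def)
    also have "\<dots> \<le> e / 2 ^ n" using e[OF i(2)] by (simp add: divide_right_mono dist_commute)
    finally have "dist (psi_word c i q) p < \<epsilon>" using n by simp
    moreover have "psi_word c i q \<in> T'" using invariant_words[OF T'(1), of n] i q by blast
    ultimately show ?thesis by blast
  qed
  then show "p \<in> T'" using closed_approachable[OF T'(3)] by blast
qed

lemma closure_V_star: "closure (V_star c) \<subseteq> diamond c" "compact (closure (V_star c))"
  "closure (V_star c) = (\<Union>a\<in>letters. psi c a ` closure (V_star c))"
proof -
  show D: "closure (V_star c) \<subseteq> diamond c"
    by (simp add: closure_minimal V_star_subset_diamond compact_diamond compact_imp_closed)
  then show K: "compact (closure (V_star c))"
    using compact_diamond by (meson bounded_subset closed_closure compact_eq_bounded_closed)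
  have psi: "continuous_on A (psi c a)" for A a using continuous_psi_word[of A "[a]"] by simp
  have "psi c a ` closure (V_star c) = closure (psi c a ` V_star c)" for a
  proof
    show "psi c a ` closure (V_star c) \<subseteq> closure (psi c a ` V_star c)"
      by (intro image_closure_subset psi closed_closure closure_subset)
    show "closure (psi c a ` V_star c) \<subseteq> psi c a ` closure (V_star c)"
      by (intro closure_minimal image_mono closure_subset compact_imp_closed
          compact_continuous_image psi K)
  qed
  then have "(\<Union>a\<in>letters. psi c a ` closure (V_star c)) = closure (\<Union>a\<in>letters. psi c a ` V_star c)"
    by (simp add: letters_def)
  then show "closure (V_star c) = (\<Union>a\<in>letters. psi c a ` closure (V_star c))"
    using V_star_eq by simp
qed

lemma fractal_eq_closure: "fractal c = closure (V_star c)"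
  unfolding fractal_def
proof (rule the_equality)
  show "closure (V_star c) \<noteq> {} \<and> compact (closure (V_star c)) \<and>
      closure (V_star c) = (\<Union>a\<in>letters. psi c a ` closure (V_star c))"
    using closure_V_star(2,3) corners_V_star(1) closure_subset by blast
  fix T assume T: "T \<noteq> {} \<and> compact T \<and> T = (\<Union>a\<in>letters. psi c a ` T)"
  have ne: "closure (V_star c) \<noteq> {}" using corners_V_star(1) closure_subset by blast
  have "bounded T" "closed T" using T compact_imp_bounded compact_imp_closed by blast+
  moreover have "bounded (closure (V_star c))" by (rule compact_imp_bounded[OF closure_V_star(2)])
  ultimately show "T = closure (V_star c)"
    using invariant_subset[OF _ _ closure_V_star(3) ne] invariant_subset[OF closure_V_star(3)] T
    by (intro equalityI) blast+
qed

definition fractal_cell :: "nat list \<Rightarrow> (real \<times> real) set" where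
  "fractal_cell i = psi_word c i ` fractal c"

lemma fractal_words: "fractal c = (\<Union>i\<in>words letters n. fractal_cell i)"
  unfolding fractal_cell_def fractal_eq_closure by (rule invariant_words[OF closure_V_star(3)])

lemma fractal_cell_append: "fractal_cell (i @ j) = psi_word c i ` fractal_cell j"
  by (simp add: fractal_cell_def psi_word_append image_comp)

lemma fractal_cell_Nil [simp]: "fractal_cell [] = fractal c"
  by (simp add: fractal_cell_def)

lemma fractal_cell_append_subset: "j \<in> lists letters \<Longrightarrow> fractal_cell (i @ j) \<subseteq> fractal_cell i"
  unfolding fractal_cell_append fractal_cell_def[of i] fractal_words[of "length j"]
  by (intro image_mono UN_upper) (simp add: words_iff)

lemma fractal_cell_subset: "i \<in> lists letters \<Longrightarrow> fractal_cell i \<subseteq> fractal c"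
  using fractal_cell_append_subset[of i "[]"] by simp

lemma compact_fractal_cell: "compact (fractal_cell i)"
  unfolding fractal_cell_def fractal_eq_closure
  by (rule compact_continuous_image[OF continuous_psi_word closure_V_star(2)])

lemma fractal_cell_nonempty: "fractal_cell i \<noteq> {}"
  using corners_V_star(1) unfolding fractal_cell_def fractal_eq_closure by fastforce

lemma fractal_cell_limit:
  assumes "x \<in> fractal_cell i"
  obtains xs where "range xs \<subseteq> psi_word c i ` V_star c" "xs \<longlonglongrightarrow> x"
proof -
  obtain y where y: "y \<in> closure (V_star c)" "x = psi_word c i y"
    using assms by (auto simp: fractal_cell_def fractal_eq_closure)
  obtain ys where ys: "\<And>n. ys n \<in> V_star c" "ys \<longlonglongrightarrow> y"
    using y(1) unfolding closure_sequential by auto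
  have "isCont (psi_word c i) y"
    using continuous_psi_word[of UNIV] continuous_on_eq_continuous_at[OF open_UNIV] by blast
  then have "(\<lambda>n. psi_word c i (ys n)) \<longlonglongrightarrow> x" using ys y isCont_tendsto_compose by blast
  then show ?thesis using that[of "\<lambda>n. psi_word c i (ys n)"] ys by auto
qed

end

section \<open>The energy of a realization of the cascade\<close>

text \<open>The cascade seen from the word \<open>i\<close>. Most inductions below peel off the
  first letter and pass to its subcascade, which is why they keep \<open>u\<close>
  arbitrary.\<close>

definition subcascade :: "(nat list \<Rightarrow> 'b) \<Rightarrow> nat list \<Rightarrow> nat list \<Rightarrow> 'b" where
  "subcascade u i = (\<lambda>j. u (i @ j))"

text \<open>The almost sure event on which the deterministic part runs. It constrains all words at
  once, so it is inherited by subcascades.\<close>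

definition balanced :: "real \<Rightarrow> (nat list \<Rightarrow> real) \<Rightarrow> bool" where
  "balanced \<epsilon> u \<longleftrightarrow> 0 < \<epsilon> \<and>
     (\<forall>i\<in>lists letters. (\<forall>a\<in>letters. \<epsilon> < u (i @ [a]) \<and> u (i @ [a]) \<le> 1) \<and> u (i @ [1]) + u (i @ [2]) = 1)"

lemma subcascade_apply: "subcascade u i j = u (i @ j)"
  by (simp add: subcascade_def)

lemma subcascade_append: "subcascade (subcascade u i) j = subcascade u (i @ j)"
  by (simp add: subcascade_def)

lemma subcascade_Nil [simp]: "subcascade u [] = u"
  by (simp add: subcascade_def)

lemma cell_length_Nil [simp]: "cell_length u [] = 1"
  by (simp add: cell_length_def)

lemma cell_length_snoc: "cell_length u (i @ [a]) = cell_length u i * u (i @ [a])"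
proof -
  have "(\<Prod>m = 1..length i. u (take m (i @ [a]))) = (\<Prod>m = 1..length i. u (take m i))"
    by (intro prod.cong) auto
  then show ?thesis by (simp add: cell_length_def)
qed

lemma cell_length_append: "cell_length u (i @ j) = cell_length u i * cell_length (subcascade u i) j"
proof (induction j rule: rev_induct)
  case (snoc a j)
  show ?case
    using snoc cell_length_snoc[of u "i @ j" a] cell_length_snoc[of "subcascade u i" j a]
    by (simp add: subcascade_apply[of u i "j @ [a]"])
qed simp

lemma cell_length_single [simp]: "cell_length u [a] = u [a]"
  by (simp add: cell_length_def)

lemma cell_length_Cons: "cell_length u (a # i) = u [a] * cell_length (subcascade u [a]) i"
  using cell_length_append[of u "[a]" i] by simp

lemma balanced_subcascade: "balanced \<epsilon> u \<Longrightarrow> i \<in> lists letters \<Longrightarrow> balanced \<epsilon> (subcascade u i)"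
  unfolding balanced_def subcascade_apply append_assoc[symmetric] by (metis append_in_lists_conv)

lemma balancedD:
  assumes "balanced \<epsilon> u"
  shows "0 < \<epsilon>" "a \<in> letters \<Longrightarrow> \<epsilon> < u [a]" "a \<in> letters \<Longrightarrow> 0 < u [a]"
    "a \<in> letters \<Longrightarrow> u [a] \<le> 1" "u [Suc 0] + u [2] = 1"
proof -
  have *: "0 < \<epsilon> \<and> (\<forall>a\<in>letters. \<epsilon> < u [a] \<and> u [a] \<le> 1) \<and> u [1] + u [2] = 1"
    using assms unfolding balanced_def by (metis append_Nil lists.Nil)
  then show "0 < \<epsilon>" "a \<in> letters \<Longrightarrow> \<epsilon> < u [a]" "a \<in> letters \<Longrightarrow> 0 < u [a]"
    "a \<in> letters \<Longrightarrow> u [a] \<le> 1" "u [Suc 0] + u [2] = 1" by force+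
qed

lemma cell_length_pos: "balanced \<epsilon> u \<Longrightarrow> i \<in> lists letters \<Longrightarrow> 0 < cell_length u i"
proof (induction i arbitrary: u rule: list.induct)
  case (Cons a i)
  then have "balanced \<epsilon> (subcascade u [a])" by (intro balanced_subcascade) auto
  then show ?case
    using Cons balancedD(3)[OF Cons.prems(1), of a] by (simp add: cell_length_Cons)
qed simp

lemma cell_length_le_1: "balanced \<epsilon> u \<Longrightarrow> i \<in> lists letters \<Longrightarrow> cell_length u i \<le> 1"
proof (induction i arbitrary: u rule: list.induct)
  case (Cons a i)
  then have a: "a \<in> letters" "i \<in> lists letters" by auto
  have b: "balanced \<epsilon> (subcascade u [a])" using Cons a by (intro balanced_subcascade) auto
  show ?case
    unfolding cell_length_Cons using Cons.IH[OF b a(2)] balancedD[OF Cons.prems(1)] a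
      cell_length_pos[OF b a(2)] by (intro mult_le_one) (auto intro: less_imp_le)
qed simp

lemma cell_length_ge: "balanced \<epsilon> u \<Longrightarrow> i \<in> lists letters \<Longrightarrow> \<epsilon> ^ length i \<le> cell_length u i"
proof (induction i arbitrary: u rule: list.induct)
  case (Cons a i)
  then have a: "a \<in> letters" "i \<in> lists letters" by auto
  have b: "balanced \<epsilon> (subcascade u [a])" using Cons a by (intro balanced_subcascade) auto
  show ?case
    unfolding cell_length_Cons using Cons.IH[OF b a(2)] balancedD[OF Cons.prems(1)] a
    by (auto intro!: mult_mono) (auto intro: less_imp_le)
qed simp

text \<open>The words over 1 and 2 form the chain of edges joining the two corners. Each edge is
  replaced by two whose lengths add up to its own, so the total is conserved; hence all R_i equal
  1.\<close>

lemma sum_cell_length_bridge: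
  "balanced \<epsilon> u \<Longrightarrow> (\<Sum>j\<in>words {1, 2} n. cell_length u j) = 1"
proof (induction n arbitrary: u)
  case (Suc n)
  have "balanced \<epsilon> (subcascade u [a])" if "a \<in> {1, 2}" for a
    using that Suc.prems by (intro balanced_subcascade) auto
  then have "(\<Sum>j\<in>words {1, 2} (Suc n). cell_length u j) = (\<Sum>a\<in>{1, 2}. u [a] * 1)"
    unfolding sum_words_Suc cell_length_Cons sum_distrib_left[symmetric]
    using Suc.IH by (intro sum.cong) auto
  then show ?case using balancedD(5)[OF Suc.prems] by simp
qed simp

lemma cell_resistance_balanced:
  assumes "balanced \<epsilon> u" "i \<in> lists letters"
  shows "cell_resistance u i = 1"
proof -
  have "(\<Sum>j\<in>words {1, 2} n. cell_length u (i @ j) / cell_length u i) = 1" for n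
    using sum_cell_length_bridge[OF balanced_subcascade[OF assms]] cell_length_pos[OF assms]
    by (simp add: cell_length_append)
  then show ?thesis by (simp add: cell_resistance_def)
qed

definition energy_at :: "real \<Rightarrow> (nat list \<Rightarrow> real) \<Rightarrow> nat \<Rightarrow> (real \<times> real \<Rightarrow> real) \<Rightarrow> real" where
  "energy_at c u n f =
     (\<Sum>i\<in>words letters n. (f (psi_word c i (0, 0)) - f (psi_word c i (1, 0)))\<^sup>2 / cell_length u i)"

lemma level_energy_balanced: "balanced \<epsilon> u \<Longrightarrow> level_energy c u n f = energy_at c u n f"
  unfolding level_energy_def energy_at_def
  by (intro sum.cong) (auto simp: cell_resistance_balanced words_iff)

lemma energy_at_0 [simp]: "energy_at c u 0 f = (f (0, 0) - f (1, 0))\<^sup>2"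
  by (simp add: energy_at_def)

lemma energy_at_Suc:
  "energy_at c u (Suc n) f = (\<Sum>a\<in>letters. energy_at c (subcascade u [a]) n (f \<circ> psi c a) / u [a])"
  unfolding energy_at_def sum_words_Suc sum_divide_distrib
  by (intro sum.cong) (auto simp: cell_length_Cons)

lemma energy_at_cong:
  "(\<And>p. p \<in> V_level c n \<Longrightarrow> f p = g p) \<Longrightarrow> energy_at c u n f = energy_at c u n g"
  unfolding energy_at_def
proof (intro sum.cong refl)
  fix i assume *: "\<And>p. p \<in> V_level c n \<Longrightarrow> f p = g p" and "i \<in> words letters n"
  then have "psi_word c i v \<in> V_level c n" if "v \<in> corners" for v
    using that unfolding V_level_def by blast
  from * [OF this[of "(0, 0)"]] * [OF this[of "(1, 0)"]]
  show "(f (psi_word c i (0, 0)) - f (psi_word c i (1, 0)))\<^sup>2 / cell_length u i =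
    (g (psi_word c i (0, 0)) - g (psi_word c i (1, 0)))\<^sup>2 / cell_length u i" by simp
qed

lemma energy_at_affine: "energy_at c u n (\<lambda>p. r * f p + s) = r\<^sup>2 * energy_at c u n f"
  unfolding energy_at_def sum_distrib_left
  by (intro sum.cong refl) (simp add: power_mult_distrib[symmetric] right_diff_distrib)

lemma energy_at_nonneg: "balanced \<epsilon> u \<Longrightarrow> 0 \<le> energy_at c u n f"
  unfolding energy_at_def
  by (intro sum_nonneg divide_nonneg_pos) (auto simp: words_iff cell_length_pos)

text \<open>Subdividing an edge puts resistors w and 1 - w in series, and minimising over the value
  at the new midpoint gives back the old energy. The third letter hangs a dead end on the midpoint,
  which can only add energy.\<close>

lemma energy_at_mono: "balanced \<epsilon> u \<Longrightarrow> energy_at c u n f \<le> energy_at c u (Suc n) f"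
proof (induction n arbitrary: u f)
  case 0
  note b = balancedD[OF 0]
  define m l r t where "m = f (1 / 2, 0)" and "l = f (0, 0)" and "r = f (1, 0)" and "t = f (psi c 3 (1, 0))"
  define w where "w = u [Suc 0]"
  have w: "0 < w" "0 < 1 - w" "u [2] = 1 - w" using b(3)[of 1] b(3)[of 2] b(5) by (auto simp: w_def)
  have "(l - r)\<^sup>2 * (w * (1 - w)) \<le> (m - l)\<^sup>2 * (1 - w) + (m - r)\<^sup>2 * w"
  proof -
    \<comment> \<open>The minimising value at the midpoint is l (1 - w) + r w; the difference of the
      two sides is the square of the distance to it.\<close>
    have "(m - l)\<^sup>2 * (1 - w) + (m - r)\<^sup>2 * w - (l - r)\<^sup>2 * (w * (1 - w)) = (m - l * (1 - w) - r * w)\<^sup>2"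
      by (simp add: power2_eq_square algebra_simps)
    then show ?thesis by (smt (verit) zero_le_power2)
  qed
  then have "(l - r)\<^sup>2 \<le> (m - l)\<^sup>2 / w + (m - r)\<^sup>2 / (1 - w)"
    using w by (simp add: field_simps)
  moreover have "0 \<le> (m - t)\<^sup>2 / u [3]" using b(3)[of 3] by simp
  ultimately show ?case
    using w by (simp add: energy_at_Suc sum_letters m_def l_def r_def t_def w_def)
next
  case (Suc n)
  have "balanced \<epsilon> (subcascade u [a])" if "a \<in> letters" for a
    using that Suc.prems by (intro balanced_subcascade) auto
  then show ?case
    unfolding energy_at_Suc[of c u n] energy_at_Suc[of c u "Suc n"]
    using Suc.IH balancedD(3)[OF Suc.prems] by (intro sum_mono divide_right_mono) (auto intro: less_imp_le)
qed

section \<open>Test functions\<close>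

definition psi_inv :: "real \<Rightarrow> nat \<Rightarrow> real \<times> real \<Rightarrow> real \<times> real" where
  "psi_inv c a = inv (psi c a)"

text \<open>\<open>harmonic c n u\<close> restricts on the \<open>n\<close>-th vertex set to the harmonic function with boundary
  values \<open>0\<close> and \<open>1\<close> at the left and the right corner.\<close>

fun harmonic :: "real \<Rightarrow> nat \<Rightarrow> (nat list \<Rightarrow> real) \<Rightarrow> real \<times> real \<Rightarrow> real" where
  "harmonic c 0 u p = fst p"
| "harmonic c (Suc n) u p =
    (if p \<in> psi c 1 ` diamond c then u [1] * (1 - harmonic c n (subcascade u [1]) (psi_inv c 1 p))
     else if p \<in> psi c 2 ` diamond c then u [1] + u [2] * harmonic c n (subcascade u [2]) (psi_inv c 2 p)
     else u [1])"

text \<open>At a vertex the sequence is eventually constant, and energies see only the values at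
  vertices.\<close>

definition harmonic_lim :: "real \<Rightarrow> (nat list \<Rightarrow> real) \<Rightarrow> real \<times> real \<Rightarrow> real" where
  "harmonic_lim c u p = lim (\<lambda>n. harmonic c n u p)"

text \<open>The harmonic function of the cell \<open>i\<close>, extended so as to be constant on each component of
  the complement of the cell.\<close>

fun cell_function :: "real \<Rightarrow> (nat list \<Rightarrow> real) \<Rightarrow> nat list \<Rightarrow> real \<times> real \<Rightarrow> real" where
  "cell_function c u [] = harmonic_lim c u"
| "cell_function c u (a # i) = (\<lambda>p.
    if p \<in> psi c a ` diamond c then cell_function c (subcascade u [a]) i (psi_inv c a p)
    else cell_function c (subcascade u [a]) i (0, 0))"

context fractal_parameter
begin

lemma psi_inv_psi [simp]: "psi_inv c a (psi c a p) = p"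
  unfolding psi_inv_def by (rule inv_f_f) (simp add: inj_def)

lemma psi_image_iff: "psi c a p \<in> psi c a ` S \<longleftrightarrow> p \<in> S"
  by auto

lemma corners_psi:
  "(0, 0) \<in> psi c a ` diamond c \<longleftrightarrow> a = 1" "(1, 0) \<in> psi c a ` diamond c \<longleftrightarrow> a = 2"
proof -
  have "(0, 0) \<in> psi c 1 ` diamond c" by (rule image_eqI[of _ _ "(1, 0)"]) auto
  then show "(0, 0) \<in> psi c a ` diamond c \<longleftrightarrow> a = 1" using psi_eq_left by (metis imageE)
  have "(1, 0) \<in> psi c 2 ` diamond c" by (rule image_eqI[of _ _ "(1, 0)"]) auto
  then show "(1, 0) \<in> psi c a ` diamond c \<longleftrightarrow> a = 2" using psi_eq_right by (metis imageE)
qed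

lemma psi_inv_corners [simp]: "psi_inv c (Suc 0) (0, 0) = (1, 0)" "psi_inv c 2 (1, 0) = (1, 0)"
  using psi_inv_psi[of 1 "(1, 0)"] psi_inv_psi[of 2 "(1, 0)"] by simp_all

lemma harmonic_corners [simp]:
  assumes "balanced \<epsilon> u"
  shows "harmonic c n u (0, 0) = 0" "harmonic c n u (1, 0) = 1"
proof -
  have "harmonic c n u (0, 0) = 0 \<and> harmonic c n u (1, 0) = 1"
    using assms
  proof (induction n arbitrary: u)
    case (Suc n)
    have "balanced \<epsilon> (subcascade u [a])" if "a \<in> letters" for a
      using that Suc.prems by (intro balanced_subcascade) auto
    from this[of 1] this[of 2] show ?case
      using Suc.IH balancedD(5)[OF Suc.prems] by (simp add: corners_psi)
  qed simp
  then show "harmonic c n u (0, 0) = 0" "harmonic c n u (1, 0) = 1" by auto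
qed

lemma psi_image_other:
  assumes "a \<in> letters" "b \<in> letters" "a \<noteq> b" "p \<in> diamond c" "psi c a p \<in> psi c b ` diamond c"
  shows "p = (0, 0)" "psi_inv c b (psi c a p) = (0, 0)"
proof -
  obtain q where q: "q \<in> diamond c" "psi c a p = psi c b q" using assms by auto
  then show "p = (0, 0)" "psi_inv c b (psi c a p) = (0, 0)"
    using psi_meet[OF assms(1-4) q] q(2) psi_inv_psi[of b "(0, 0)"] by auto
qed

text \<open>The case distinction in \<open>harmonic\<close> tests the letters in order, while the
  three images share the point (1 / 2, 0). The formulas hold nevertheless because every branch takes
  the value \<open>u [1]\<close> there.\<close>

lemma harmonic_psi:
  assumes "balanced \<epsilon> u" "p \<in> diamond c"
  shows "harmonic c (Suc n) u (psi c 1 p) = u [1] * (1 - harmonic c n (subcascade u [1]) p)"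
    "harmonic c (Suc n) u (psi c 2 p) = u [1] + u [2] * harmonic c n (subcascade u [2]) p"
    "harmonic c (Suc n) u (psi c 3 p) = u [1]"
proof -
  have b: "balanced \<epsilon> (subcascade u [a])" if "a \<in> letters" for a
    using that assms by (intro balanced_subcascade) auto
  note b = harmonic_corners[OF b[of 1], simplified] harmonic_corners[OF b[of 2], simplified]
  show "harmonic c (Suc n) u (psi c 1 p) = u [1] * (1 - harmonic c n (subcascade u [1]) p)"
    using assms(2) by simp
  show "harmonic c (Suc n) u (psi c 2 p) = u [1] + u [2] * harmonic c n (subcascade u [2]) p"
    using assms(2) psi_image_other[of 2 1 p] b by (auto simp del: psi_inj)
  show "harmonic c (Suc n) u (psi c 3 p) = u [1]"
    using assms(2) psi_image_other[of 3 1 p] psi_image_other[of 3 2 p] b by (auto simp del: psi_inj)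
qed

lemma harmonic_stable:
  assumes "balanced \<epsilon> u" "p \<in> V_level c m" "m \<le> n"
  shows "harmonic c n u p = harmonic c m u p"
  using assms
proof (induction m arbitrary: n u p)
  case 0
  then show ?case by auto
next
  case (Suc m)
  then obtain n' where n: "n = Suc n'" "m \<le> n'" by (cases n) auto
  obtain a q where q: "a \<in> letters" "q \<in> V_level c m" "p = psi c a q"
    using Suc.prems by (auto simp: V_level_Suc)
  have b: "balanced \<epsilon> (subcascade u [a])" using q Suc.prems by (intro balanced_subcascade) auto
  have "q \<in> diamond c" using q V_level_subset_diamond by auto
  moreover have "a = 1 \<or> a = 2 \<or> a = 3" using q by (auto simp: letters_def)
  ultimately show ?case
    using harmonic_psi[OF Suc.prems(1)] Suc.IH[OF b q(2) n(2)] unfolding q(3) n(1) by metis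
qed

text \<open>By scaling, the children contribute u[1]^2 / u[1], u[2]^2 / u[2] and 0, with sum u[1] +
  u[2] = 1.\<close>

lemma energy_harmonic:
  assumes "balanced \<epsilon> u" "m \<le> n"
  shows "energy_at c u m (harmonic c n u) = 1"
  using assms
proof (induction m arbitrary: n u)
  case (Suc m)
  then obtain n' where n: "n = Suc n'" "m \<le> n'" by (cases n) auto
  have b: "balanced \<epsilon> (subcascade u [a])" if "a \<in> letters" for a
    using that Suc.prems by (intro balanced_subcascade) auto
  note b = b[of 1, simplified] b[of 2, simplified]
  have D: "p \<in> diamond c" if "p \<in> V_level c m" for p using that V_level_subset_diamond by auto
  have "energy_at c (subcascade u [1]) m (harmonic c n u \<circ> psi c 1) =
    energy_at c (subcascade u [1]) m (\<lambda>p. - u [1] * harmonic c n' (subcascade u [1]) p + u [1])"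
    using D harmonic_psi(1)[OF Suc.prems(1)] n
    by (intro energy_at_cong) (simp add: algebra_simps)
  moreover have "energy_at c (subcascade u [2]) m (harmonic c n u \<circ> psi c 2) =
    energy_at c (subcascade u [2]) m (\<lambda>p. u [2] * harmonic c n' (subcascade u [2]) p + u [1])"
    using D harmonic_psi(2)[OF Suc.prems(1)] n
    by (intro energy_at_cong) (simp add: algebra_simps)
  moreover have "energy_at c (subcascade u [3]) m (harmonic c n u \<circ> psi c 3) =
    energy_at c (subcascade u [3]) m (\<lambda>p. 0 * fst p + u [1])"
    using D harmonic_psi(3)[OF Suc.prems(1)] n by (intro energy_at_cong) simp
  ultimately show ?case
    using Suc.IH[OF b(1) n(2)] Suc.IH[OF b(2) n(2)] balancedD(5)[OF Suc.prems(1)]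
      balancedD(3)[OF Suc.prems(1), of 1] balancedD(3)[OF Suc.prems(1), of 2]
    unfolding energy_at_Suc sum_letters energy_at_affine by (simp add: power2_eq_square)
qed simp

lemma harmonic_lim_eq:
  assumes "balanced \<epsilon> u" "p \<in> V_level c m"
  shows "harmonic_lim c u p = harmonic c m u p"
proof -
  have "eventually (\<lambda>n. harmonic c n u p = harmonic c m u p) sequentially"
    using harmonic_stable[OF assms] eventually_sequentially by blast
  then show ?thesis
    unfolding harmonic_lim_def by (intro limI tendsto_eventually)
qed

lemma harmonic_lim_corners [simp]:
  "balanced \<epsilon> u \<Longrightarrow> harmonic_lim c u (0, 0) = 0" "balanced \<epsilon> u \<Longrightarrow> harmonic_lim c u (1, 0) = 1"
  by (simp_all add: harmonic_lim_eq[of _ _ _ 0])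

lemma energy_harmonic_lim: "balanced \<epsilon> u \<Longrightarrow> energy_at c u n (harmonic_lim c u) = 1"
  using energy_harmonic[of \<epsilon> u n n] energy_at_cong[of c n "harmonic_lim c u" "harmonic c n u" u] harmonic_lim_eq[of \<epsilon> u _ n]
  by simp

lemma cell_function_psi:
  assumes "p \<in> diamond c"
  shows "cell_function c u (a # i) (psi c a p) = cell_function c (subcascade u [a]) i p"
  using assms by simp

lemma cell_function_psi_other:
  assumes "a \<in> letters" "b \<in> letters" "a \<noteq> b" "p \<in> diamond c"
  shows "cell_function c u (a # i) (psi c b p) = cell_function c (subcascade u [a]) i (0, 0)"
  using assms psi_image_other[of b a p] by auto

text \<open>The function is constant on the children off the path to \<open>i\<close>, so each
  letter of \<open>i\<close> leaves one child and divides the energy by its weight.\<close>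

lemma energy_cell_function:
  assumes "balanced \<epsilon> u" "i \<in> lists letters" "length i \<le> n"
  shows "energy_at c u n (cell_function c u i) = 1 / cell_length u i"
  using assms
proof (induction i arbitrary: n u rule: list.induct)
  case Nil
  then show ?case by (simp add: energy_harmonic_lim)
next
  case (Cons a i)
  then obtain n' where n: "n = Suc n'" "length i \<le> n'" by (cases n) auto
  have a: "a \<in> letters" "i \<in> lists letters" using Cons.prems by auto
  have b: "balanced \<epsilon> (subcascade u [a])" using a Cons.prems by (intro balanced_subcascade) auto
  have D: "p \<in> diamond c" if "p \<in> V_level c n'" for p using that V_level_subset_diamond by auto
  have "energy_at c (subcascade u [a]) n' (cell_function c u (a # i) \<circ> psi c a) =
    energy_at c (subcascade u [a]) n' (cell_function c (subcascade u [a]) i)"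
    using D by (intro energy_at_cong) simp
  then have 1: "energy_at c (subcascade u [a]) n' (cell_function c u (a # i) \<circ> psi c a) / u [a] =
      1 / cell_length u (a # i)"
    using Cons.IH[OF b a(2) n(2)] by (simp add: cell_length_Cons mult.commute)
  have 0: "energy_at c (subcascade u [b]) n' (cell_function c u (a # i) \<circ> psi c b) / u [b] = 0"
    if "b \<in> letters - {a}" for b
  proof -
    have "energy_at c (subcascade u [b]) n' (cell_function c u (a # i) \<circ> psi c b) =
      energy_at c (subcascade u [b]) n' (\<lambda>p. 0 * fst p + cell_function c (subcascade u [a]) i (0, 0))"
      using D that a cell_function_psi_other[of a b]
      by (intro energy_at_cong) (simp del: cell_function.simps)
    then show ?thesis unfolding energy_at_affine by simp
  qed
  show ?case
    unfolding n(1) energy_at_Suc sum.remove[OF finite_letters a(1)] 1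
    by (simp only: sum.neutral[OF ballI[OF 0]])
qed

lemma energy_cell_function_limit:
  assumes "balanced \<epsilon> u" "i \<in> lists letters"
  shows "cell_function c u i \<in> finite_energy c u" "energy c u (cell_function c u i) = 1 / cell_length u i"
proof -
  have "eventually (\<lambda>n. level_energy c u n (cell_function c u i) = 1 / cell_length u i) sequentially"
    using energy_cell_function[OF assms] level_energy_balanced[OF assms(1)]
    unfolding eventually_sequentially by (intro exI[of _ "length i"]) simp
  then have *: "(\<lambda>n. level_energy c u n (cell_function c u i)) \<longlonglongrightarrow> 1 / cell_length u i"
    by (rule tendsto_eventually)
  then show "cell_function c u i \<in> finite_energy c u" "energy c u (cell_function c u i) = 1 / cell_length u i"
    by (auto simp: finite_energy_def energy_def convergent_def limI)
qed

text \<open>The cells \<open>1 # replicate m 2\<close> are those containing the left corner, apart from the whole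
  fractal.\<close>

lemma cell_function_right:
  assumes "balanced \<epsilon> u"
  shows "cell_function c u (replicate m 2) (1, 0) = 1"
    "p \<in> diamond c \<Longrightarrow> p \<notin> cell c (replicate m 2) \<Longrightarrow> cell_function c u (replicate m 2) p = 0"
    "p = psi_word c (replicate m 2) (0, 0) \<Longrightarrow> cell_function c u (replicate m 2) p = 0"
    "cell_function c u (replicate m 2) (0, 0) = 0"
proof -
  have "cell_function c u (replicate m 2) (1, 0) = 1 \<and>
    (\<forall>p. p \<in> diamond c \<longrightarrow> p \<notin> cell c (replicate m 2) \<longrightarrow> cell_function c u (replicate m 2) p = 0) \<and>
    cell_function c u (replicate m 2) (psi_word c (replicate m 2) (0, 0)) = 0 \<and>
    cell_function c u (replicate m 2) (0, 0) = 0"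
    using assms
  proof (induction m arbitrary: u)
    case (Suc m)
    have b: "balanced \<epsilon> (subcascade u [2])" using Suc.prems by (intro balanced_subcascade) auto
    show ?case using Suc.IH[OF b] by (auto simp: corners_psi cell_Cons psi_word_diamond psi_image_iff)
  qed auto
  then show "cell_function c u (replicate m 2) (1, 0) = 1"
    "p \<in> diamond c \<Longrightarrow> p \<notin> cell c (replicate m 2) \<Longrightarrow> cell_function c u (replicate m 2) p = 0"
    "p = psi_word c (replicate m 2) (0, 0) \<Longrightarrow> cell_function c u (replicate m 2) p = 0"
    "cell_function c u (replicate m 2) (0, 0) = 0"
    by blast+
qed

lemma cell_function_left:
  assumes "balanced \<epsilon> u"
  shows "cell_function c u (1 # replicate m 2) (0, 0) = 1"
    "p \<in> diamond c \<Longrightarrow> p \<notin> cell c (1 # replicate m 2) \<or> p = psi_word c (1 # replicate m 2) (0, 0) \<Longrightarrow>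
      cell_function c u (1 # replicate m 2) p = 0"
proof -
  have b: "balanced \<epsilon> (subcascade u [1])" using assms by (intro balanced_subcascade) auto
  note r = cell_function_right[OF b]
  show "cell_function c u (1 # replicate m 2) (0, 0) = 1"
    using r(1) by (simp add: corners_psi)
  show "cell_function c u (1 # replicate m 2) p = 0"
    if "p \<in> diamond c" "p \<notin> cell c (1 # replicate m 2) \<or> p = psi_word c (1 # replicate m 2) (0, 0)"
    using r(2-4) that by (auto simp: cell_Cons psi_word_diamond psi_image_iff)
qed

end

section \<open>The resistance metric\<close>

locale cascade_network = fractal_parameter +
  fixes \<epsilon> :: real and u :: "nat list \<Rightarrow> real"
  assumes balanced: "balanced \<epsilon> u"
begin

abbreviation len :: "nat list \<Rightarrow> real" where
  "len \<equiv> cell_length u"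

text \<open>The square root of the resistance is the least such bound; this makes its triangle inequality
  immediate.\<close>

definition osc_bound :: "real \<times> real \<Rightarrow> real \<times> real \<Rightarrow> real \<Rightarrow> bool" where
  "osc_bound x y k \<longleftrightarrow> 0 \<le> k \<and> (\<forall>f\<in>finite_energy c u. \<bar>f x - f y\<bar> \<le> k * sqrt (energy c u f))"

definition root_resistance :: "real \<times> real \<Rightarrow> real \<times> real \<Rightarrow> real" where
  "root_resistance x y = sqrt (resistance_star c u x y)"

lemma energy_at_tendsto:
  assumes "f \<in> finite_energy c u"
  shows "(\<lambda>n. energy_at c u n f) \<longlonglongrightarrow> energy c u f"
  using assms unfolding finite_energy_def energy_def level_energy_balanced[OF balanced]
  by (simp only: mem_Collect_eq convergent_LIMSEQ_iff)

lemma energy_at_le_energy: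
  assumes "f \<in> finite_energy c u"
  shows "energy_at c u n f \<le> energy c u f"
  by (rule incseq_le[OF incseq_SucI energy_at_tendsto[OF assms]]) (rule energy_at_mono[OF balanced])

lemma energy_nonneg: "f \<in> finite_energy c u \<Longrightarrow> 0 \<le> energy c u f"
  using energy_at_le_energy[of f 0] energy_at_nonneg[OF balanced, of c 0 f] by linarith

lemma finite_energy_affine:
  assumes "f \<in> finite_energy c u"
  shows "(\<lambda>p. r * f p + s) \<in> finite_energy c u"
    "energy c u (\<lambda>p. r * f p + s) = r\<^sup>2 * energy c u f"
proof -
  have "(\<lambda>n. energy_at c u n (\<lambda>p. r * f p + s)) \<longlonglongrightarrow> r\<^sup>2 * energy c u f"
    unfolding energy_at_affine by (intro tendsto_mult_left energy_at_tendsto assms)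
  then show "(\<lambda>p. r * f p + s) \<in> finite_energy c u"
    "energy c u (\<lambda>p. r * f p + s) = r\<^sup>2 * energy c u f"
    unfolding finite_energy_def energy_def level_energy_balanced[OF balanced]
    by (auto simp: convergent_def intro: limI)
qed

lemma cell_function_psi_word:
  "p \<in> diamond c \<Longrightarrow> cell_function c v (k @ j) (psi_word c k p) = cell_function c (subcascade v k) j p"
proof (induction k arbitrary: v)
  case (Cons a k)
  have "cell_function c v ((a # k) @ j) (psi_word c (a # k) p) =
      cell_function c (subcascade v [a]) (k @ j) (psi_word c k p)"
    using cell_function_psi[OF psi_word_diamond[OF Cons.prems, of k], of v a "k @ j"] by simp
  then show ?case using Cons by (simp add: subcascade_append)
qed simp

text \<open>The branches below \<open>k\<close> meet at the junction
  \<open>psi_word c k (1 / 2, 0)\<close>, and \<open>k @ e # 1 # replicate m 2\<close> are the cells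
  of branch \<open>e\<close> that touch it. The function of such a cell is 1 on the other branches
  and 0 on the part of branch \<open>e\<close> outside the cell.\<close>

lemma cell_function_branch:
  assumes k: "k \<in> lists letters" and e: "e \<in> letters" "e' \<in> letters" "e \<noteq> e'"
  shows "x \<in> diamond c \<Longrightarrow> x \<notin> cell c (1 # replicate m 2) \<or> x = psi_word c (1 # replicate m 2) (0, 0) \<Longrightarrow>
      cell_function c u (k @ e # 1 # replicate m 2) (psi_word c k (psi c e x)) = 0"
    "y \<in> diamond c \<Longrightarrow> cell_function c u (k @ e # 1 # replicate m 2) (psi_word c k (psi c e' y)) = 1"
proof -
  have b: "balanced \<epsilon> (subcascade (subcascade u k) [e])"
    using balanced k e by (intro balanced_subcascade) auto
  show "cell_function c u (k @ e # 1 # replicate m 2) (psi_word c k (psi c e x)) = 0"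
    if "x \<in> diamond c" "x \<notin> cell c (1 # replicate m 2) \<or> x = psi_word c (1 # replicate m 2) (0, 0)"
    using cell_function_left(2)[OF b that] that
    by (simp only: cell_function_psi_word psi_diamond cell_function_psi)
  show "cell_function c u (k @ e # 1 # replicate m 2) (psi_word c k (psi c e' y)) = 1"
    if "y \<in> diamond c"
    using cell_function_left(1)[OF b] that
    by (simp only: cell_function_psi_word psi_diamond cell_function_psi_other[OF e])
qed

text \<open>This makes the set under the infimum in \<open>resistance_star\<close> nonempty. Two
  distinct vertices part at a junction and at most one of them is the junction itself; a small cell
  at the junction then misses the other one.\<close>

lemma separating_function:
  assumes "x \<in> V_star c" "y \<in> V_star c" "x \<noteq> y"
  obtains f where "f \<in> finite_energy c u" "f x \<noteq> f y"
proof -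
  have main: "\<exists>f\<in>finite_energy c u. f (psi_word c k (psi c e x)) \<noteq> f (psi_word c k (psi c e' y))"
    if k: "k \<in> lists letters" "e \<in> letters" "e' \<in> letters" "e \<noteq> e'"
      and xy: "x \<in> diamond c" "y \<in> diamond c" "x \<noteq> (0, 0)" for k e e' x y
  proof -
    have "0 < dist x (0, 0) / 2" using xy by simp
    from real_arch_pow_inv[OF this, of "1 / 2"]
    obtain m :: nat where m: "(1 / 2) ^ m < dist x (0, 0) / 2" by auto
    have "x \<notin> cell c (1 # replicate m 2)"
    proof
      assume "x \<in> cell c (1 # replicate m 2)"
      then obtain p where p: "p \<in> diamond c" "x = psi_word c (1 # replicate m 2) p" by (auto simp: cell_def)
      have r: "psi_word c (replicate m 2) (1, 0) = (1, 0)" by (induction m) auto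
      obtain a b where ab: "p = (a, b)" by (cases p)
      have "dist p (1, 0) \<le> \<bar>a - 1\<bar> + \<bar>b\<bar>"
        unfolding ab dist_Pair_Pair by (simp add: dist_real_def sqrt_sum_squares_le_sum_abs)
      also have "\<dots> \<le> 2" using diamond_bounds[of a b] p ab by auto
      finally have d: "dist p (1, 0) \<le> 2" .
      have "dist x (0, 0) \<le> dist p (1, 0) / 2 ^ Suc m"
        using dist_psi_word[of "1 # replicate m 2" p "(1, 0)"] p r by simp
      also have "\<dots> \<le> 2 / 2 ^ Suc m" using d by (intro divide_right_mono) auto
      also have "\<dots> = (1 / 2) ^ m" by (simp add: power_divide)
      finally show False using m xy(3) by (smt (verit) field_sum_of_halves zero_less_dist_iff)
    qed
    then have "cell_function c u (k @ e # 1 # replicate m 2) (psi_word c k (psi c e x)) \<noteq>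
        cell_function c u (k @ e # 1 # replicate m 2) (psi_word c k (psi c e' y))"
      using cell_function_branch[OF k] xy by simp
    moreover have "cell_function c u (k @ e # 1 # replicate m 2) \<in> finite_energy c u"
      using k by (intro energy_cell_function_limit(1)[OF balanced]) auto
    ultimately show ?thesis by blast
  qed
  \<comment> \<open>At this depth \<open>x\<close> and \<open>y\<close> cannot be corners of one
    cell, as corners have distance at most 2 before scaling.\<close>
  obtain n :: nat where "(1 / 2) ^ n < dist x y / 2"
    using real_arch_pow_inv[of "dist x y / 2" "1 / 2"] assms by auto
  then have n: "2 / 2 ^ n < dist x y" by (simp add: power_divide)
  obtain m1 m2 where m12: "x \<in> V_level c m1" "y \<in> V_level c m2"
    using assms unfolding V_star_def by blast
  define m where "m = max m1 m2"
  have "m1 \<le> max m n" "m2 \<le> max m n" by (auto simp: m_def)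
  then have "x \<in> V_level c (max m n)" "y \<in> V_level c (max m n)"
    using m12 V_level_mono by blast+
  then obtain i v j v' where i: "i \<in> words letters (max m n)" "v \<in> corners" "x = psi_word c i v"
    and j: "j \<in> words letters (max m n)" "v' \<in> corners" "y = psi_word c j v'"
    unfolding V_level_def by blast
  have "i \<noteq> j"
  proof
    assume "i = j"
    then have "dist x y \<le> dist v v' / 2 ^ max m n"
      using i j dist_psi_word[of i v v'] by (simp add: words_def)
    also have "\<dots> \<le> 2 / 2 ^ n"
    proof (intro frac_le power_increasing)
      show "dist v v' \<le> 2" using i j by (auto simp: dist_Pair_Pair)
    qed auto
    finally show False using n by simp
  qed
  then have "i \<parallel> j" using i j by (intro not_equal_is_parallel) (auto simp: words_def)
  then obtain k e is' e' js where *: "e \<noteq> e'" "i = k @ e # is'" "j = k @ e' # js"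
    using parallel_decomp by blast
  define x' y' where "x' = psi_word c is' v" and "y' = psi_word c js v'"
  have xy: "x = psi_word c k (psi c e x')" "y = psi_word c k (psi c e' y')"
    using i j * by (auto simp: x'_def y'_def psi_word_append)
  have D: "x' \<in> diamond c" "y' \<in> diamond c"
    using i j by (auto simp: x'_def y'_def intro!: psi_word_diamond)
  have k: "k \<in> lists letters" "e \<in> letters" "e' \<in> letters"
    using i j * by (auto simp: words_iff)
  have "x' \<noteq> (0, 0) \<or> y' \<noteq> (0, 0)" using assms(3) xy by auto
  then show ?thesis
    using main[OF k *(1) D] main[OF k(1,3,2) *(1)[symmetric] D(2,1)] that xy by metis
qed

lemma osc_bound_refl: "osc_bound x x 0"
  by (simp add: osc_bound_def)

lemma osc_bound_sym: "osc_bound x y k \<Longrightarrow> osc_bound y x k"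
  by (simp add: osc_bound_def abs_minus_commute)

lemma osc_bound_mono: "osc_bound x y k \<Longrightarrow> k \<le> l \<Longrightarrow> osc_bound x y l"
  unfolding osc_bound_def using energy_nonneg
  by (meson dual_order.trans mult_right_mono real_sqrt_ge_zero)

lemma osc_bound_trans: "osc_bound x y k \<Longrightarrow> osc_bound y z l \<Longrightarrow> osc_bound x z (k + l)"
  unfolding osc_bound_def distrib_right by (smt (verit, best))

lemma osc_bound_energy:
  assumes "osc_bound x y k" "f \<in> finite_energy c u" "f x = 0" "f y = 1"
  shows "0 < k" "1 / k\<^sup>2 \<le> energy c u f"
proof -
  have *: "1 \<le> k * sqrt (energy c u f)" "0 \<le> k" using assms by (auto simp: osc_bound_def)
  then show k: "0 < k" by (metis less_eq_real_def mult_zero_left not_one_le_zero)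
  have "1 \<le> (k * sqrt (energy c u f))\<^sup>2" using *(1) by (simp add: one_le_power)
  also have "\<dots> = k\<^sup>2 * energy c u f" using energy_nonneg[OF assms(2)] by (simp add: power_mult_distrib)
  finally show "1 / k\<^sup>2 \<le> energy c u f" using k by (simp add: divide_le_eq mult.commute)
qed

context
  fixes x y :: "real \<times> real"
  assumes V: "x \<in> V_star c" "y \<in> V_star c"
begin

lemma unit_functions_nonempty:
  assumes "x \<noteq> y"
  shows "{f \<in> finite_energy c u. f x = 0 \<and> f y = 1} \<noteq> {}"
proof -
  obtain f where f: "f \<in> finite_energy c u" "f x \<noteq> f y" using separating_function[OF V assms] .
  define g where "g = (\<lambda>p. (1 / (f y - f x)) * f p + (- f x / (f y - f x)))"
  have "g \<in> finite_energy c u" unfolding g_def by (rule finite_energy_affine[OF f(1)])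
  moreover have "g x = 0" "g y = 1"
    using f(2) by (simp_all add: g_def diff_divide_distrib[symmetric])
  ultimately show ?thesis by blast
qed

lemma osc_bound_Inf:
  assumes "osc_bound x y k" "x \<noteq> y"
  shows "0 < k" "1 / k\<^sup>2 \<le> Inf (energy c u ` {f \<in> finite_energy c u. f x = 0 \<and> f y = 1})"
proof -
  obtain f where f: "f \<in> {f \<in> finite_energy c u. f x = 0 \<and> f y = 1}"
    using unit_functions_nonempty[OF assms(2)] by blast
  then show "0 < k" using osc_bound_energy(1)[OF assms(1)] by blast
  show "1 / k\<^sup>2 \<le> Inf (energy c u ` {f \<in> finite_energy c u. f x = 0 \<and> f y = 1})"
    using osc_bound_energy(2)[OF assms(1)] f by (intro cInf_greatest) auto
qed

lemma root_resistance_le: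
  assumes "osc_bound x y k"
  shows "root_resistance x y \<le> k"
proof (cases "x = y")
  case True
  then show ?thesis using assms by (simp add: root_resistance_def resistance_star_def osc_bound_def)
next
  case False
  have "inverse (Inf (energy c u ` {f \<in> finite_energy c u. f x = 0 \<and> f y = 1})) \<le> inverse (1 / k\<^sup>2)"
    using osc_bound_Inf[OF assms False] by (intro le_imp_inverse_le) auto
  then have "resistance_star c u x y \<le> k\<^sup>2" using False by (simp add: resistance_star_def)
  then show ?thesis
    unfolding root_resistance_def using osc_bound_Inf(1)[OF assms False] by (intro real_le_lsqrt) auto
qed

text \<open>Any bound \<open>k\<close> keeps the infimum of the energies above 1 / k^2; without
  this, \<open>inverse 0 = 0\<close> would give resistance 0. With a positive infimum, normalising
  \<open>f\<close> to the values 0 and 1 shows that the root of the resistance is itself a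
  bound.\<close>

lemma osc_bound_root_resistance:
  assumes "osc_bound x y k"
  shows "osc_bound x y (root_resistance x y)" "0 \<le> resistance_star c u x y"
proof -
  have "osc_bound x y (root_resistance x y) \<and> 0 \<le> resistance_star c u x y"
  proof (cases "x = y")
    case True
    then show ?thesis by (simp add: root_resistance_def resistance_star_def osc_bound_refl)
  next
    case False
    define I where "I = Inf (energy c u ` {f \<in> finite_energy c u. f x = 0 \<and> f y = 1})"
    note k = osc_bound_Inf[OF assms False, folded I_def]
    have I: "0 < I" using k by (smt (verit) zero_less_divide_1_iff zero_less_power)
    have R: "resistance_star c u x y = 1 / I"
      using False by (simp add: resistance_star_def I_def divide_inverse)
    have "\<bar>f x - f y\<bar> \<le> root_resistance x y * sqrt (energy c u f)" if f: "f \<in> finite_energy c u" for f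
    proof (cases "f x = f y")
      case True
      then show ?thesis using energy_nonneg[OF f] I R by (simp add: root_resistance_def)
    next
      case ne: False
      define g where "g = (\<lambda>p. (1 / (f y - f x)) * f p + (- f x / (f y - f x)))"
      have g: "g \<in> finite_energy c u"
        unfolding g_def by (rule finite_energy_affine(1)[OF f])
      have g01: "g x = 0" "g y = 1"
        using ne by (simp_all add: g_def diff_divide_distrib[symmetric])
      have E: "energy c u g = energy c u f / (f x - f y)\<^sup>2"
        unfolding g_def finite_energy_affine(2)[OF f] by (simp add: power_divide power2_commute)
      have "I \<le> energy c u g"
        unfolding I_def using g g01 energy_nonneg by (intro cInf_lower bdd_belowI[of _ 0]) auto
      then have "(f x - f y)\<^sup>2 * I \<le> energy c u f" using ne by (simp add: E field_simps)
      then have "(f x - f y)\<^sup>2 \<le> resistance_star c u x y * energy c u f"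
        unfolding R using I by (simp add: field_simps)
      then have "sqrt ((f x - f y)\<^sup>2) \<le> sqrt (resistance_star c u x y * energy c u f)"
        by (rule real_sqrt_le_mono)
      then show ?thesis by (simp only: root_resistance_def real_sqrt_mult real_sqrt_abs)
    qed
    then show ?thesis using I R by (simp add: osc_bound_def root_resistance_def)
  qed
  then show "osc_bound x y (root_resistance x y)" "0 \<le> resistance_star c u x y" by auto
qed

end

section \<open>Upper bounds for resistances by chaining\<close>

text \<open>The edge contributes one summand to the level energy, which is at most the full
  energy.\<close>

lemma osc_bound_edge:
  assumes "i \<in> lists letters"
  shows "osc_bound (psi_word c i (0, 0)) (psi_word c i (1, 0)) (sqrt (len i))"
  unfolding osc_bound_def
proof (intro conjI ballI)
  have l: "0 < len i" using cell_length_pos[OF balanced assms] .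
  then show "0 \<le> sqrt (len i)" by simp
  fix f assume f: "f \<in> finite_energy c u"
  define d where "d = f (psi_word c i (0, 0)) - f (psi_word c i (1, 0))"
  have "d\<^sup>2 / len i \<le> energy_at c u (length i) f"
    unfolding d_def energy_at_def using assms cell_length_pos[OF balanced]
    by (intro member_le_sum) (auto simp: words_iff intro!: divide_nonneg_pos)
  also have "\<dots> \<le> energy c u f" by (rule energy_at_le_energy[OF f])
  finally have "d\<^sup>2 \<le> len i * energy c u f" using l by (simp add: divide_le_eq mult.commute)
  then have "sqrt (d\<^sup>2) \<le> sqrt (len i * energy c u f)" by (rule real_sqrt_le_mono)
  then show "\<bar>d\<bar> \<le> sqrt (len i) * sqrt (energy c u f)" by (simp only: real_sqrt_mult real_sqrt_abs)
qed

text \<open>The left corner of a cell is the right corner of its first child, whose left corner is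
  shared by all children.\<close>

lemma osc_bound_child:
  assumes "i \<in> lists letters" "a \<in> letters"
  shows "osc_bound (psi_word c i (0, 0)) (psi_word c (i @ [a]) (0, 0)) (sqrt (len i))"
proof (rule osc_bound_mono)
  have i1: "i @ [1] \<in> lists letters" using assms by auto
  show "osc_bound (psi_word c i (0, 0)) (psi_word c (i @ [a]) (0, 0)) (sqrt (len (i @ [1])))"
    using osc_bound_sym[OF osc_bound_edge[OF i1]] by (simp add: psi_word_append)
  have "len (i @ [1]) = len i * subcascade u i [1]" by (simp add: cell_length_append)
  also have "\<dots> \<le> len i * 1"
    using balancedD(4)[OF balanced_subcascade[OF balanced assms(1)], of 1] cell_length_pos[OF balanced assms(1)]
    by (intro mult_left_mono) auto
  finally show "sqrt (len (i @ [1])) \<le> sqrt (len i)" by simp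
qed

lemma osc_bound_descend:
  assumes "i \<in> lists letters" "j \<in> lists letters"
  shows "osc_bound (psi_word c i (0, 0)) (psi_word c (i @ j) (0, 0)) (\<Sum>m<length j. sqrt (len (i @ take m j)))"
  using assms(2)
proof (induction j rule: rev_induct)
  case (snoc a j)
  have "(\<Sum>m<length j. sqrt (len (i @ take m (j @ [a])))) = (\<Sum>m<length j. sqrt (len (i @ take m j)))"
    by (intro sum.cong) auto
  then show ?case
    using osc_bound_trans[OF snoc.IH osc_bound_child[of "i @ j" a]] snoc.prems assms by simp
qed (simp add: osc_bound_refl)

lemma V_star_words: "x \<in> V_star c \<Longrightarrow> \<exists>j\<in>lists letters. \<exists>v\<in>corners. x = psi_word c j v"
  unfolding V_star_def V_level_def by (auto simp: words_iff)

text \<open>Chaining: the vertex is reached through the left corners of the successive cells, and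
  the geometric series bounds the sum of the increments. The final term
  \<open>sqrt (len (i @ j))\<close> is for a vertex that is a right corner.\<close>

lemma osc_bound_cell:
  assumes i: "i \<in> lists letters" and len: "\<And>j. j \<in> lists letters \<Longrightarrow> sqrt (len (i @ j)) \<le> A * q ^ length j"
    and q: "0 \<le> q" "q < 1" and x: "x \<in> psi_word c i ` V_star c"
  shows "osc_bound (psi_word c i (0, 0)) x (A / (1 - q))"
proof -
  obtain j v where j: "j \<in> lists letters" "v \<in> corners" "x = psi_word c (i @ j) v"
    using x V_star_words by (fastforce simp: psi_word_append)
  have "0 \<le> A" using len[of "[]"] by (simp add: order_trans[OF real_sqrt_ge_zero[OF less_imp_le[OF cell_length_pos[OF balanced i]]]])
  have ij: "i @ j \<in> lists letters" using i j by auto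
  have 1: "osc_bound (psi_word c (i @ j) (0, 0)) x (sqrt (len (i @ j)))"
  proof (cases "v = (0, 0)")
    case True
    then show ?thesis
      using osc_bound_mono[OF osc_bound_refl, of "sqrt (len (i @ j))"] j cell_length_pos[OF balanced ij] by simp
  next
    case False
    then show ?thesis using j osc_bound_edge[OF ij] by auto
  qed
  have "(\<Sum>m<length j. sqrt (len (i @ take m j))) + sqrt (len (i @ j)) =
      (\<Sum>m\<le>length j. sqrt (len (i @ take m j)))"
    by (simp add: lessThan_Suc_atMost[symmetric])
  also have "\<dots> \<le> (\<Sum>m\<le>length j. A * q ^ m)"
  proof (intro sum_mono)
    fix m assume "m \<in> {..length j}"
    moreover have "take m j \<in> lists letters" using j(1) by (auto dest: in_set_takeD)
    ultimately show "sqrt (len (i @ take m j)) \<le> A * q ^ m" using len[of "take m j"] by simp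
  qed
  also have "\<dots> = A * (\<Sum>m<Suc (length j). q ^ m)"
    by (simp only: sum_distrib_left lessThan_Suc_atMost)
  also have "\<dots> \<le> A * (1 / (1 - q))"
  proof (intro mult_left_mono \<open>0 \<le> A\<close>)
    have "(\<Sum>m<Suc (length j). q ^ m) \<le> (\<Sum>m. q ^ m)"
      using q by (intro sum_le_suminf summable_geometric) auto
    then show "(\<Sum>m<Suc (length j). q ^ m) \<le> 1 / (1 - q)"
      using q suminf_geometric[of q] by simp
  qed
  finally have "(\<Sum>m<length j. sqrt (len (i @ take m j))) + sqrt (len (i @ j)) \<le> A / (1 - q)"
    by simp
  then show ?thesis
    by (rule osc_bound_mono[OF osc_bound_trans[OF osc_bound_descend[OF i j(1)] 1]])
qed

end

section \<open>Networks with geometrically decaying level sums\<close>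

locale decaying_network = cascade_network +
  fixes \<theta> K \<rho> :: real
  assumes \<theta>_pos: "0 < \<theta>" and \<rho>_pos: "0 < \<rho>" and \<rho>_less: "\<rho> < 1"
    and decay: "\<And>n. (\<Sum>i\<in>words letters n. cell_length u i powr \<theta>) \<le> K * \<rho> ^ n"
begin

text \<open>Chosen so that b > 1 and b \<rho> < 1: weighting level m by b^m keeps the series
  convergent and still forces each of its terms to decay.\<close>

definition b :: real where "b = 1 / sqrt \<rho>"

text \<open>The decay b^(-m) concerns lengths to the power \<theta>; the root of order 2 \<theta>
  yields the rate of the square roots of the lengths.\<close>

definition q :: real where "q = b powr (- 1 / (2 * \<theta>))"

definition level_mass :: "nat list \<Rightarrow> nat \<Rightarrow> real" where
  "level_mass i m = (\<Sum>j\<in>words letters m. len (i @ j) powr \<theta>)"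

text \<open>Since \<open>b > 1\<close>, the lengths of the descendants of \<open>i\<close> decay geometrically with a constant
  controlled by this sum, which in turn is summable over the level of \<open>i\<close>.\<close>

definition tail_mass :: "nat list \<Rightarrow> real" where
  "tail_mass i = (\<Sum>m. b ^ m * level_mass i m)"

lemma b_gt_1: "1 < b"
  using \<rho>_pos \<rho>_less by (simp add: b_def)

lemma b_\<rho>: "b * \<rho> = sqrt \<rho>"
  using \<rho>_pos by (simp add: b_def real_div_sqrt)

lemma sqrt_\<rho>: "0 < sqrt \<rho>" "sqrt \<rho> < 1"
  using \<rho>_pos \<rho>_less by auto

lemma q_bounds: "0 < q" "q < 1"
proof -
  show "0 < q" using b_gt_1 by (simp add: q_def)
  have "b powr (- 1 / (2 * \<theta>)) < b powr 0"
    using \<theta>_pos by (intro powr_less_mono b_gt_1) (simp add: field_simps)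
  then show "q < 1" using b_gt_1 by (simp add: q_def)
qed

lemma level_mass_nonneg: "0 \<le> level_mass i m"
  by (simp add: level_mass_def sum_nonneg)

lemma sum_level_mass:
  "(\<Sum>i\<in>words letters n. level_mass i m) = (\<Sum>i\<in>words letters (n + m). len i powr \<theta>)"
  unfolding level_mass_def sum_words_add ..

lemma level_mass_le:
  assumes "i \<in> words letters n"
  shows "level_mass i m \<le> K * \<rho> ^ (n + m)"
proof -
  have "level_mass i m \<le> (\<Sum>i\<in>words letters n. level_mass i m)"
    using assms level_mass_nonneg by (intro member_le_sum) auto
  then show ?thesis using decay[of "n + m"] by (simp add: sum_level_mass)
qed

lemma K_ge_1: "1 \<le> K"
  using decay[of 0] by simp

lemma geometric_bound:
  "b ^ m * (K * \<rho> ^ (n + m)) = K * \<rho> ^ n * sqrt \<rho> ^ m"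
proof -
  have "b ^ m * \<rho> ^ m = sqrt \<rho> ^ m" unfolding power_mult_distrib[symmetric] b_\<rho> ..
  then show ?thesis by (simp add: power_add algebra_simps)
qed

lemma summable_tail_mass:
  assumes "i \<in> lists letters"
  shows "summable (\<lambda>m. b ^ m * level_mass i m)"
proof (rule summable_comparison_test')
  show "summable (\<lambda>m. K * \<rho> ^ length i * sqrt \<rho> ^ m)"
    using sqrt_\<rho> by (intro summable_mult summable_geometric) auto
  fix m :: nat
  have "b ^ m * level_mass i m \<le> b ^ m * (K * \<rho> ^ (length i + m))"
    using b_gt_1 assms by (intro mult_left_mono level_mass_le) (auto simp: words_iff)
  then show "norm (b ^ m * level_mass i m) \<le> K * \<rho> ^ length i * sqrt \<rho> ^ m"
    unfolding geometric_bound using level_mass_nonneg b_gt_1 by simp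
qed

lemma tail_mass_nonneg: "i \<in> lists letters \<Longrightarrow> 0 \<le> tail_mass i"
  unfolding tail_mass_def using level_mass_nonneg b_gt_1 summable_tail_mass
  by (intro suminf_nonneg) auto

text \<open>After exchanging the sums, level n + m contributes at most K b^m \<rho>^(n + m) = K
  \<rho>^n (sqrt \<rho>)^m.\<close>

lemma sum_tail_mass: "(\<Sum>i\<in>words letters n. tail_mass i) \<le> K / (1 - sqrt \<rho>) * \<rho> ^ n"
proof -
  have s: "summable (\<lambda>m. b ^ m * level_mass i m)" if "i \<in> words letters n" for i
    using that summable_tail_mass by (simp add: words_iff)
  have "(\<Sum>i\<in>words letters n. tail_mass i) = (\<Sum>m. \<Sum>i\<in>words letters n. b ^ m * level_mass i m)"
    unfolding tail_mass_def using s by (rule suminf_sum[symmetric])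
  also have "\<dots> \<le> (\<Sum>m. K * \<rho> ^ n * sqrt \<rho> ^ m)"
  proof (rule suminf_le)
    fix m
    have "b ^ m * (\<Sum>i\<in>words letters n. level_mass i m) \<le> b ^ m * (K * \<rho> ^ (n + m))"
      unfolding sum_level_mass using b_gt_1 decay by (intro mult_left_mono) auto
    then show "(\<Sum>i\<in>words letters n. b ^ m * level_mass i m) \<le> K * \<rho> ^ n * sqrt \<rho> ^ m"
      unfolding geometric_bound sum_distrib_left .
  qed (use s sqrt_\<rho> in \<open>auto intro!: summable_sum summable_mult summable_geometric\<close>)
  also have "\<dots> = K * \<rho> ^ n * (1 / (1 - sqrt \<rho>))"
    using sqrt_\<rho> by (subst suminf_mult) (auto simp: suminf_geometric intro!: summable_geometric)
  finally show ?thesis by simp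
qed

lemma tail_mass_le:
  assumes "i \<in> words letters n"
  shows "tail_mass i \<le> K / (1 - sqrt \<rho>) * \<rho> ^ n"
proof -
  have "tail_mass i \<le> (\<Sum>i\<in>words letters n. tail_mass i)"
    using assms tail_mass_nonneg by (intro member_le_sum) (auto simp: words_iff)
  then show ?thesis using sum_tail_mass[of n] by simp
qed

text \<open>The length of a single word to the power \<theta>, times b^m, is at most one summand of
  \<open>tail_mass\<close>; take the root of order 2 \<theta>.\<close>

lemma sqrt_len_le:
  assumes "i \<in> lists letters" "j \<in> lists letters"
  shows "sqrt (len (i @ j)) \<le> tail_mass i powr (1 / (2 * \<theta>)) * q ^ length j"
proof -
  let ?m = "length j"
  have l: "0 < len (i @ j)" using assms by (intro cell_length_pos[OF balanced]) auto
  have bm: "0 < b ^ ?m" using b_gt_1 by simp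
  have "b ^ ?m * len (i @ j) powr \<theta> \<le> b ^ ?m * level_mass i ?m"
    unfolding level_mass_def using assms bm
    by (intro mult_left_mono member_le_sum[of j]) (auto simp: words_iff)
  also have "\<dots> \<le> tail_mass i"
    unfolding tail_mass_def using sum_le_suminf[OF summable_tail_mass[OF assms(1)], of "{?m}"]
      level_mass_nonneg b_gt_1 by simp
  finally have "len (i @ j) powr \<theta> \<le> tail_mass i * b powr (- real ?m)"
    using bm b_gt_1 by (simp add: powr_minus powr_realpow field_simps)
  then have "(len (i @ j) powr \<theta>) powr (1 / (2 * \<theta>)) \<le> (tail_mass i * b powr (- real ?m)) powr (1 / (2 * \<theta>))"
    using \<theta>_pos by (intro powr_mono2) auto
  also have "(len (i @ j) powr \<theta>) powr (1 / (2 * \<theta>)) = sqrt (len (i @ j))"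
    using \<theta>_pos l by (simp add: powr_powr powr_half_sqrt)
  also have "(tail_mass i * b powr (- real ?m)) powr (1 / (2 * \<theta>)) =
      tail_mass i powr (1 / (2 * \<theta>)) * b powr (- 1 / (2 * \<theta>) * real ?m)"
    using tail_mass_nonneg[OF assms(1)] b_gt_1 by (simp add: powr_mult powr_powr)
  also have "b powr (- 1 / (2 * \<theta>) * real ?m) = q ^ ?m"
    using b_gt_1 q_bounds by (simp only: powr_powr[symmetric] q_def[symmetric] powr_realpow)
  finally show ?thesis .
qed

text \<open>The factor 2 comes from passing through the left corner of the cell and 1 / (1 - q) from
  the chaining series. It bounds root resistances, so its square bounds resistances.\<close>

definition cell_radius :: "real \<Rightarrow> real" where
  "cell_radius s = 2 / (1 - q) * s powr (1 / (2 * \<theta>))"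

lemma cell_radius_mono: "0 \<le> s \<Longrightarrow> s \<le> t \<Longrightarrow> cell_radius s \<le> cell_radius t"
  unfolding cell_radius_def using q_bounds \<theta>_pos by (intro mult_left_mono powr_mono2) auto

lemma osc_bound_in_cell:
  assumes "i \<in> lists letters" "x \<in> psi_word c i ` V_star c" "y \<in> psi_word c i ` V_star c"
  shows "osc_bound x y (cell_radius (tail_mass i))"
proof -
  have *: "osc_bound (psi_word c i (0, 0)) z (tail_mass i powr (1 / (2 * \<theta>)) / (1 - q))"
    if "z \<in> psi_word c i ` V_star c" for z
    using q_bounds by (intro osc_bound_cell[OF assms(1) sqrt_len_le[OF assms(1)] _ _ that]) auto
  show ?thesis
    using osc_bound_trans[OF osc_bound_sym[OF *[OF assms(2)]] *[OF assms(3)]]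
    by (simp add: cell_radius_def field_simps)
qed

section \<open>The resistance metric on the vertices and its extension to the fractal\<close>

lemma osc_bound_V_star:
  assumes "x \<in> V_star c" "y \<in> V_star c"
  shows "osc_bound x y (root_resistance x y)" "0 \<le> resistance_star c u x y"
  using osc_bound_root_resistance[OF assms osc_bound_in_cell[of "[]"]] assms by auto

lemma resistance_star_eq:
  "x \<in> V_star c \<Longrightarrow> y \<in> V_star c \<Longrightarrow> resistance_star c u x y = (root_resistance x y)\<^sup>2"
  using osc_bound_V_star(2) by (simp add: root_resistance_def)

lemma root_resistance_triangle:
  assumes "x \<in> V_star c" "y \<in> V_star c" "z \<in> V_star c"
  shows "root_resistance x z \<le> root_resistance x y + root_resistance y z"
  by (rule root_resistance_le[OF assms(1,3) osc_bound_trans[OF osc_bound_V_star(1)[OF assms(1,2)]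
      osc_bound_V_star(1)[OF assms(2,3)]]])

lemma root_resistance_commute:
  assumes "x \<in> V_star c" "y \<in> V_star c"
  shows "root_resistance x y = root_resistance y x"
  using root_resistance_le[OF assms osc_bound_sym[OF osc_bound_V_star(1)[OF assms(2,1)]]]
    root_resistance_le[OF assms(2,1) osc_bound_sym[OF osc_bound_V_star(1)[OF assms]]] by simp

lemma root_resistance_diff:
  assumes "x \<in> V_star c" "y \<in> V_star c" "x' \<in> V_star c" "y' \<in> V_star c"
  shows "\<bar>root_resistance x y - root_resistance x' y'\<bar> \<le> root_resistance x x' + root_resistance y y'"
proof -
  have "root_resistance x y \<le> root_resistance x x' + (root_resistance x' y' + root_resistance y' y)"
    using assms root_resistance_triangle[of x x' y] root_resistance_triangle[of x' y' y] by simp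
  moreover have "root_resistance x' y' \<le> root_resistance x' x + (root_resistance x y + root_resistance y y')"
    using assms root_resistance_triangle[of x' x y'] root_resistance_triangle[of x y y'] by simp
  ultimately show ?thesis
    using root_resistance_commute[of x x'] root_resistance_commute[of y y'] assms by linarith
qed

lemma cell_radius_tendsto: "(\<lambda>n. cell_radius (K / (1 - sqrt \<rho>) * \<rho> ^ n)) \<longlonglongrightarrow> 0"
proof -
  have "(\<lambda>n. K / (1 - sqrt \<rho>) * \<rho> ^ n) \<longlonglongrightarrow> 0"
    using LIMSEQ_power_zero[of \<rho>] \<rho>_pos \<rho>_less by (intro tendsto_mult_right_zero) auto
  then have "(\<lambda>n. (K / (1 - sqrt \<rho>) * \<rho> ^ n) powr (1 / (2 * \<theta>))) \<longlonglongrightarrow> 0"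
    using \<theta>_pos K_ge_1 \<rho>_pos \<rho>_less
    by (intro tendsto_zero_powrI[of _ _ "\<lambda>_. 1 / (2 * \<theta>)" "1 / (2 * \<theta>)"]) auto
  then show ?thesis unfolding cell_radius_def by (rule tendsto_mult_right_zero)
qed

text \<open>Vertices close in the plane lie in the same cell or in two intersecting cells of level
  n. Intersecting cells share a vertex, so two steps of size \<eta> / 2 suffice.\<close>

lemma root_resistance_small:
  assumes "0 < \<eta>"
  shows "\<exists>d>0. \<forall>x\<in>V_star c. \<forall>y\<in>V_star c. dist x y < d \<longrightarrow> root_resistance x y \<le> \<eta>"
proof -
  obtain n where n: "cell_radius (K / (1 - sqrt \<rho>) * \<rho> ^ n) < \<eta> / 2"
    using order_tendstoD(2)[OF cell_radius_tendsto, of "\<eta> / 2"] assms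
    by (auto simp: eventually_sequentially)
  have osc: "osc_bound x y (\<eta> / 2)"
    if "i \<in> words letters n" "x \<in> psi_word c i ` V_star c" "y \<in> psi_word c i ` V_star c" for i x y
  proof (rule osc_bound_mono[OF osc_bound_in_cell[of i x y]])
    have "cell_radius (tail_mass i) \<le> cell_radius (K / (1 - sqrt \<rho>) * \<rho> ^ n)"
      using that tail_mass_le tail_mass_nonneg by (intro cell_radius_mono) (auto simp: words_iff)
    then show "cell_radius (tail_mass i) \<le> \<eta> / 2" using n by simp
  qed (use that in \<open>auto simp: words_iff\<close>)
  obtain d where d: "d > 0" "\<And>i j p q. i \<in> words letters n \<Longrightarrow> j \<in> words letters n \<Longrightarrow>
      p \<in> cell c i \<Longrightarrow> q \<in> cell c j \<Longrightarrow> dist p q < d \<Longrightarrow> cell c i \<inter> cell c j \<noteq> {}"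
    using cell_separation[of n] by blast
  have "root_resistance x y \<le> \<eta>" if xy: "x \<in> V_star c" "y \<in> V_star c" "dist x y < d" for x y
  proof -
    obtain i where i: "i \<in> words letters n" "x \<in> psi_word c i ` V_star c"
      using invariant_words[OF V_star_eq, of n] xy by blast
    obtain j where j: "j \<in> words letters n" "y \<in> psi_word c j ` V_star c"
      using invariant_words[OF V_star_eq, of n] xy by blast
    have "osc_bound x y (\<eta> / 2 + \<eta> / 2)"
    proof (cases "i = j")
      case True
      then show ?thesis using osc_bound_mono[OF osc[OF i] , of y] i j assms by simp
    next
      case False
      then have par: "i \<parallel> j" using i j by (intro not_equal_is_parallel) (auto simp: words_def)
      have "x \<in> cell c i" "y \<in> cell c j"
        using i j V_star_subset_diamond by (auto simp: cell_def)
      then obtain z where z: "z \<in> cell c i" "z \<in> cell c j" using d(2) i j xy by blast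
      then have "z \<in> psi_word c i ` corners"
        using cell_Int_parallel[OF par] i j by (auto simp: words_iff)
      then have zi: "z \<in> psi_word c i ` V_star c" by auto
      then have "z \<in> V_star c" using i psi_word_V_star by (auto simp: words_iff)
      then have "z \<in> psi_word c j ` V_star c" using V_star_Int_cell z j by (simp add: words_iff)
      then show ?thesis using osc_bound_trans osc i j zi by blast
    qed
    then show ?thesis using root_resistance_le[OF xy(1,2)] by simp
  qed
  then show ?thesis using d(1) by blast
qed

lemma resistance_star_limit:
  assumes "range xs \<subseteq> V_star c" "range ys \<subseteq> V_star c" "xs \<longlonglongrightarrow> x" "ys \<longlonglongrightarrow> y"
  shows "convergent (\<lambda>n. resistance_star c u (xs n) (ys n))"
proof -
  have V: "xs n \<in> V_star c" "ys n \<in> V_star c" for n using assms by auto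
  have small: "\<exists>N. \<forall>m\<ge>N. \<forall>n\<ge>N. root_resistance (zs m) (zs n) \<le> \<eta>"
    if zs: "\<And>n. zs n \<in> V_star c" "zs \<longlonglongrightarrow> z" and "0 < \<eta>" for zs z \<eta>
  proof -
    obtain d where "d > 0" "\<And>x y. x \<in> V_star c \<Longrightarrow> y \<in> V_star c \<Longrightarrow> dist x y < d \<Longrightarrow> root_resistance x y \<le> \<eta>"
      using root_resistance_small[OF \<open>0 < \<eta>\<close>] by blast
    then show ?thesis using LIMSEQ_imp_Cauchy[OF zs(2)] zs(1) unfolding Cauchy_def by meson
  qed
  have "Cauchy (\<lambda>n. root_resistance (xs n) (ys n))"
  proof (rule CauchyI)
    fix e :: real assume "0 < e"
    then have "0 < e / 3" by simp
    obtain N1 where N1: "\<forall>m\<ge>N1. \<forall>n\<ge>N1. root_resistance (xs m) (xs n) \<le> e / 3"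
      using small[OF V(1) assms(3) \<open>0 < e / 3\<close>] by blast
    obtain N2 where N2: "\<forall>m\<ge>N2. \<forall>n\<ge>N2. root_resistance (ys m) (ys n) \<le> e / 3"
      using small[OF V(2) assms(4) \<open>0 < e / 3\<close>] by blast
    show "\<exists>M. \<forall>m\<ge>M. \<forall>n\<ge>M. norm (root_resistance (xs m) (ys m) - root_resistance (xs n) (ys n)) < e"
    proof (intro exI[of _ "max N1 N2"] allI impI)
      fix m n assume "max N1 N2 \<le> m" "max N1 N2 \<le> n"
      then have "root_resistance (xs m) (xs n) \<le> e / 3" "root_resistance (ys m) (ys n) \<le> e / 3"
        using N1 N2 by auto
      then show "norm (root_resistance (xs m) (ys m) - root_resistance (xs n) (ys n)) < e"
        using root_resistance_diff[OF V V, of m m n n] \<open>0 < e\<close> unfolding real_norm_def by linarith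
    qed
  qed
  then have "convergent (\<lambda>n. root_resistance (xs n) (ys n))" by (simp add: Cauchy_convergent_iff)
  then have "convergent (\<lambda>n. (root_resistance (xs n) (ys n))\<^sup>2)"
    using tendsto_power unfolding convergent_def by fast
  then show ?thesis using resistance_star_eq[OF V] by simp
qed

text \<open>Interleaving two pairs of sequences shows that the limit does not depend on them.\<close>

lemma resistance_metric_limit:
  assumes "range xs \<subseteq> V_star c" "range ys \<subseteq> V_star c" "xs \<longlonglongrightarrow> x" "ys \<longlonglongrightarrow> y"
  shows "(\<lambda>n. resistance_star c u (xs n) (ys n)) \<longlonglongrightarrow> resistance_metric c u x y"
proof -
  obtain r where r: "(\<lambda>n. resistance_star c u (xs n) (ys n)) \<longlonglongrightarrow> r"
    using resistance_star_limit[OF assms] by (auto simp: convergent_def)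
  have "resistance_metric c u x y = r"
    unfolding resistance_metric_def
  proof (rule the_equality)
    show "\<forall>xs ys. range xs \<subseteq> V_star c \<longrightarrow> range ys \<subseteq> V_star c \<longrightarrow> xs \<longlonglongrightarrow> x \<longrightarrow> ys \<longlonglongrightarrow> y \<longrightarrow>
        (\<lambda>n. resistance_star c u (xs n) (ys n)) \<longlonglongrightarrow> r"
    proof (intro allI impI)
      fix xs' ys'
      assume *: "range xs' \<subseteq> V_star c" "range ys' \<subseteq> V_star c" "xs' \<longlonglongrightarrow> x" "ys' \<longlonglongrightarrow> y"
      define zs where "zs = (\<lambda>n. if even n then xs (n div 2) else xs' (n div 2))"
      define ws where "ws = (\<lambda>n. if even n then ys (n div 2) else ys' (n div 2))"
      have z: "zs \<longlonglongrightarrow> x" "ws \<longlonglongrightarrow> y"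
        using assms(3,4) *(3,4) by (simp_all add: limseq_even_odd zs_def ws_def)
      have "range zs \<subseteq> V_star c" "range ws \<subseteq> V_star c"
        using assms(1,2) *(1,2) by (auto simp: zs_def ws_def)
      then obtain l where l: "(\<lambda>n. resistance_star c u (zs n) (ws n)) \<longlonglongrightarrow> l"
        using resistance_star_limit[OF _ _ z] unfolding convergent_def by blast
      have "strict_mono (\<lambda>n::nat. 2 * n)" "strict_mono (\<lambda>n::nat. 2 * n + 1)"
        by (auto intro!: strict_monoI)
      then have "(\<lambda>n. resistance_star c u (xs n) (ys n)) \<longlonglongrightarrow> l"
        "(\<lambda>n. resistance_star c u (xs' n) (ys' n)) \<longlonglongrightarrow> l"
        using LIMSEQ_subseq_LIMSEQ[OF l] by (force simp: o_def zs_def ws_def)+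
      then show "(\<lambda>n. resistance_star c u (xs' n) (ys' n)) \<longlonglongrightarrow> r"
        using LIMSEQ_unique[OF r] by simp
    qed
  next
    fix r' assume "\<forall>xs ys. range xs \<subseteq> V_star c \<longrightarrow> range ys \<subseteq> V_star c \<longrightarrow> xs \<longlonglongrightarrow> x \<longrightarrow> ys \<longlonglongrightarrow> y \<longrightarrow>
        (\<lambda>n. resistance_star c u (xs n) (ys n)) \<longlonglongrightarrow> r'"
    then show "r' = r" using assms r LIMSEQ_unique by blast
  qed
  then show ?thesis using r by simp
qed

lemma psi_word_image_V_star: "i \<in> lists letters \<Longrightarrow> psi_word c i ` V_star c \<subseteq> V_star c"
  using psi_word_V_star by blast

lemma resistance_metric_le_cell_radius:
  assumes "i \<in> lists letters" "x \<in> fractal_cell i" "y \<in> fractal_cell i"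
  shows "resistance_metric c u x y \<le> (cell_radius (tail_mass i))\<^sup>2"
proof -
  obtain xs where xs: "range xs \<subseteq> psi_word c i ` V_star c" "xs \<longlonglongrightarrow> x"
    using fractal_cell_limit[OF assms(2)] .
  obtain ys where ys: "range ys \<subseteq> psi_word c i ` V_star c" "ys \<longlonglongrightarrow> y"
    using fractal_cell_limit[OF assms(3)] .
  have V: "range xs \<subseteq> V_star c" "range ys \<subseteq> V_star c"
    using xs(1) ys(1) psi_word_image_V_star[OF assms(1)] by blast+
  show ?thesis
  proof (rule LIMSEQ_le_const2[OF resistance_metric_limit[OF V xs(2) ys(2)]], intro exI allI impI)
    fix n
    have "xs n \<in> psi_word c i ` V_star c" "ys n \<in> psi_word c i ` V_star c" using xs(1) ys(1) by blast+
    note osc = osc_bound_in_cell[OF assms(1) this]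
    have n: "xs n \<in> V_star c" "ys n \<in> V_star c" using V by auto
    show "resistance_star c u (xs n) (ys n) \<le> (cell_radius (tail_mass i))\<^sup>2"
      unfolding resistance_star_eq[OF n] using root_resistance_le[OF n osc] osc_bound_V_star(1)[OF n]
      by (intro power_mono) (auto simp: osc_bound_def)
  qed
qed

text \<open>To leave branch \<open>e\<close> from \<open>x\<close> one has to cross the cell
  \<open>k @ e # 1 # replicate m 2\<close> at the junction. Its function changes by 1 between
  \<open>x\<close> and \<open>y\<close> and has the reciprocal of its length as energy.\<close>

lemma resistance_metric_branch:
  assumes k: "k \<in> lists letters" "e \<in> letters" "e' \<in> letters" "e \<noteq> e'" "j \<in> lists letters"
    and j: "(0, 0) \<notin> cell c j" "j \<parallel> (1 # replicate m 2)"
    and x: "x \<in> fractal_cell (k @ e # j)" and y: "y \<in> fractal_cell (k @ [e'])"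
  shows "len (k @ e # 1 # replicate m 2) \<le> resistance_metric c u x y"
proof -
  let ?r = "k @ e # 1 # replicate m 2"
  have lists: "k @ e # j \<in> lists letters" "k @ [e'] \<in> lists letters" "?r \<in> lists letters"
    "1 # replicate m 2 \<in> lists letters"
    using k by auto
  obtain xs where xs: "range xs \<subseteq> psi_word c (k @ e # j) ` V_star c" "xs \<longlonglongrightarrow> x"
    using fractal_cell_limit[OF x] .
  obtain ys where ys: "range ys \<subseteq> psi_word c (k @ [e']) ` V_star c" "ys \<longlonglongrightarrow> y"
    using fractal_cell_limit[OF y] .
  have V: "range xs \<subseteq> V_star c" "range ys \<subseteq> V_star c"
    using xs(1) ys(1) psi_word_image_V_star[OF lists(1)] psi_word_image_V_star[OF lists(2)] by blast+
  define f where "f = cell_function c u ?r"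
  have f: "f \<in> finite_energy c u" "energy c u f = 1 / len ?r"
    unfolding f_def using energy_cell_function_limit[OF balanced lists(3)] by auto
  have l: "0 < len ?r" by (rule cell_length_pos[OF balanced lists(3)])
  have "len ?r \<le> resistance_star c u (xs n) (ys n)" for n
  proof -
    have n: "xs n \<in> V_star c" "ys n \<in> V_star c" using V by auto
    have "xs n \<in> psi_word c (k @ e # j) ` V_star c" using xs(1) by blast
    then obtain p where p: "p \<in> V_star c" "xs n = psi_word c k (psi c e (psi_word c j p))"
      by (auto simp: psi_word_append)
    have "ys n \<in> psi_word c (k @ [e']) ` V_star c" using ys(1) by blast
    then obtain p' where p': "p' \<in> V_star c" "ys n = psi_word c k (psi c e' p')"
      by (auto simp: psi_word_append)
    have D: "p \<in> diamond c" "p' \<in> diamond c" using p p' V_star_subset_diamond by auto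
    have pj: "psi_word c j p \<in> cell c j" using D by (simp add: cell_def)
    \<comment> \<open>The two cells can share only corners of the second one. Its right corner is
      the junction, which is excluded, so only its left corner remains, where the function vanishes
      as well.\<close>
    have "psi_word c j p = psi_word c (1 # replicate m 2) (0, 0)"
      if in_cell: "psi_word c j p \<in> cell c (1 # replicate m 2)"
    proof -
      have "(1 # replicate m 2) \<parallel> j" using j(2) by (auto simp: parallel_def)
      then have "psi_word c j p \<in> psi_word c (1 # replicate m 2) ` corners"
        using cell_Int_parallel[OF _ lists(4) k(5)] in_cell pj by blast
      moreover have "psi_word c (replicate m 2) (1, 0) = (1, 0)" by (induction m) auto
      then have "psi_word c (1 # replicate m 2) (1, 0) = (0, 0)" by simp
      ultimately show ?thesis using pj j(1) by auto
    qed
    then have "f (xs n) = 0"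
      unfolding f_def p(2) by (intro cell_function_branch(1)[OF k(1-4)] psi_word_diamond D) blast
    moreover have "f (ys n) = 1"
      unfolding f_def p'(2) by (intro cell_function_branch(2)[OF k(1-4)] D)
    ultimately have "1 \<le> root_resistance (xs n) (ys n) * sqrt (1 / len ?r)"
      using osc_bound_V_star(1)[OF n] f unfolding osc_bound_def by force
    then have "sqrt (len ?r) \<le> root_resistance (xs n) (ys n)"
      using l by (simp add: real_sqrt_divide field_simps)
    then have "(sqrt (len ?r))\<^sup>2 \<le> (root_resistance (xs n) (ys n))\<^sup>2"
      using l by (intro power_mono) auto
    then show ?thesis using l by (simp add: resistance_star_eq[OF n])
  qed
  then show ?thesis
    by (intro LIMSEQ_le_const[OF resistance_metric_limit[OF V xs(2) ys(2)]]) auto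
qed

end

section \<open>Hausdorff measures of the fractal\<close>

lemma sum_UN_le:
  fixes f :: "'b \<Rightarrow> real"
  assumes "finite I" "\<And>k. k \<in> I \<Longrightarrow> finite (A k)" "\<And>x. 0 \<le> f x"
  shows "sum f (\<Union>k\<in>I. A k) \<le> (\<Sum>k\<in>I. sum f (A k))"
  using assms(1,2)
proof (induction I rule: finite_induct)
  case (insert k I)
  have "sum f (A k \<union> (\<Union>k\<in>I. A k)) + sum f (A k \<inter> (\<Union>k\<in>I. A k)) = sum f (A k) + sum f (\<Union>k\<in>I. A k)"
    using insert by (intro sum.union_inter) auto
  moreover have "0 \<le> sum f (A k \<inter> (\<Union>k\<in>I. A k))" using assms(3) by (simp add: sum_nonneg)
  ultimately show ?case using insert by simp
qed simp

lemma hausdorff_measure_eq_0: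
  fixes X :: "'b set" and d :: "'b \<Rightarrow> 'b \<Rightarrow> real"
  assumes "\<And>\<delta> e. 0 < \<delta> \<Longrightarrow> 0 < e \<Longrightarrow> \<exists>(U :: 'i \<Rightarrow> 'b set) I. finite I \<and> X \<subseteq> (\<Union>i\<in>I. U i) \<and>
      (\<forall>i\<in>I. U i \<subseteq> X \<and> diam d (U i) \<le> ennreal \<delta>) \<and>
      (\<Sum>i\<in>I. enn2real (diam d (U i)) powr s) \<le> e"
    and s: "0 < s"
  shows "hausdorff_measure X d s = 0"
proof -
  have content: "hausdorff_content X d s \<delta> \<le> 0 + ennreal e" if \<delta>: "0 < \<delta>" and e: "0 < e" for \<delta> e
  proof -
    obtain U :: "'i \<Rightarrow> 'b set" and I where I: "finite I" "X \<subseteq> (\<Union>i\<in>I. U i)" "\<And>i. i \<in> I \<Longrightarrow> U i \<subseteq> X"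
      "\<And>i. i \<in> I \<Longrightarrow> diam d (U i) \<le> ennreal \<delta>"
      "(\<Sum>i\<in>I. enn2real (diam d (U i)) powr s) \<le> e"
      using assms(1)[OF \<delta> e] by blast
    obtain h where h: "bij_betw h {0..<card I} I" using ex_bij_betw_nat_finite[OF I(1)] by blast
    then have hI: "h k \<in> I" if "k < card I" for k using that by (auto simp: bij_betw_def)
    \<comment> \<open>The covering is padded with empty sets, which have diameter 0 and contribute
      0.\<close>
    define W where "W k = (if k < card I then U (h k) else {})" for k
    have [simp]: "diam d {} = 0" by (simp add: diam_def bot_ennreal)
    have "X \<subseteq> (\<Union>k. W k)"
    proof
      fix x assume "x \<in> X"
      then obtain i where i: "i \<in> I" "x \<in> U i" using I by blast
      then have "i \<in> h ` {0..<card I}" using h by (simp add: bij_betw_def)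
      then obtain k where "k < card I" "i = h k" by auto
      then show "x \<in> (\<Union>k. W k)" using i by (auto simp: W_def)
    qed
    then have "hausdorff_content X d s \<delta> \<le> (\<Sum>k. ennreal (enn2real (diam d (W k)) powr s))"
      unfolding hausdorff_content_def using I hI by (intro INF_lower) (auto simp: W_def)
    also have "\<dots> = (\<Sum>k\<in>{0..<card I}. ennreal (enn2real (diam d (W k)) powr s))"
      using s by (intro suminf_finite) (auto simp: W_def)
    also have "\<dots> = ennreal (\<Sum>k\<in>{0..<card I}. enn2real (diam d (U (h k))) powr s)"
      by (simp add: W_def sum_ennreal)
    also have "(\<Sum>k\<in>{0..<card I}. enn2real (diam d (U (h k))) powr s) = (\<Sum>i\<in>I. enn2real (diam d (U i)) powr s)"
      by (rule sum.reindex_bij_betw[OF h])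
    also have "ennreal \<dots> \<le> ennreal e" using I by (intro ennreal_leI) simp
    finally show ?thesis by simp
  qed
  have "hausdorff_content X d s \<delta> \<le> 0" if "0 < \<delta>" for \<delta>
    by (rule ennreal_le_epsilon) (rule content[OF that])
  then have "hausdorff_measure X d s \<le> 0"
    unfolding hausdorff_measure_def by (intro SUP_least) auto
  then show ?thesis by simp
qed

text \<open>The combinatorial substitute for a mass distribution on the fractal. \<open>F\<close>
  need not be an antichain, as overlaps only increase the sum; \<open>N\<close> restricts the claim
  to deep cuts, where the random error is small.\<close>

definition cut_sums_bounded :: "(nat list \<Rightarrow> real) \<Rightarrow> real \<Rightarrow> bool" where
  "cut_sums_bounded u s \<longleftrightarrow> (\<exists>\<kappa>>0. \<exists>N. \<forall>F. finite F \<longrightarrow> F \<subseteq> lists letters \<longrightarrow> (\<forall>i\<in>F. N \<le> length i) \<longrightarrow>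
     (\<exists>n. \<forall>j\<in>words letters n. \<exists>i\<in>F. prefix i j) \<longrightarrow> \<kappa> \<le> (\<Sum>i\<in>F. cell_length u i powr s))"

lemma cut_sums_bounded_antimono:
  assumes "balanced \<epsilon> u" "cut_sums_bounded u t" "s \<le> t"
  shows "cut_sums_bounded u s"
proof -
  have le: "(\<Sum>i\<in>F. cell_length u i powr t) \<le> (\<Sum>i\<in>F. cell_length u i powr s)" if "F \<subseteq> lists letters" for F
  proof (rule sum_mono)
    fix i assume "i \<in> F"
    then have "i \<in> lists letters" using that by blast
    then show "cell_length u i powr t \<le> cell_length u i powr s"
      using cell_length_pos[OF assms(1)] cell_length_le_1[OF assms(1)] assms(3)
      by (intro powr_mono') (auto intro: less_imp_le)
  qed
  obtain \<kappa> N where "0 < \<kappa>" and \<kappa>: "\<And>F. finite F \<Longrightarrow> F \<subseteq> lists letters \<Longrightarrow> \<forall>i\<in>F. N \<le> length i \<Longrightarrow>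
      \<exists>n. \<forall>j\<in>words letters n. \<exists>i\<in>F. prefix i j \<Longrightarrow> \<kappa> \<le> (\<Sum>i\<in>F. cell_length u i powr t)"
    using assms(2) unfolding cut_sums_bounded_def by auto
  then show ?thesis
    unfolding cut_sums_bounded_def
    by (intro exI[of _ \<kappa>] conjI exI[of _ N] allI impI) (assumption, rule order_trans[OF \<kappa> le])
qed

section \<open>Coverings by the cells of one level\<close>

context decaying_network
begin

lemma diam_fractal_cell:
  assumes "i \<in> lists letters"
  shows "diam (resistance_metric c u) (fractal_cell i) \<le> ennreal ((cell_radius (tail_mass i))\<^sup>2)"
  unfolding diam_def using resistance_metric_le_cell_radius[OF assms]
  by (intro SUP_least) (auto intro!: ennreal_leI)

text \<open>The exponent 1 / (2 \<theta>) is matched to the squared radius, so the covering sum of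
  exponent \<theta> is linear in the tail masses.\<close>

lemma cell_radius_powr:
  assumes "0 \<le> t"
  shows "(cell_radius t)\<^sup>2 powr \<theta> = (2 / (1 - q)) powr (2 * \<theta>) * t"
proof (cases "t = 0")
  case True
  then show ?thesis by (simp add: cell_radius_def)
next
  case False
  then have t: "0 < t" using assms by simp
  have "(cell_radius t)\<^sup>2 = cell_radius t powr 2"
    using t q_bounds by (intro powr_numeral[symmetric]) (auto simp: cell_radius_def)
  then have "(cell_radius t)\<^sup>2 powr \<theta> = cell_radius t powr (2 * \<theta>)" by (simp add: powr_powr)
  also have "\<dots> = (2 / (1 - q)) powr (2 * \<theta>) * (t powr (1 / (2 * \<theta>))) powr (2 * \<theta>)"
    unfolding cell_radius_def by (rule powr_mult)
  also have "(t powr (1 / (2 * \<theta>))) powr (2 * \<theta>) = t"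
    using t \<theta>_pos by (simp add: powr_powr)
  finally show ?thesis .
qed

lemma hausdorff_measure_decay: "hausdorff_measure (fractal c) (resistance_metric c u) \<theta> = 0"
proof (rule hausdorff_measure_eq_0[where 'i = "nat list", OF _ \<theta>_pos])
  fix \<delta> e :: real assume \<delta>: "0 < \<delta>" and e: "0 < e"
  define B where "B = (2 / (1 - q)) powr (2 * \<theta>)"
  have "(\<lambda>n. B * (K / (1 - sqrt \<rho>)) * \<rho> ^ n) \<longlonglongrightarrow> 0"
    using LIMSEQ_power_zero[of \<rho>] \<rho>_pos \<rho>_less by (intro tendsto_mult_right_zero) auto
  then have "eventually (\<lambda>n. B * (K / (1 - sqrt \<rho>)) * \<rho> ^ n < e) sequentially"
    using e by (rule order_tendstoD)
  moreover have "(\<lambda>n. (cell_radius (K / (1 - sqrt \<rho>) * \<rho> ^ n))\<^sup>2) \<longlonglongrightarrow> 0\<^sup>2"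
    by (intro tendsto_power cell_radius_tendsto)
  then have "eventually (\<lambda>n. (cell_radius (K / (1 - sqrt \<rho>) * \<rho> ^ n))\<^sup>2 < \<delta>) sequentially"
    using \<delta> by (intro order_tendstoD) auto
  ultimately have "eventually (\<lambda>n. B * (K / (1 - sqrt \<rho>)) * \<rho> ^ n < e \<and>
      (cell_radius (K / (1 - sqrt \<rho>) * \<rho> ^ n))\<^sup>2 < \<delta>) sequentially"
    by eventually_elim auto
  then obtain n where n: "B * (K / (1 - sqrt \<rho>)) * \<rho> ^ n < e"
    "(cell_radius (K / (1 - sqrt \<rho>) * \<rho> ^ n))\<^sup>2 < \<delta>"
    by (auto simp: eventually_sequentially)
  let ?d = "resistance_metric c u"
  have "(\<Sum>i\<in>words letters n. enn2real (diam ?d (fractal_cell i)) powr \<theta>) \<le> (\<Sum>i\<in>words letters n. B * tail_mass i)"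
  proof (intro sum_mono)
    fix i assume "i \<in> words letters n"
    then have i: "i \<in> lists letters" by (simp add: words_iff)
    have "enn2real (diam ?d (fractal_cell i)) \<le> (cell_radius (tail_mass i))\<^sup>2"
      using diam_fractal_cell[OF i] by (intro enn2real_leI) auto
    then have "enn2real (diam ?d (fractal_cell i)) powr \<theta> \<le> (cell_radius (tail_mass i))\<^sup>2 powr \<theta>"
      using \<theta>_pos by (intro powr_mono2) auto
    then show "enn2real (diam ?d (fractal_cell i)) powr \<theta> \<le> B * tail_mass i"
      using cell_radius_powr[OF tail_mass_nonneg[OF i]] by (simp add: B_def)
  qed
  also have "\<dots> \<le> B * (K / (1 - sqrt \<rho>) * \<rho> ^ n)"
    unfolding sum_distrib_left[symmetric] by (intro mult_left_mono sum_tail_mass) (simp add: B_def)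
  also have "\<dots> \<le> e" using n(1) by simp
  finally have "(\<Sum>i\<in>words letters n. enn2real (diam ?d (fractal_cell i)) powr \<theta>) \<le> e" .
  moreover have "diam ?d (fractal_cell i) \<le> ennreal \<delta>" if "i \<in> words letters n" for i
  proof -
    have i: "i \<in> lists letters" using that by (simp add: words_iff)
    have "0 \<le> cell_radius (tail_mass i)" using q_bounds by (simp add: cell_radius_def)
    then have "(cell_radius (tail_mass i))\<^sup>2 \<le> (cell_radius (K / (1 - sqrt \<rho>) * \<rho> ^ n))\<^sup>2"
      using tail_mass_le[OF that] tail_mass_nonneg[OF i] by (intro power_mono cell_radius_mono)
    then have "(cell_radius (tail_mass i))\<^sup>2 \<le> \<delta>" using n(2) by simp
    then show ?thesis using diam_fractal_cell[OF i] ennreal_leI order_trans by blast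
  qed
  moreover have "fractal_cell i \<subseteq> fractal c" if "i \<in> words letters n" for i
    using that fractal_cell_subset by (simp add: words_iff)
  ultimately show "\<exists>(U :: nat list \<Rightarrow> _) I. finite I \<and> fractal c \<subseteq> (\<Union>i\<in>I. U i) \<and>
      (\<forall>i\<in>I. U i \<subseteq> fractal c \<and> diam ?d (U i) \<le> ennreal \<delta>) \<and>
      (\<Sum>i\<in>I. enn2real (diam ?d (U i)) powr \<theta>) \<le> e"
    using fractal_words[of n] by (intro exI[of _ fractal_cell] exI[of _ "words letters n"]) auto
qed

section \<open>Antichains and cuts in the tree of addresses\<close>

lemma cell_left_corner:
  "(1, 0) \<in> cell c j \<Longrightarrow> j = replicate (length j) 2"
  "(0, 0) \<in> cell c j \<Longrightarrow> j \<noteq> [] \<Longrightarrow> j = 1 # replicate (length j - 1) 2"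
proof -
  show 1: "j = replicate (length j) 2" if "(1, 0) \<in> cell c j" for j
    using that
  proof (induction j)
    case (Cons a j)
    then obtain p where p: "p \<in> cell c j" "psi c a p = (1, 0)" by (auto simp: cell_Cons)
    then have "a = 2" "p = (1, 0)" using psi_eq_right cell_subset_diamond by blast+
    then show ?case using Cons p by simp
  qed simp
  show "j = 1 # replicate (length j - 1) 2" if j: "(0, 0) \<in> cell c j" "j \<noteq> []"
  proof -
    obtain a j' where a: "j = a # j'" using j by (cases j) auto
    then obtain p where p: "p \<in> cell c j'" "psi c a p = (0, 0)" using j by (auto simp: cell_Cons)
    then have "a = 1" "p = (1, 0)" using psi_eq_left cell_subset_diamond by blast+
    then show ?thesis using 1[of j'] p a by simp
  qed
qed

lemma left_corner_ray: "(0, 0) \<in> cell c (1 # replicate m 2)"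
proof -
  have "psi_word c (replicate m 2) (1, 0) = (1, 0)" by (induction m) auto
  then have "psi_word c (1 # replicate m 2) (1, 0) = (0, 0)" by simp
  then show ?thesis unfolding cell_def by (intro image_eqI[of _ _ "(1, 0)"]) auto
qed

text \<open>Cells of an antichain which meet a set of small diameter all contain a common vertex, and a
  vertex lies in at most three cells of an antichain.\<close>

lemma antichain_cells_meeting:
  assumes C: "C \<subseteq> lists letters" and anti: "\<And>i j. i \<in> C \<Longrightarrow> j \<in> C \<Longrightarrow> prefix i j \<Longrightarrow> i = j"
    and cover: "\<And>j. j \<in> words letters L \<Longrightarrow> \<exists>i\<in>C. prefix i j"
    and small: "\<And>x y i. x \<in> U \<Longrightarrow> y \<in> U \<Longrightarrow> i \<in> C \<Longrightarrow> resistance_metric c u x y < len i"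
  shows "finite {i \<in> C. fractal_cell i \<inter> U \<noteq> {}} \<and> card {i \<in> C. fractal_cell i \<inter> U \<noteq> {}} \<le> 3"
proof (cases "{i \<in> C. fractal_cell i \<inter> U \<noteq> {}} = {}")
  case False
  define F where "F = {i \<in> C. fractal_cell i \<inter> U \<noteq> {}}"
  have FC: "F \<subseteq> C" by (auto simp: F_def)
  have Fl: "i \<in> lists letters" if "i \<in> F" for i using that FC C by blast
  define k where "k = Longest_common_prefix F"
  have F: "F \<noteq> {}" using False by (simp add: F_def)
  have kF: "prefix k i" if "i \<in> F" for i
    using Longest_common_prefix_prefix[OF that] by (simp add: k_def)
  show ?thesis
  proof (cases "k \<in> F")
    case True
    then have "F = {k}" using kF anti FC by blast
    then show ?thesis by (simp add: F_def[symmetric])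
  next
    case k: False
    have split: "\<exists>e j. i = k @ e # j \<and> e \<in> letters \<and> j \<in> lists letters" if i: "i \<in> F" for i
    proof -
      obtain j where j: "i = k @ j" using kF[OF i] by (auto simp: prefix_def)
      then have "j \<noteq> []" using i k by auto
      then obtain e j' where "j = e # j'" by (cases j) auto
      then show ?thesis using j Fl[OF i] by auto
    qed
    have other: "\<exists>e' j. k @ e' # j \<in> F \<and> e' \<noteq> e" for e
    proof (rule ccontr)
      assume *: "\<not> ?thesis"
      have "prefix (k @ [e]) i" if "i \<in> F" for i
        using split[OF that] * that by (auto simp: prefix_def)
      then have "length (k @ [e]) \<le> length k"
        using Longest_common_prefix_longest[OF F] unfolding k_def by blast
      then show False by simp
    qed
    \<comment> \<open>Suppose the cell misses the junction below \<open>k\<close>. The ray of cells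
      of branch \<open>e\<close> at the junction runs into the cut at some \<open>p\<close>, and
      \<open>p\<close> separates this cell from a point of \<open>U\<close> in another branch. Two
      points of \<open>U\<close> then have distance at least \<open>len p\<close>, against the
      smallness of \<open>U\<close>.\<close>
    have corner: "(0, 0) \<in> cell c j" if i: "k @ e # j \<in> F" for e j
    proof (rule ccontr)
      assume not: "(0, 0) \<notin> cell c j"
      obtain e' j' where i': "k @ e' # j' \<in> F" "e' \<noteq> e" using other by blast
      have kl: "k \<in> lists letters" "e \<in> letters" "j \<in> lists letters" "e' \<in> letters" "j' \<in> lists letters"
        using Fl[OF i] Fl[OF i'(1)] by auto
      define w where "w = k @ e # 1 # replicate L 2"
      have "set w \<subseteq> letters" using kl by (auto simp: w_def)
      then have "take L w \<in> words letters L"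
        using set_take_subset[of L w] by (auto simp: words_def w_def simp del: take_append)
      then obtain p where p: "p \<in> C" "prefix p (take L w)" using cover by blast
      then have pw: "prefix p w" using take_is_prefix prefix_order.trans by blast
      have "\<not> prefix p (k @ [e])"
      proof
        assume pk: "prefix p (k @ [e])"
        then have "prefix p (k @ e # j)" using prefix_prefix[OF pk, of j] by simp
        then have "p = k @ e # j" using anti p(1) i FC by blast
        then have "j = []" using prefix_length_le[OF pk] by simp
        then show False using not by simp
      qed
      moreover have "prefix p ((k @ [e]) @ (1 # replicate L 2))"
        using pw by (simp add: w_def)
      ultimately obtain us where us: "p = (k @ [e]) @ us" "prefix us (1 # replicate L 2)"
        unfolding prefix_append by blast
      have "us \<noteq> []" using us(1) \<open>\<not> prefix p (k @ [e])\<close> by auto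
      then obtain us' where us': "us = 1 # us'" "prefix us' (replicate L 2)"
        using us(2) by (cases us) auto
      then have "us' = replicate (min (length us') L) 2"
        by (metis append_eq_conv_conj prefix_def take_replicate)
      then obtain m where m: "us = 1 # replicate m 2" using us'(1) by blast
      have pr: "p = k @ e # 1 # replicate m 2" using us m by simp
      have "j \<parallel> (1 # replicate m 2)"
      proof (rule ccontr)
        assume "\<not> j \<parallel> (1 # replicate m 2)"
        then have "prefix (k @ e # j) p \<or> prefix p (k @ e # j)"
          unfolding pr by (auto simp: parallel_def)
        then have "k @ e # j = p" using anti p(1) i FC by blast
        then have "j = 1 # replicate m 2" using pr by simp
        then show False using not left_corner_ray by simp
      qed
      moreover obtain x where x: "x \<in> fractal_cell (k @ e # j)" "x \<in> U" using i by (auto simp: F_def)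
      moreover obtain y where y: "y \<in> fractal_cell (k @ e' # j')" "y \<in> U" using i' by (auto simp: F_def)
      moreover have "y \<in> fractal_cell (k @ [e'])"
        using fractal_cell_append_subset[OF kl(5), of "k @ [e']"] y by auto
      ultimately have "len p \<le> resistance_metric c u x y"
        unfolding pr using kl i'(2) not by (intro resistance_metric_branch) auto
      then show False using small[OF x(2) y(2) p(1)] by simp
    qed
    \<comment> \<open>Cells of one branch containing the junction lie on a single ray, where an
      antichain has at most one element. So the letter after \<open>k\<close> determines the cell,
      and there are three letters.\<close>
    have inj: "inj_on (\<lambda>i. i ! length k) F"
    proof (rule inj_onI)
      fix i i' assume *: "i \<in> F" "i' \<in> F" "i ! length k = i' ! length k"
      obtain e j j' where e: "i = k @ e # j" "i' = k @ e # j'"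
        using split[OF *(1)] split[OF *(2)] *(3) by auto
      \<comment> \<open>Both words are compared with one ray that is long enough for each of
        them.\<close>
      define M where "M = length j + length j'"
      have ray: "prefix j'' (1 # replicate M 2)"
        if "(0, 0) \<in> cell c j''" "length j'' \<le> M" for j''
      proof (cases "j'' = []")
        case False
        have "replicate M 2 = replicate (length j'' - 1) 2 @ replicate (M - (length j'' - 1)) (2::nat)"
          using that(2) by (simp add: replicate_add[symmetric])
        then show ?thesis using cell_left_corner(2)[OF that(1) False] by (metis append_Cons prefixI)
      qed simp
      have "prefix j j' \<or> prefix j' j"
      proof -
        have "prefix j (1 # replicate M 2)" "prefix j' (1 # replicate M 2)"
          using ray[of j] ray[of j'] corner * e by (auto simp: M_def)
        then show ?thesis using prefix_same_cases by blast
      qed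
      then have "prefix i i' \<or> prefix i' i" using e by auto
      then show "i = i'" using anti * FC by blast
    qed
    have "(\<lambda>i. i ! length k) ` F \<subseteq> letters"
    proof (rule image_subsetI)
      fix i assume "i \<in> F"
      from split[OF this] show "i ! length k \<in> letters" by auto
    qed
    then have "finite F" "card F \<le> 3"
      using card_inj_on_le[OF inj _ finite_letters] finite_imageD[OF finite_subset[OF _ finite_letters] inj]
      by simp_all
    then show ?thesis by (simp add: F_def[symmetric])
  qed
qed (simp only: card.empty finite.emptyI, simp)

lemma len_le_geometric:
  assumes "i \<in> lists letters"
  shows "len i \<le> (tail_mass [] powr (1 / (2 * \<theta>)) * q ^ length i)\<^sup>2"
  using power_mono[OF sqrt_len_le[of "[]" i], of 2] cell_length_pos[OF balanced assms] assms by simp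

lemma len_antimono:
  assumes "j \<in> lists letters" "prefix i j"
  shows "len j \<le> len i"
proof -
  obtain w where w: "j = i @ w" using assms(2) by (auto simp: prefix_def)
  then have "i \<in> lists letters" "w \<in> lists letters" using assms(1) by auto
  then have "cell_length (subcascade u i) w \<le> 1" "0 < len i"
    using cell_length_le_1[OF balanced_subcascade[OF balanced]] cell_length_pos[OF balanced] by auto
  then show ?thesis unfolding w cell_length_append by (intro mult_left_le) auto
qed

text \<open>The stopping line at scale \<open>r\<close>: lengths decrease along a branch, and these
  words are where they first drop to \<open>r\<close>. As all weights exceed \<epsilon>, their
  lengths lie between \<epsilon> r and r.\<close>

definition cut_at :: "real \<Rightarrow> nat list set" where
  "cut_at r = {i \<in> lists letters. i \<noteq> [] \<and> len i \<le> r \<and> r < len (butlast i)}"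

lemma cut_at_antichain:
  assumes "i \<in> cut_at r" "j \<in> cut_at r" "prefix i j"
  shows "i = j"
proof (rule ccontr)
  assume "i \<noteq> j"
  then obtain w where "j = i @ w" "w \<noteq> []" using assms(3) by (auto simp: prefix_def)
  then have "butlast j = i @ butlast w" by (simp add: butlast_append)
  moreover have "set (butlast j) \<subseteq> letters" using assms(2) by (auto simp: cut_at_def dest: in_set_butlastD)
  ultimately have "len (butlast j) \<le> len i" by (intro len_antimono) auto
  then show False using assms by (auto simp: cut_at_def)
qed

text \<open>The geometric bound is uniform over words of equal length, so one level exists at which
  all lengths have dropped to \<open>r\<close>.\<close>

lemma cut_at_cover:
  assumes "0 < r" "r < 1"
  shows "\<exists>L. \<forall>j\<in>words letters L. \<exists>i\<in>cut_at r. prefix i j"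
proof -
  have "(\<lambda>n. (tail_mass [] powr (1 / (2 * \<theta>)) * q ^ n)\<^sup>2) \<longlonglongrightarrow> (tail_mass [] powr (1 / (2 * \<theta>)) * 0)\<^sup>2"
    using q_bounds by (intro tendsto_intros LIMSEQ_power_zero) auto
  then have "eventually (\<lambda>n. (tail_mass [] powr (1 / (2 * \<theta>)) * q ^ n)\<^sup>2 < r) sequentially"
    using assms by (intro order_tendstoD) auto
  then obtain L where L: "(tail_mass [] powr (1 / (2 * \<theta>)) * q ^ L)\<^sup>2 < r"
    by (auto simp: eventually_sequentially)
  show ?thesis
  proof (intro exI[of _ L] ballI)
    fix j assume j: "j \<in> words letters L"
    define n where "n = (LEAST n. len (take n j) \<le> r)"
    have "len (take L j) \<le> r" using len_le_geometric[of j] j L by (auto simp: words_iff)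
    then have n: "len (take n j) \<le> r" "n \<le> L" unfolding n_def by (auto intro: LeastI Least_le)
    have "n \<noteq> 0" using n(1) assms by (intro notI) simp
    then obtain n' where n': "n = Suc n'" by (cases n) auto
    have "r < len (take n' j)" using not_less_Least[of n' "\<lambda>n. len (take n j) \<le> r"] n' n_def by auto
    moreover have "butlast (take n j) = take n' j" using n n' j by (simp add: words_iff butlast_take)
    moreover have "take n j \<noteq> []" using n n' j by (auto simp: words_iff)
    moreover have "take n j \<in> lists letters" using j by (auto simp: words_iff dest: in_set_takeD)
    ultimately have "take n j \<in> cut_at r" using n(1) by (simp add: cut_at_def)
    then show "\<exists>i\<in>cut_at r. prefix i j" using take_is_prefix by blast
  qed
qed

text \<open>Koenig's lemma on the tree of addresses without prefix in \<open>F\<close>, combined with compactness of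
  the cells along an infinite branch.\<close>

lemma finite_depth:
  assumes cover: "\<And>x. x \<in> fractal c \<Longrightarrow> \<exists>L. \<forall>j\<in>words letters L. x \<in> fractal_cell j \<longrightarrow> (\<exists>i\<in>F. prefix i j)"
  shows "\<exists>n. \<forall>j\<in>words letters n. \<exists>i\<in>F. prefix i j"
proof (rule ccontr)
  assume neg: "\<not> ?thesis"
  define bad where "bad j \<longleftrightarrow> j \<in> lists letters \<and>
    (\<forall>n. \<exists>j'\<in>words letters n. \<forall>i\<in>F. \<not> prefix i (j @ j'))" for j
  have bad_Nil: "bad []" using neg by (auto simp: bad_def)
  have step: "\<exists>a\<in>letters. bad (j @ [a])" if "bad j" for j
  proof (rule ccontr)
    assume "\<not> ?thesis"
    then have "\<exists>n. \<forall>j'\<in>words letters n. \<exists>i\<in>F. prefix i (j @ a # j')" if "a \<in> letters" for a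
      using that \<open>bad j\<close> unfolding bad_def by auto
    then obtain N where N: "\<And>a j'. a \<in> letters \<Longrightarrow> j' \<in> words letters (N a) \<Longrightarrow> \<exists>i\<in>F. prefix i (j @ a # j')"
      by metis
    define M where "M = Max (N ` letters)"
    have NM: "N a \<le> M" if "a \<in> letters" for a using that by (simp add: M_def)
    obtain j' where j': "j' \<in> words letters (Suc M)" "\<forall>i\<in>F. \<not> prefix i (j @ j')"
      using \<open>bad j\<close> unfolding bad_def by blast
    obtain a j'' where a: "a \<in> letters" "j'' \<in> words letters M" "j' = a # j''"
      using j'(1) by (auto simp: words_Suc)
    have "take (N a) j'' \<in> words letters (N a)"
      using a NM[OF a(1)] by (auto simp: words_def dest: in_set_takeD)
    then obtain i where i: "i \<in> F" "prefix i (j @ a # take (N a) j'')" using N a by blast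
    have "j @ j' = (j @ a # take (N a) j'') @ drop (N a) j''" using a by simp
    then have "prefix i (j @ j')" using i(2) prefix_prefix by metis
    then show False using j' i by blast
  qed
  have "\<exists>f. \<forall>n. (bad (f n) \<and> length (f n) = n) \<and> (\<exists>a\<in>letters. f (Suc n) = f n @ [a])"
  proof (rule dependent_nat_choice)
    show "\<exists>j. bad j \<and> length j = 0" using bad_Nil by auto
    fix j n assume "bad j \<and> length j = n"
    moreover then obtain a where "a \<in> letters" "bad (j @ [a])" using step by blast
    ultimately show "\<exists>j'. (bad j' \<and> length j' = Suc n) \<and> (\<exists>a\<in>letters. j' = j @ [a])"
      by (intro exI[of _ "j @ [a]"]) auto
  qed
  then obtain f where f: "\<And>n. bad (f n) \<and> length (f n) = n"
      "\<And>n. \<exists>a\<in>letters. f (Suc n) = f n @ [a]"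
    by blast
  have lists: "f n \<in> lists letters" for n using f(1) by (auto simp: bad_def)
  have "\<Inter>(range (\<lambda>n. fractal_cell (f n))) \<noteq> {}"
  proof (rule compact_nest)
    have "fractal_cell (f (Suc n)) \<subseteq> fractal_cell (f n)" for n
    proof -
      obtain a where "a \<in> letters" "f (Suc n) = f n @ [a]" using f(2) by blast
      then show ?thesis using fractal_cell_append_subset[of "[a]" "f n"] by simp
    qed
    then show "fractal_cell (f n) \<subseteq> fractal_cell (f m)" if "m \<le> n" for m n
      using lift_Suc_antimono_le[of "\<lambda>n. fractal_cell (f n)"] that by blast
  qed (auto simp: compact_fractal_cell fractal_cell_nonempty)
  then obtain x where x: "\<And>n. x \<in> fractal_cell (f n)" by blast
  then have "x \<in> fractal c" using fractal_cell_subset lists by blast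
  then obtain L where L: "\<And>j. j \<in> words letters L \<Longrightarrow> x \<in> fractal_cell j \<Longrightarrow> \<exists>i\<in>F. prefix i j"
    using cover by blast
  have "f L \<in> words letters L" using f(1) lists by (simp add: words_iff)
  then obtain i where i: "i \<in> F" "prefix i (f L)" using L x by blast
  moreover have "bad (f L)" using f(1) by blast
  then have "\<forall>i\<in>F. \<not> prefix i (f L)" unfolding bad_def by (metis append_Nil2 words_0 singletonD)
  ultimately show False by blast
qed

text \<open>Each covering set has its own scale and hence its own cut, from which only the cells
  meeting the set are kept, at most three. The kept cells together have finite depth by compactness,
  so finitely many of them form a cut, whose sum is controlled by the covering sum.\<close>

lemma hausdorff_measure_nonzero:
  assumes s: "0 < s" and cut: "cut_sums_bounded u s"
  shows "hausdorff_measure (fractal c) (resistance_metric c u) s \<noteq> 0"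
proof
  let ?R = "resistance_metric c u"
  assume "hausdorff_measure (fractal c) ?R s = 0"
  \<comment> \<open>Scale 1 suffices, because a small covering sum already forces small
    diameters.\<close>
  then have content: "hausdorff_content (fractal c) ?R s 1 = 0"
    unfolding hausdorff_measure_def
    by (metis SUP_upper bot.extremum_unique bot_ennreal greaterThan_iff zero_less_one)
  obtain \<kappa> N where \<kappa>: "0 < \<kappa>" and cuts: "\<And>F. finite F \<Longrightarrow> F \<subseteq> lists letters \<Longrightarrow> \<forall>i\<in>F. N \<le> length i \<Longrightarrow>
      \<exists>n. \<forall>j\<in>words letters n. \<exists>i\<in>F. prefix i j \<Longrightarrow> \<kappa> \<le> (\<Sum>i\<in>F. len i powr s)"
    using cut unfolding cut_sums_bounded_def by auto
  have \<epsilon>: "0 < \<epsilon>" "\<epsilon> < 1"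
    using balancedD(1)[OF balanced] balancedD(2,4)[OF balanced, of 1] by auto
  \<comment> \<open>The first entry makes every scale so small that the cells kept have length at
    least \<open>N\<close>; the second makes the final estimate \<kappa> \<epsilon>^s \<le> 6 \<eta>
    impossible.\<close>
  define \<eta> where "\<eta> = min ((\<epsilon> ^ Suc N) powr s / 3) (\<kappa> * \<epsilon> powr s / 7)"
  have \<eta>: "0 < \<eta>" "2 * \<eta> < (\<epsilon> ^ Suc N) powr s" "6 * \<eta> < \<kappa> * \<epsilon> powr s"
  proof -
    have pos: "0 < (\<epsilon> ^ Suc N) powr s" "0 < \<kappa> * \<epsilon> powr s" using \<epsilon> \<kappa> by auto
    then show "0 < \<eta>" by (simp add: \<eta>_def)
    have "\<eta> \<le> (\<epsilon> ^ Suc N) powr s / 3" "\<eta> \<le> \<kappa> * \<epsilon> powr s / 7" by (auto simp: \<eta>_def)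
    then show "2 * \<eta> < (\<epsilon> ^ Suc N) powr s" "6 * \<eta> < \<kappa> * \<epsilon> powr s" using pos by linarith+
  qed
  obtain U :: "nat \<Rightarrow> (real \<times> real) set" where U: "\<And>k. U k \<subseteq> fractal c" "\<And>k. diam ?R (U k) \<le> ennreal 1"
    "fractal c \<subseteq> (\<Union>k. U k)" "(\<Sum>k. ennreal (enn2real (diam ?R (U k)) powr s)) < ennreal \<eta>"
  proof -
    have "hausdorff_content (fractal c) ?R s 1 < ennreal \<eta>" using content \<eta>(1) by simp
    then show ?thesis unfolding hausdorff_content_def INF_less_iff using that by blast
  qed
  define d where "d k = enn2real (diam ?R (U k))" for k
  have d: "?R x y \<le> d k" if "x \<in> U k" "y \<in> U k" for x y k
  proof -
    have "ennreal (?R x y) \<le> diam ?R (U k)"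
      unfolding diam_def using that by (intro SUP_upper2[of "(x, y)"]) auto
    also have "\<dots> = ennreal (d k)"
      using U(2)[of k] unfolding d_def by (intro ennreal_enn2real[symmetric]) (auto simp: top.not_eq_extremum le_less_trans)
    finally show ?thesis by (simp add: ennreal_le_iff d_def)
  qed
  have sum_d: "(\<Sum>k<m. d k powr s) \<le> \<eta>" for m
  proof -
    have "ennreal (\<Sum>k<m. d k powr s) = (\<Sum>k<m. ennreal (d k powr s))" by (simp add: sum_ennreal)
    also have "\<dots> \<le> (\<Sum>k. ennreal (d k powr s))" by (intro sum_le_suminf) auto
    also have "\<dots> \<le> ennreal \<eta>" using U(4) by (simp add: d_def)
    finally show ?thesis using \<eta>(1) by (simp add: ennreal_le_iff)
  qed
  \<comment> \<open>A diameter may vanish, so each one is enlarged to a positive scale. In the power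
    s the enlargements add up to at most \<eta>.\<close>
  define r where "r k = (d k powr s + \<eta> * (1 / 2) ^ Suc k) powr (1 / s)" for k
  have base_pos: "0 < d k powr s + \<eta> * (1 / 2) ^ Suc k" for k
    using \<eta>(1) by (intro add_nonneg_pos) auto
  have r_powr: "r k powr s = d k powr s + \<eta> * (1 / 2) ^ Suc k" for k
    using s base_pos[of k] by (simp add: r_def powr_powr)
  have r_pos: "0 < r k" for k using base_pos[of k] by (simp add: r_def)
  have d_less_r: "d k < r k" for k
  proof -
    have "d k powr s < r k powr s" using \<eta>(1) by (simp add: r_powr)
    then show ?thesis using r_pos[of k] s by (meson less_imp_le not_le powr_mono2)
  qed
  have r_small: "r k < \<epsilon> ^ Suc N" for k
  proof -
    have "d k powr s \<le> (\<Sum>k<Suc k. d k powr s)" by (intro member_le_sum) auto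
    then have "d k powr s \<le> \<eta>" using sum_d order_trans by blast
    moreover have "\<eta> * (1 / 2) ^ Suc k \<le> \<eta> * 1" using \<eta>(1) by (intro mult_left_mono power_le_one) auto
    ultimately have "r k powr s < (\<epsilon> ^ Suc N) powr s" using \<eta>(2) by (simp only: r_powr)
    then show ?thesis using \<epsilon> s by (meson less_imp_le not_le powr_mono2 zero_less_power)
  qed
  have r\<epsilon>: "0 < r k / \<epsilon>" "r k / \<epsilon> < \<epsilon> ^ N" "r k / \<epsilon> < 1" for k
  proof -
    show "0 < r k / \<epsilon>" using r_pos \<epsilon> by simp
    show *: "r k / \<epsilon> < \<epsilon> ^ N" using r_small[of k] \<epsilon> by (simp add: divide_less_eq mult.commute)
    have "\<epsilon> ^ N \<le> 1" using \<epsilon> by (simp add: power_le_one)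
    then show "r k / \<epsilon> < 1" using * by simp
  qed
  \<comment> \<open>Dividing by \<epsilon> compensates for the last letter: the lengths in the cut
    still exceed \<open>r k\<close>, hence the diameter of \<open>U k\<close>.\<close>
  define C where "C k = cut_at (r k / \<epsilon>)" for k
  have C: "i \<in> lists letters" "len i \<le> r k / \<epsilon>" "d k < len i" "N \<le> length i" if i: "i \<in> C k" for i k
  proof -
    show l: "i \<in> lists letters" "len i \<le> r k / \<epsilon>" using i by (auto simp: C_def cut_at_def)
    have ne: "i \<noteq> []" "r k / \<epsilon> < len (butlast i)" using i by (auto simp: C_def cut_at_def)
    have bl: "butlast i \<in> lists letters" using l by (auto dest: in_set_butlastD)
    have la: "last i \<in> letters" using l ne last_in_set by auto
    have "len i = len (butlast i) * subcascade u (butlast i) [last i]"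
      using cell_length_append[of u "butlast i" "[last i]"] ne by simp
    moreover have "\<epsilon> < subcascade u (butlast i) [last i]"
      using balancedD(2)[OF balanced_subcascade[OF balanced bl] la] .
    then have "r k / \<epsilon> * \<epsilon> < len (butlast i) * subcascade u (butlast i) [last i]"
      using ne(2) r\<epsilon>(1)[of k] \<epsilon> by (intro mult_strict_mono) auto
    ultimately show "d k < len i" using d_less_r[of k] \<epsilon> by simp
    have "\<epsilon> ^ length i < \<epsilon> ^ N"
      using cell_length_ge[OF balanced l(1)] l(2) r\<epsilon>(2)[of k] by linarith
    then show "N \<le> length i" using \<epsilon> by (metis less_imp_le not_le power_decreasing)
  qed
  define F where "F k = {i \<in> C k. fractal_cell i \<inter> U k \<noteq> {}}" for k
  have F_card: "finite (F k)" "card (F k) \<le> 3" for k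
  proof -
    obtain L where "\<And>j. j \<in> words letters L \<Longrightarrow> \<exists>i\<in>C k. prefix i j"
      using cut_at_cover[OF r\<epsilon>(1,3)] unfolding C_def by blast
    moreover have "?R x y < len i" if "x \<in> U k" "y \<in> U k" "i \<in> C k" for x y i
      using d[OF that(1,2)] C(3)[OF that(3)] by simp
    ultimately have "finite (F k) \<and> card (F k) \<le> 3"
      unfolding F_def using C(1) cut_at_antichain unfolding C_def
      by (intro antichain_cells_meeting[of _ L]) blast+
    then show "finite (F k)" "card (F k) \<le> 3" by auto
  qed
  have "\<exists>n. \<forall>j\<in>words letters n. \<exists>i\<in>(\<Union>k. F k). prefix i j"
  proof (rule finite_depth)
    fix x assume x: "x \<in> fractal c"
    then obtain k where k: "x \<in> U k" using U(3) by blast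
    obtain L where L: "\<And>j. j \<in> words letters L \<Longrightarrow> \<exists>i\<in>C k. prefix i j"
      using cut_at_cover[OF r\<epsilon>(1,3)] unfolding C_def by blast
    have "\<exists>i\<in>(\<Union>k. F k). prefix i j" if j: "j \<in> words letters L" "x \<in> fractal_cell j" for j
    proof -
      obtain i w where i: "i \<in> C k" "j = i @ w" using L[OF j(1)] by (auto simp: prefix_def)
      then have "w \<in> lists letters" using j by (auto simp: words_iff)
      then have "x \<in> fractal_cell i" using fractal_cell_append_subset i j by blast
      then have "i \<in> F k" using i k by (auto simp: F_def)
      then show ?thesis using i by (auto simp: prefix_def)
    qed
    then show "\<exists>L. \<forall>j\<in>words letters L. x \<in> fractal_cell j \<longrightarrow> (\<exists>i\<in>(\<Union>k. F k). prefix i j)" by blast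
  qed
  then obtain n where n: "\<And>j. j \<in> words letters n \<Longrightarrow> \<exists>i\<in>(\<Union>k. F k). prefix i j" by blast
  \<comment> \<open>There are finitely many words of level \<open>n\<close>, so finitely many
    covering sets supply all the prefixes required.\<close>
  have "\<exists>k. \<forall>j\<in>words letters n. \<exists>i\<in>(\<Union>k<k. F k). prefix i j"
  proof -
    have "\<forall>j\<in>words letters n. \<exists>k. \<exists>i\<in>F k. prefix i j" using n by blast
    then obtain g where g: "\<And>j. j \<in> words letters n \<Longrightarrow> \<exists>i\<in>F (g j). prefix i j" by metis
    show ?thesis
    proof (intro exI[of _ "Suc (Max (g ` words letters n))"] ballI)
      fix j assume j: "j \<in> words letters n"
      then have "g j < Suc (Max (g ` words letters n))" by (simp add: less_Suc_eq_le)
      then show "\<exists>i\<in>(\<Union>k<Suc (Max (g ` words letters n)). F k). prefix i j" using g[OF j] by blast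
    qed
  qed
  then obtain m where m: "\<forall>j\<in>words letters n. \<exists>i\<in>(\<Union>k<m. F k). prefix i j" by blast
  have "\<kappa> \<le> (\<Sum>i\<in>(\<Union>k<m. F k). len i powr s)"
  proof (rule cuts)
    show "(\<Union>k<m. F k) \<subseteq> lists letters" "\<forall>i\<in>(\<Union>k<m. F k). N \<le> length i"
      using C(1,4) by (auto simp: F_def)
  qed (use F_card m in auto)
  also have "\<dots> \<le> (\<Sum>k<m. \<Sum>i\<in>F k. len i powr s)"
    using F_card by (intro sum_UN_le) auto
  also have "\<dots> \<le> (\<Sum>k<m. 3 * (r k powr s / \<epsilon> powr s))"
  proof (intro sum_mono)
    fix k
    have "(\<Sum>i\<in>F k. len i powr s) \<le> of_nat (card (F k)) * (r k powr s / \<epsilon> powr s)"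
    proof (rule sum_bounded_above)
      fix i assume "i \<in> F k"
      then have i: "i \<in> C k" by (simp add: F_def)
      have "len i powr s \<le> (r k / \<epsilon>) powr s"
        using C(2)[OF i] cell_length_pos[OF balanced C(1)[OF i]] s by (intro powr_mono2) auto
      then show "len i powr s \<le> r k powr s / \<epsilon> powr s" using \<epsilon> r_pos[of k] by (simp add: powr_divide)
    qed
    also have "\<dots> \<le> 3 * (r k powr s / \<epsilon> powr s)"
      using F_card(2)[of k] \<epsilon> by (intro mult_right_mono) auto
    finally show "(\<Sum>i\<in>F k. len i powr s) \<le> 3 * (r k powr s / \<epsilon> powr s)" .
  qed
  also have "\<dots> = 3 / \<epsilon> powr s * ((\<Sum>k<m. d k powr s) + \<eta> * (\<Sum>k<m. (1 / 2) ^ Suc k))"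
    unfolding r_powr sum.distrib[symmetric] sum_distrib_left by (intro sum.cong) auto
  also have "\<dots> \<le> 3 / \<epsilon> powr s * (\<eta> + \<eta> * 1)"
  proof (intro mult_left_mono add_mono sum_d)
    have "(\<Sum>k<m. (1 / 2) ^ Suc k) = 1 - (1 / 2 :: real) ^ m" by (induction m) (auto simp: field_simps)
    then show "(\<Sum>k<m. (1 / 2) ^ Suc k) \<le> (1 :: real)" by simp
  qed (use \<eta> \<epsilon> in auto)
  finally have "\<kappa> * \<epsilon> powr s \<le> 6 * \<eta>" using \<epsilon> by (simp add: field_simps)
  then show False using \<eta>(3) by simp
qed

end

section \<open>Moments of the cascade\<close>

text \<open>With \<open>h\<close> constant this is a level sum, and with \<open>h\<close> a squared
  level sum of a subtree it is a term of the error below; one computation of expectations serves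
  both.\<close>

definition weighted_sum :: "(nat list \<Rightarrow> real) \<Rightarrow> real \<Rightarrow> (nat list \<Rightarrow> real) \<Rightarrow> nat \<Rightarrow> real" where
  "weighted_sum u \<beta> h m = (\<Sum>i\<in>words letters m. cell_length u i powr \<beta> * h i)"

definition level_sum :: "(nat list \<Rightarrow> real) \<Rightarrow> real \<Rightarrow> nat \<Rightarrow> real" where
  "level_sum u \<beta> n = (\<Sum>i\<in>words letters n. cell_length u i powr \<beta>)"

lemma weighted_sum_0 [simp]: "weighted_sum u \<beta> h 0 = h []"
  by (simp add: weighted_sum_def)

lemma weighted_sum_Suc:
  "weighted_sum u \<beta> h (Suc m) =
    (\<Sum>a\<in>letters. u [a] powr \<beta> * weighted_sum (subcascade u [a]) \<beta> (\<lambda>i. h (a # i)) m)"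
  unfolding weighted_sum_def sum_words_Suc cell_length_Cons powr_mult sum_distrib_left mult.assoc ..

lemma level_sum_eq: "level_sum u \<beta> n = weighted_sum u \<beta> (\<lambda>_. 1) n"
  by (simp add: level_sum_def weighted_sum_def)

lemma level_sum_0 [simp]: "level_sum u \<beta> 0 = 1"
  by (simp add: level_sum_eq)

lemma level_sum_Suc:
  "level_sum u \<beta> (Suc n) = (\<Sum>a\<in>letters. u [a] powr \<beta> * level_sum (subcascade u [a]) \<beta> n)"
  by (simp add: level_sum_eq weighted_sum_Suc)

lemma level_sum_nonneg: "0 \<le> level_sum u \<beta> n"
  by (simp add: level_sum_def sum_nonneg)

text \<open>By \<open>x y \<le> x\<^sup>2 + y\<^sup>2\<close> a level sum of exponent \<open>\<alpha>\<close> is bounded by the sum over a cut of the lengths to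
  a power less than \<open>\<alpha>\<close>, up to this error term with \<open>\<gamma> > \<alpha>\<close>.\<close>

definition overflow :: "real \<Rightarrow> real \<Rightarrow> nat \<Rightarrow> nat \<Rightarrow> (nat list \<Rightarrow> real) \<Rightarrow> real" where
  "overflow \<alpha> \<gamma> k n u =
    (\<Sum>m\<in>{k..n}. weighted_sum u \<gamma> (\<lambda>j. (level_sum (subcascade u j) \<alpha> (n - m))\<^sup>2) m)"

text \<open>The subcascade at \<open>k\<close>, apart from its root value, is determined by the
  triples at these words. Disjoint subtrees will therefore give independent variables.\<close>

definition subtree :: "nat list \<Rightarrow> nat list set" where
  "subtree k = (\<lambda>j. k @ j) ` lists letters"

lemma subtree_self: "k \<in> subtree k"
  unfolding subtree_def by (rule image_eqI[of _ _ "[]"]) auto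

lemma subtree_subset: "k \<in> lists letters \<Longrightarrow> subtree k \<subseteq> lists letters"
  unfolding subtree_def by auto

lemma subtree_child: "a \<in> letters \<Longrightarrow> subtree (k @ [a]) \<subseteq> subtree k"
proof
  fix x assume a: "a \<in> letters" "x \<in> subtree (k @ [a])"
  then obtain j where "j \<in> lists letters" "x = k @ (a # j)" by (auto simp: subtree_def)
  then show "x \<in> subtree k" unfolding subtree_def using a by (intro image_eqI[of _ _ "a # j"]) auto
qed

lemma subtree_disjoint: "length k = length k' \<Longrightarrow> k \<noteq> k' \<Longrightarrow> subtree k \<inter> subtree k' = {}"
  by (auto simp: subtree_def)

lemma subtree_disjoint_self: "{k} \<inter> subtree (k @ [a]) = {}"
  by (auto simp: subtree_def)

section \<open>Independence of subtrees and first moments\<close>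

context random_cascade
begin

definition triple :: "nat list \<Rightarrow> 'a \<Rightarrow> real \<times> real \<times> real" where
  "triple i \<omega> = (w (i @ [1]) \<omega>, w (i @ [2]) \<omega>, w (i @ [3]) \<omega>)"

definition triples :: "nat list set \<Rightarrow> 'a \<Rightarrow> nat list \<Rightarrow> real \<times> real \<times> real" where
  "triples K \<omega> = (\<lambda>i\<in>K. triple i \<omega>)"

text \<open>The sigma-algebra generated by the triples at the words of \<open>K\<close>.
  Measurability with respect to it expresses dependence on these triples only.\<close>

definition history :: "nat list set \<Rightarrow> 'a measure" where
  "history K = vimage_algebra (space M) (triples K) (PiM K (\<lambda>_. borel))"

abbreviation realization :: "'a \<Rightarrow> nat list \<Rightarrow> real" where
  "realization \<omega> \<equiv> \<lambda>i. w i \<omega>"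

abbreviation sub :: "'a \<Rightarrow> nat list \<Rightarrow> nat list \<Rightarrow> real" where
  "sub \<omega> k \<equiv> subcascade (realization \<omega>) k"

lemma triples_indep': "indep_vars (\<lambda>_. borel) triple (lists letters)"
  using triples_indep by (simp add: triple_def[abs_def])

lemma triple_rv [measurable]: "i \<in> lists letters \<Longrightarrow> triple i \<in> borel_measurable M"
  using triples_indep' by (simp add: indep_vars_def)

lemma triples_funcset: "triples K \<in> space M \<rightarrow> space (PiM K (\<lambda>_. borel))"
  by (auto simp: triples_def space_PiM)

lemma triples_measurable: "K \<subseteq> lists letters \<Longrightarrow> triples K \<in> measurable M (PiM K (\<lambda>_. borel))"
  unfolding triples_def[abs_def] by (rule measurable_restrict) (auto intro: triple_rv)

lemma space_history [simp]: "space (history K) = space M"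
  by (simp add: history_def)

lemma sets_history: "sets (history K) = {triples K -` A \<inter> space M | A. A \<in> sets (PiM K (\<lambda>_. borel))}"
  unfolding history_def by (rule sets_vimage_algebra2[OF triples_funcset])

lemma sets_history_subset: "K \<subseteq> lists letters \<Longrightarrow> sets (history K) \<subseteq> sets M"
  unfolding sets_history using measurable_sets[OF triples_measurable] by blast

lemma measurable_history_imp: "f \<in> measurable (history K) N \<Longrightarrow> K \<subseteq> lists letters \<Longrightarrow> f \<in> measurable M N"
  using sets_history_subset[of K] by (auto simp: measurable_def)

lemma triple_history: "i \<in> K \<Longrightarrow> triple i \<in> borel_measurable (history K)"
proof -
  assume i: "i \<in> K"
  have "triples K \<in> measurable (history K) (PiM K (\<lambda>_. borel))"
    unfolding history_def by (rule measurable_vimage_algebra1[OF triples_funcset])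
  then have "(\<lambda>\<omega>. triples K \<omega> i) \<in> borel_measurable (history K)"
    using i by (rule measurable_compose[OF _ measurable_component_singleton])
  then show ?thesis using i by (simp add: triples_def)
qed

lemma measurable_history_mono:
  assumes "f \<in> measurable (history K) N" "K \<subseteq> L"
  shows "f \<in> measurable (history L) N"
proof -
  have "triples K \<in> measurable (history L) (PiM K (\<lambda>_. borel))"
    unfolding triples_def[abs_def] using assms by (intro measurable_restrict triple_history) auto
  then have "(\<lambda>\<omega>. \<omega>) \<in> measurable (history L) (history K)"
    unfolding history_def[of K] by (intro measurable_vimage_algebra2) auto
  then show ?thesis using measurable_compose assms by blast
qed

lemma w_history:
  assumes "i \<in> K" "a \<in> letters"
  shows "w (i @ [a]) \<in> borel_measurable (history K)"
proof -
  note t = triple_history[OF assms(1)]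
  have 1: "(\<lambda>x :: real \<times> real \<times> real. fst x) \<in> borel_measurable borel"
    "(\<lambda>x :: real \<times> real \<times> real. fst (snd x)) \<in> borel_measurable borel"
    "(\<lambda>x :: real \<times> real \<times> real. snd (snd x)) \<in> borel_measurable borel"
    by (intro borel_measurable_continuous_onI continuous_intros)+
  have "(\<lambda>\<omega>. fst (triple i \<omega>)) \<in> borel_measurable (history K)"
    "(\<lambda>\<omega>. fst (snd (triple i \<omega>))) \<in> borel_measurable (history K)"
    "(\<lambda>\<omega>. snd (snd (triple i \<omega>))) \<in> borel_measurable (history K)"
    using measurable_compose[OF t 1(1)] measurable_compose[OF t 1(2)] measurable_compose[OF t 1(3)] by auto
  moreover have "a = 1 \<or> a = 2 \<or> a = 3" using assms by (auto simp: letters_def)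
  ultimately show ?thesis by (auto simp: triple_def)
qed

text \<open>Disjoint subfamilies of independent triples generate independent sigma-algebras, and
  this passes to the smaller ones generated by \<open>f\<close> and \<open>g\<close>.\<close>

lemma indep_history:
  fixes f g :: "'a \<Rightarrow> real"
  assumes KL: "K \<inter> L = {}" "K \<subseteq> lists letters" "L \<subseteq> lists letters"
    and f: "f \<in> borel_measurable (history K)" and g: "g \<in> borel_measurable (history L)"
  shows "indep_var borel f borel g"
proof -
  have ind: "indep_set (sigma_sets (space M) (sets (history K))) (sigma_sets (space M) (sets (history L)))"
    using indep_var_restrict[OF triples_indep' KL]
    unfolding indep_var_eq sets_history triples_def[abs_def] by blast
  have sub: "sigma_sets (space M) {h -` A \<inter> space M | A. A \<in> sets borel} \<subseteq> sigma_sets (space M) (sets (history J))"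
    if "h \<in> borel_measurable (history J)" for h :: "'a \<Rightarrow> real" and J
    using measurable_sets[OF that] by (intro sigma_sets_mono') auto
  have "indep_set (sigma_sets (space M) {f -` A \<inter> space M | A. A \<in> sets borel})
      (sigma_sets (space M) {g -` A \<inter> space M | A. A \<in> sets borel})"
  proof (rule indep_setI)
    show "sigma_sets (space M) {f -` A \<inter> space M | A. A \<in> sets borel} \<subseteq> events"
      using sub[OF f] indep_setD_ev1[OF ind] by blast
    show "sigma_sets (space M) {g -` A \<inter> space M | A. A \<in> sets borel} \<subseteq> events"
      using sub[OF g] indep_setD_ev2[OF ind] by blast
    fix x y assume "x \<in> sigma_sets (space M) {f -` A \<inter> space M | A. A \<in> sets borel}"
      "y \<in> sigma_sets (space M) {g -` A \<inter> space M | A. A \<in> sets borel}"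
    then show "prob (x \<inter> y) = prob x * prob y"
      using sub[OF f] sub[OF g] by (intro indep_setD[OF ind]) auto
  qed
  then show ?thesis
    unfolding indep_var_eq using f g KL(2,3) measurable_history_imp by blast
qed

text \<open>Records the triples on which \<open>f\<close> depends together with a bound. The class
  is closed under sums and products, so integrability and independence follow from the shape of an
  expression.\<close>

definition bounded_rv :: "nat list set \<Rightarrow> ('a \<Rightarrow> real) \<Rightarrow> bool" where
  "bounded_rv K f \<longleftrightarrow> f \<in> borel_measurable (history K) \<and> (\<exists>B. \<forall>\<omega>\<in>space M. \<bar>f \<omega>\<bar> \<le> B)"

lemma bounded_rv_mono: "bounded_rv K f \<Longrightarrow> K \<subseteq> L \<Longrightarrow> bounded_rv L f"
  unfolding bounded_rv_def using measurable_history_mono by blast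

lemma bounded_rv_const [intro]: "bounded_rv K (\<lambda>_. x)"
  by (auto simp: bounded_rv_def)

lemma bounded_rv_add [intro]:
  assumes "bounded_rv K f" "bounded_rv K g"
  shows "bounded_rv K (\<lambda>\<omega>. f \<omega> + g \<omega>)"
proof -
  obtain A B where "\<And>\<omega>. \<omega> \<in> space M \<Longrightarrow> \<bar>f \<omega>\<bar> \<le> A" "\<And>\<omega>. \<omega> \<in> space M \<Longrightarrow> \<bar>g \<omega>\<bar> \<le> B"
    using assms by (auto simp: bounded_rv_def)
  then have "\<forall>\<omega>\<in>space M. \<bar>f \<omega> + g \<omega>\<bar> \<le> A + B" by (smt (verit))
  then show ?thesis using assms unfolding bounded_rv_def by (auto intro: borel_measurable_add)
qed

lemma bounded_rv_mult [intro]: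
  assumes "bounded_rv K f" "bounded_rv K g"
  shows "bounded_rv K (\<lambda>\<omega>. f \<omega> * g \<omega>)"
proof -
  obtain A B where AB: "\<And>\<omega>. \<omega> \<in> space M \<Longrightarrow> \<bar>f \<omega>\<bar> \<le> A" "\<And>\<omega>. \<omega> \<in> space M \<Longrightarrow> \<bar>g \<omega>\<bar> \<le> B"
    using assms by (auto simp: bounded_rv_def)
  have "\<bar>f \<omega> * g \<omega>\<bar> \<le> A * B" if "\<omega> \<in> space M" for \<omega>
    unfolding abs_mult using AB[OF that] by (intro mult_mono) (auto intro: order_trans[OF abs_ge_zero])
  then show ?thesis using assms unfolding bounded_rv_def by (blast intro: borel_measurable_times)
qed

lemma bounded_rv_sum [intro]: "(\<And>i. i \<in> I \<Longrightarrow> bounded_rv K (f i)) \<Longrightarrow> bounded_rv K (\<lambda>\<omega>. \<Sum>i\<in>I. f i \<omega>)"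
  by (induction I rule: infinite_finite_induct) auto

lemma bounded_rv_power [intro]: "bounded_rv K f \<Longrightarrow> bounded_rv K (\<lambda>\<omega>. f \<omega> ^ n)"
  by (induction n) auto

lemma bounded_rv_integrable: "bounded_rv K f \<Longrightarrow> K \<subseteq> lists letters \<Longrightarrow> integrable M f"
  unfolding bounded_rv_def using measurable_history_imp
  by (elim conjE exE, intro integrable_const_bound) (auto intro!: AE_I2)

lemma bounded_rv_w:
  assumes "i \<in> K" "i \<in> lists letters" "a \<in> letters" "0 \<le> \<beta>"
  shows "bounded_rv K (\<lambda>\<omega>. w (i @ [a]) \<omega> powr \<beta>)"
proof -
  have "i @ [a] \<in> lists letters - {[]}" using assms by auto
  then have "w (i @ [a]) \<omega> \<in> {0..1}" if "\<omega> \<in> space M" for \<omega> using w_range that by blast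
  then have "\<forall>\<omega>\<in>space M. \<bar>w (i @ [a]) \<omega> powr \<beta>\<bar> \<le> 1"
    using assms(4) by (auto intro: powr_le1)
  moreover have "(\<lambda>\<omega>. w (i @ [a]) \<omega> powr \<beta>) \<in> borel_measurable (history K)"
    using w_history[OF assms(1,3)] by measurable
  ultimately show ?thesis unfolding bounded_rv_def by blast
qed

lemma bounded_rv_weighted_sum:
  assumes "\<And>j. j \<in> lists letters \<Longrightarrow> bounded_rv (subtree (k @ j)) (h (k @ j))" "k \<in> lists letters" "0 \<le> \<beta>"
  shows "bounded_rv (subtree k) (\<lambda>\<omega>. weighted_sum (sub \<omega> k) \<beta> (\<lambda>j. h (k @ j) \<omega>) m)"
  using assms
proof (induction m arbitrary: k)
  case 0
  then show ?case using 0(1)[of "[]"] by simp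
next
  case (Suc m)
  have "bounded_rv (subtree k) (\<lambda>\<omega>. weighted_sum (sub \<omega> (k @ [a])) \<beta> (\<lambda>j. h (k @ a # j) \<omega>) m)"
    if a: "a \<in> letters" for a
  proof (rule bounded_rv_mono[OF _ subtree_child[OF a]])
    have "bounded_rv (subtree ((k @ [a]) @ j)) (h ((k @ [a]) @ j))" if "j \<in> lists letters" for j
      using Suc.prems(1)[of "a # j"] that a by simp
    then show "bounded_rv (subtree (k @ [a])) (\<lambda>\<omega>. weighted_sum (sub \<omega> (k @ [a])) \<beta> (\<lambda>j. h (k @ a # j) \<omega>) m)"
      using Suc.IH[of "k @ [a]"] Suc.prems a by simp
  qed
  then show ?case
    unfolding weighted_sum_Suc subcascade_append subcascade_apply
    using Suc.prems by (intro bounded_rv_sum bounded_rv_mult bounded_rv_w subtree_self) auto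
qed

lemma expectation_indep:
  assumes "bounded_rv K f" "bounded_rv L g" "K \<inter> L = {}" "K \<subseteq> lists letters" "L \<subseteq> lists letters"
  shows "expectation (\<lambda>\<omega>. f \<omega> * g \<omega>) = expectation f * expectation g"
proof -
  have "indep_var borel f borel g"
    using assms(1,2) by (intro indep_history[OF assms(3-5)]) (auto simp: bounded_rv_def)
  then show ?thesis
    using bounded_rv_integrable assms by (intro indep_var_lebesgue_integral) auto
qed

lemma expectation_triple:
  assumes "i \<in> lists letters" "h \<in> borel_measurable borel"
  shows "expectation (\<lambda>\<omega>. h (triple i \<omega>)) = (expectation (\<lambda>\<omega>. h (triple [] \<omega>)) :: real)"
proof -
  have d: "distr M borel (triple i) = distr M borel (triple [])"
    using triples_distr[OF assms(1)] by (simp add: triple_def[abs_def])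
  show ?thesis
    using integral_distr[OF triple_rv[OF assms(1)] assms(2)] integral_distr[OF triple_rv[of "[]"] assms(2)] d
    by simp
qed

definition coord :: "nat \<Rightarrow> real \<times> real \<times> real \<Rightarrow> real" where
  "coord a = (\<lambda>(x, y, z). if a = 1 then x else if a = 2 then y else z)"

lemma coord_triple: "a \<in> letters \<Longrightarrow> coord a (triple i \<omega>) = w (i @ [a]) \<omega>"
  by (auto simp: coord_def triple_def letters_def)

lemma coord_measurable [measurable]: "coord a \<in> borel_measurable borel"
proof -
  have "coord a = (if a = 1 then fst else if a = 2 then (\<lambda>p. fst (snd p)) else (\<lambda>p. snd (snd p)))"
    by (auto simp: coord_def)
  moreover have "continuous_on UNIV (\<lambda>p :: real \<times> real \<times> real. fst p)"
    "continuous_on UNIV (\<lambda>p :: real \<times> real \<times> real. fst (snd p))"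
    "continuous_on UNIV (\<lambda>p :: real \<times> real \<times> real. snd (snd p))"
    by (intro continuous_intros)+
  ultimately show ?thesis by (auto intro: borel_measurable_continuous_onI)
qed

lemma expectation_w:
  assumes "i \<in> lists letters" "a \<in> letters"
  shows "expectation (\<lambda>\<omega>. w (i @ [a]) \<omega> powr \<beta>) = expectation (\<lambda>\<omega>. w [a] \<omega> powr \<beta>)"
  using expectation_triple[OF assms(1), of "\<lambda>t. coord a t powr \<beta>"] assms(2)
  by (simp add: coord_triple)

lemma expectation_w_w:
  assumes "i \<in> lists letters" "a \<in> letters" "b \<in> letters"
  shows "expectation (\<lambda>\<omega>. w (i @ [a]) \<omega> powr \<beta> * w (i @ [b]) \<omega> powr \<beta>) =
    expectation (\<lambda>\<omega>. w [a] \<omega> powr \<beta> * w [b] \<omega> powr \<beta>)"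
  using expectation_triple[OF assms(1), of "\<lambda>t. coord a t powr \<beta> * coord b t powr \<beta>"] assms(2,3)
  by (simp add: coord_triple)

definition moment :: "real \<Rightarrow> real" where
  "moment \<beta> = expectation (\<lambda>\<omega>. \<Sum>a\<in>letters. w [a] \<omega> powr \<beta>)"

lemma integrable_w: "a \<in> letters \<Longrightarrow> 0 \<le> \<beta> \<Longrightarrow> integrable M (\<lambda>\<omega>. w [a] \<omega> powr \<beta>)"
  using bounded_rv_integrable[OF bounded_rv_w[of "[]" "{[]}" a \<beta>]] by simp

lemma moment_eq: "0 \<le> \<beta> \<Longrightarrow> moment \<beta> = (\<Sum>a\<in>letters. expectation (\<lambda>\<omega>. w [a] \<omega> powr \<beta>))"
  unfolding moment_def by (intro Bochner_Integration.integral_sum integrable_w)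

text \<open>The triple at \<open>k\<close> is independent of the subtrees of its children, so each
  level contributes one factor \<open>moment \<beta>\<close>. Nothing is asked about dependence
  within a triple, since the expression is linear in its weights to the power \<beta>.\<close>

lemma expectation_weighted_sum:
  assumes "\<And>j. j \<in> lists letters \<Longrightarrow> bounded_rv (subtree (k @ j)) (h (k @ j))"
    "\<And>j. j \<in> lists letters \<Longrightarrow> expectation (h (k @ j)) = x" "k \<in> lists letters" "0 \<le> \<beta>"
  shows "expectation (\<lambda>\<omega>. weighted_sum (sub \<omega> k) \<beta> (\<lambda>j. h (k @ j) \<omega>) m) = moment \<beta> ^ m * x"
  using assms
proof (induction m arbitrary: k)
  case 0
  then show ?case using 0(2)[of "[]"] by simp
next
  case (Suc m)
  let ?W = "\<lambda>a \<omega>. weighted_sum (sub \<omega> (k @ [a])) \<beta> (\<lambda>j. h (k @ a # j) \<omega>) m"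
  have prems: "bounded_rv (subtree ((k @ [a]) @ j)) (h ((k @ [a]) @ j))" "expectation (h ((k @ [a]) @ j)) = x"
    if "a \<in> letters" "j \<in> lists letters" for a j
    using Suc.prems(1,2)[of "a # j"] that by simp_all
  have W: "bounded_rv (subtree (k @ [a])) (?W a)" "expectation (?W a) = moment \<beta> ^ m * x" if a: "a \<in> letters" for a
    using bounded_rv_weighted_sum[of "k @ [a]" h \<beta> m] Suc.IH[of "k @ [a]"] prems a Suc.prems(3,4) by simp_all
  have sub: "{k} \<subseteq> lists letters" "subtree (k @ [a]) \<subseteq> lists letters" if "a \<in> letters" for a
    using Suc.prems(3) that by (auto intro!: subtree_subset)
  have w: "bounded_rv {k} (\<lambda>\<omega>. w (k @ [a]) \<omega> powr \<beta>)" if "a \<in> letters" for a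
    using that Suc.prems by (intro bounded_rv_w) auto
  have "expectation (\<lambda>\<omega>. weighted_sum (sub \<omega> k) \<beta> (\<lambda>j. h (k @ j) \<omega>) (Suc m)) =
    expectation (\<lambda>\<omega>. \<Sum>a\<in>letters. w (k @ [a]) \<omega> powr \<beta> * ?W a \<omega>)"
    unfolding weighted_sum_Suc subcascade_append subcascade_apply ..
  also have "\<dots> = (\<Sum>a\<in>letters. expectation (\<lambda>\<omega>. w (k @ [a]) \<omega> powr \<beta> * ?W a \<omega>))"
  proof (rule Bochner_Integration.integral_sum)
    fix a assume a: "a \<in> letters"
    have "bounded_rv ({k} \<union> subtree (k @ [a])) (\<lambda>\<omega>. w (k @ [a]) \<omega> powr \<beta> * ?W a \<omega>)"
      by (intro bounded_rv_mult bounded_rv_mono[OF w[OF a]] bounded_rv_mono[OF W(1)[OF a]]) auto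
    then show "integrable M (\<lambda>\<omega>. w (k @ [a]) \<omega> powr \<beta> * ?W a \<omega>)"
      by (rule bounded_rv_integrable) (use sub[OF a] in auto)
  qed
  also have "\<dots> = (\<Sum>a\<in>letters. expectation (\<lambda>\<omega>. w [a] \<omega> powr \<beta>) * (moment \<beta> ^ m * x))"
  proof (rule sum.cong[OF refl])
    fix a assume a: "a \<in> letters"
    show "expectation (\<lambda>\<omega>. w (k @ [a]) \<omega> powr \<beta> * ?W a \<omega>) = expectation (\<lambda>\<omega>. w [a] \<omega> powr \<beta>) * (moment \<beta> ^ m * x)"
      unfolding expectation_indep[OF w[OF a] W(1)[OF a] subtree_disjoint_self sub[OF a]]
      using W(2)[OF a] expectation_w[OF Suc.prems(3) a] by simp
  qed
  also have "\<dots> = moment \<beta> ^ Suc m * x"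
    unfolding sum_distrib_right[symmetric] moment_eq[OF Suc.prems(4), symmetric] by simp
  finally show ?case .
qed

lemma bounded_rv_level_sum: "k \<in> lists letters \<Longrightarrow> 0 \<le> \<beta> \<Longrightarrow> bounded_rv (subtree k) (\<lambda>\<omega>. level_sum (sub \<omega> k) \<beta> n)"
  unfolding level_sum_eq by (intro bounded_rv_weighted_sum[where h = "\<lambda>_ _. 1"]) auto

lemma expectation_level_sum:
  "k \<in> lists letters \<Longrightarrow> 0 \<le> \<beta> \<Longrightarrow> expectation (\<lambda>\<omega>. level_sum (sub \<omega> k) \<beta> n) = moment \<beta> ^ n"
  unfolding level_sum_eq
  using expectation_weighted_sum[where h = "\<lambda>_ _. 1" and x = 1 and k = k and \<beta> = \<beta> and m = n]
  by (simp add: prob_space bounded_rv_const)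

end

section \<open>Second moments and deviations of the level sums\<close>

text \<open>For fixed \<open>k\<close> the events that \<open>Z k n\<close> stays at least 1 from
  \<open>m\<close> on increase with \<open>m\<close>. Markov's inequality bounds each by
  \<open>e k\<close>, hence also their union, and the intersection of these unions over
  \<open>k\<close> is null.\<close>

lemma (in prob_space) AE_infinitely_often_small:
  fixes Z :: "nat \<Rightarrow> nat \<Rightarrow> 'a \<Rightarrow> real"
  assumes int: "\<And>k n. k \<le> n \<Longrightarrow> integrable M (Z k n)" and nonneg: "\<And>k n \<omega>. \<omega> \<in> space M \<Longrightarrow> 0 \<le> Z k n \<omega>"
    and le: "\<And>k n. k \<le> n \<Longrightarrow> expectation (Z k n) \<le> e k" and e: "e \<longlonglongrightarrow> 0"
  shows "AE \<omega> in M. \<exists>k. \<forall>m. \<exists>n\<ge>m. Z k n \<omega> < 1"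
proof -
  define B where "B k m = {\<omega> \<in> space M. \<forall>n\<ge>max k m. 1 \<le> Z k n \<omega>}" for k m
  have [measurable]: "Z k n \<in> borel_measurable M" if "k \<le> n" for k n using int[OF that] by auto
  have B_sets: "B k m \<in> sets M" for k m
  proof -
    have "{\<omega> \<in> space M. 1 \<le> Z k n \<omega>} \<in> sets M" if "k \<le> n" for n using that by measurable
    moreover have "B k m = (\<Inter>n\<in>{max k m..}. {\<omega> \<in> space M. 1 \<le> Z k n \<omega>})" by (auto simp: B_def)
    ultimately show ?thesis by (auto intro!: sets.countable_INT'')
  qed
  have B_le: "prob (B k m) \<le> e k" for k m
  proof -
    have [measurable]: "Z k (max k m) \<in> borel_measurable M" by simp
    have "prob (B k m) \<le> prob {\<omega> \<in> space M. 1 \<le> Z k (max k m) \<omega>}"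
      by (intro finite_measure_mono) (auto simp: B_def)
    also have "\<dots> \<le> expectation (Z k (max k m)) / 1"
      using nonneg by (intro integral_Markov_inequality_measure[where A = "{}"] int) auto
    also have "\<dots> \<le> e k" using le[of k "max k m"] by simp
    finally show ?thesis .
  qed
  have "incseq (B k)" for k
    by (rule incseq_SucI) (auto simp: B_def)
  then have "(\<lambda>m. prob (B k m)) \<longlonglongrightarrow> prob (\<Union>m. B k m)" for k
    using B_sets by (intro finite_Lim_measure_incseq) auto
  then have U_le: "prob (\<Union>m. B k m) \<le> e k" for k
    by (rule LIMSEQ_le_const2) (use B_le in auto)
  have "prob (\<Inter>k. \<Union>m. B k m) \<le> e k" for k
  proof -
    have "prob (\<Inter>k. \<Union>m. B k m) \<le> prob (\<Union>m. B k m)"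
      using B_sets by (intro finite_measure_mono INT_lower) auto
    then show ?thesis using U_le[of k] by simp
  qed
  then have "prob (\<Inter>k. \<Union>m. B k m) \<le> 0"
    by (intro LIMSEQ_le_const[OF e]) blast
  then have "prob (\<Inter>k. \<Union>m. B k m) = 0" using measure_nonneg by (intro antisym)
  then have "(\<Inter>k. \<Union>m. B k m) \<in> null_sets M"
    using B_sets by (intro null_setsI) (auto simp: emeasure_eq_measure)
  then show ?thesis
  proof (rule AE_I')
    show "{\<omega> \<in> space M. \<not> (\<exists>k. \<forall>m. \<exists>n\<ge>m. Z k n \<omega> < 1)} \<subseteq> (\<Inter>k. \<Union>m. B k m)"
      by (force simp: B_def not_less)
  qed
qed

context random_cascade
begin

definition cross_moment :: "real \<Rightarrow> real" where
  "cross_moment \<beta> = (\<Sum>a\<in>letters. \<Sum>b\<in>letters - {a}. expectation (\<lambda>\<omega>. w [a] \<omega> powr \<beta> * w [b] \<omega> powr \<beta>))"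

fun second_moment :: "real \<Rightarrow> nat \<Rightarrow> real" where
  "second_moment \<beta> 0 = 1"
| "second_moment \<beta> (Suc n) = moment (2 * \<beta>) * second_moment \<beta> n + cross_moment \<beta>"

text \<open>Square the recursion over the first letter. Diagonal terms give the moment of exponent 2
  \<beta> times the previous second moment. Off the diagonal two independent level sums of mean 1
  drop out and a joint expectation within the triple remains, whence
  \<open>cross_moment\<close>.\<close>

lemma expectation_level_sum_square:
  assumes \<beta>: "0 \<le> \<beta>" "moment \<beta> = 1" and k: "k \<in> lists letters"
  shows "expectation (\<lambda>\<omega>. (level_sum (sub \<omega> k) \<beta> n)\<^sup>2) = second_moment \<beta> n"
  using k
proof (induction n arbitrary: k)
  case 0
  show ?case by (simp add: prob_space)
next
  case (Suc n)
  define Y where "Y a \<omega> = level_sum (sub \<omega> (k @ [a])) \<beta> n" for a \<omega>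
  define x where "x a \<omega> = w (k @ [a]) \<omega> powr \<beta>" for a \<omega>
  have ka: "k @ [a] \<in> lists letters" if "a \<in> letters" for a using that Suc.prems by auto
  have Y: "bounded_rv (subtree (k @ [a])) (Y a)" if "a \<in> letters" for a
    unfolding Y_def using bounded_rv_level_sum[OF ka[OF that] \<beta>(1)] .
  have x: "bounded_rv {k} (x a)" if "a \<in> letters" for a
    unfolding x_def using that Suc.prems \<beta> by (intro bounded_rv_w) auto
  have K: "{k} \<subseteq> lists letters" using Suc.prems by auto
  have T: "subtree (k @ [a]) \<subseteq> lists letters" if "a \<in> letters" for a by (rule subtree_subset[OF ka[OF that]])
  have int: "integrable M (\<lambda>\<omega>. (x a \<omega> * Y a \<omega>) * (x b \<omega> * Y b \<omega>))" if "a \<in> letters" "b \<in> letters" for a b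
  proof (rule bounded_rv_integrable)
    show "bounded_rv (lists letters) (\<lambda>\<omega>. (x a \<omega> * Y a \<omega>) * (x b \<omega> * Y b \<omega>))"
      by (intro bounded_rv_mult bounded_rv_mono[OF x K] bounded_rv_mono[OF Y T] that)
  qed simp
  have E: "expectation (\<lambda>\<omega>. (x a \<omega> * Y a \<omega>) * (x b \<omega> * Y b \<omega>)) =
      (if a = b then expectation (\<lambda>\<omega>. w [a] \<omega> powr (2 * \<beta>)) * second_moment \<beta> n
       else expectation (\<lambda>\<omega>. w [a] \<omega> powr \<beta> * w [b] \<omega> powr \<beta>))"
    if ab: "a \<in> letters" "b \<in> letters" for a b
  proof (cases "a = b")
    case True
    have "expectation (\<lambda>\<omega>. (x a \<omega> * Y a \<omega>) * (x a \<omega> * Y a \<omega>)) =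
        expectation (\<lambda>\<omega>. w (k @ [a]) \<omega> powr (2 * \<beta>) * (Y a \<omega>)\<^sup>2)"
      by (simp add: x_def power2_eq_square powr_add[symmetric] algebra_simps mult_2[symmetric])
    also have "\<dots> = expectation (\<lambda>\<omega>. w (k @ [a]) \<omega> powr (2 * \<beta>)) * expectation (\<lambda>\<omega>. (Y a \<omega>)\<^sup>2)"
      using Suc.prems ab(1) \<beta>(1)
      by (intro expectation_indep[OF bounded_rv_w bounded_rv_power[OF Y] subtree_disjoint_self K T]) auto
    also have "\<dots> = expectation (\<lambda>\<omega>. w [a] \<omega> powr (2 * \<beta>)) * second_moment \<beta> n"
      unfolding Y_def Suc.IH[OF ka[OF ab(1)]] expectation_w[OF Suc.prems ab(1)] ..
    finally show ?thesis using True by simp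
  next
    case False
    have disj: "subtree (k @ [a]) \<inter> subtree (k @ [b]) = {}" using False by (intro subtree_disjoint) auto
    have "expectation (\<lambda>\<omega>. (x a \<omega> * Y a \<omega>) * (x b \<omega> * Y b \<omega>)) =
        expectation (\<lambda>\<omega>. (x a \<omega> * x b \<omega>) * (Y a \<omega> * Y b \<omega>))"
      by (simp add: algebra_simps)
    also have "\<dots> = expectation (\<lambda>\<omega>. x a \<omega> * x b \<omega>) * expectation (\<lambda>\<omega>. Y a \<omega> * Y b \<omega>)"
    proof (rule expectation_indep)
      show "bounded_rv {k} (\<lambda>\<omega>. x a \<omega> * x b \<omega>)" using x ab by auto
      show "bounded_rv (subtree (k @ [a]) \<union> subtree (k @ [b])) (\<lambda>\<omega>. Y a \<omega> * Y b \<omega>)"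
        using ab by (intro bounded_rv_mult bounded_rv_mono[OF Y]) auto
      show "{k} \<inter> (subtree (k @ [a]) \<union> subtree (k @ [b])) = {}"
        using subtree_disjoint_self by (simp add: Int_Un_distrib)
    qed (use K T ab in auto)
    also have "expectation (\<lambda>\<omega>. Y a \<omega> * Y b \<omega>) = expectation (Y a) * expectation (Y b)"
      using ab by (intro expectation_indep[OF Y Y disj T T])
    also have "expectation (Y a) * expectation (Y b) = 1"
      unfolding Y_def expectation_level_sum[OF ka[OF ab(1)] \<beta>(1)] expectation_level_sum[OF ka[OF ab(2)] \<beta>(1)]
      using \<beta>(2) by simp
    finally show ?thesis
      using False by (simp add: x_def expectation_w_w[OF Suc.prems ab])
  qed
  have "expectation (\<lambda>\<omega>. (level_sum (sub \<omega> k) \<beta> (Suc n))\<^sup>2) =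
      expectation (\<lambda>\<omega>. \<Sum>a\<in>letters. \<Sum>b\<in>letters. (x a \<omega> * Y a \<omega>) * (x b \<omega> * Y b \<omega>))"
    unfolding level_sum_Suc power2_eq_square sum_product subcascade_append subcascade_apply x_def Y_def ..
  also have "\<dots> = (\<Sum>a\<in>letters. \<Sum>b\<in>letters. expectation (\<lambda>\<omega>. (x a \<omega> * Y a \<omega>) * (x b \<omega> * Y b \<omega>)))"
    using int by (subst Bochner_Integration.integral_sum) (auto intro!: sum.cong Bochner_Integration.integral_sum)
  also have "\<dots> = (\<Sum>a\<in>letters. \<Sum>b\<in>letters.
      (if a = b then expectation (\<lambda>\<omega>. w [a] \<omega> powr (2 * \<beta>)) * second_moment \<beta> n
       else expectation (\<lambda>\<omega>. w [a] \<omega> powr \<beta> * w [b] \<omega> powr \<beta>)))"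
    using E by (intro sum.cong) auto
  also have "\<dots> = (\<Sum>a\<in>letters. expectation (\<lambda>\<omega>. w [a] \<omega> powr (2 * \<beta>)) * second_moment \<beta> n +
      (\<Sum>b\<in>letters - {a}. expectation (\<lambda>\<omega>. w [a] \<omega> powr \<beta> * w [b] \<omega> powr \<beta>)))"
  proof (rule sum.cong[OF refl])
    fix a assume "a \<in> letters"
    then show "(\<Sum>b\<in>letters. (if a = b then expectation (\<lambda>\<omega>. w [a] \<omega> powr (2 * \<beta>)) * second_moment \<beta> n
        else expectation (\<lambda>\<omega>. w [a] \<omega> powr \<beta> * w [b] \<omega> powr \<beta>))) =
      expectation (\<lambda>\<omega>. w [a] \<omega> powr (2 * \<beta>)) * second_moment \<beta> n +
      (\<Sum>b\<in>letters - {a}. expectation (\<lambda>\<omega>. w [a] \<omega> powr \<beta> * w [b] \<omega> powr \<beta>))"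
      by (subst sum.remove[of letters a]) (auto intro!: sum.cong)
  qed
  also have "\<dots> = second_moment \<beta> (Suc n)"
    using \<beta>(1) by (simp add: sum.distrib cross_moment_def moment_eq sum_distrib_right)
  finally show ?case .
qed

lemma w_bounds: "a \<in> letters \<Longrightarrow> \<omega> \<in> space M \<Longrightarrow> 0 \<le> w [a] \<omega> \<and> w [a] \<omega> \<le> 1"
  using w_range[of "[a]" \<omega>] by auto

lemma moment_nonneg: "0 \<le> moment \<beta>"
  unfolding moment_def by (intro integral_nonneg_AE AE_I2 sum_nonneg) auto

lemma cross_moment_le:
  assumes "0 \<le> \<beta>"
  shows "cross_moment \<beta> \<le> 9"
proof -
  have "expectation (\<lambda>\<omega>. w [a] \<omega> powr \<beta> * w [b] \<omega> powr \<beta>) \<le> 1" if "a \<in> letters" "b \<in> letters" for a b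
  proof (rule integral_le_const)
    show "integrable M (\<lambda>\<omega>. w [a] \<omega> powr \<beta> * w [b] \<omega> powr \<beta>)"
      using that assms bounded_rv_w[of "[]" "lists letters" _ \<beta>]
      by (intro bounded_rv_integrable[OF bounded_rv_mult]) auto
    show "AE \<omega> in M. w [a] \<omega> powr \<beta> * w [b] \<omega> powr \<beta> \<le> 1"
      using w_bounds that assms by (intro AE_I2 mult_le_one powr_le1) auto
  qed
  then have "cross_moment \<beta> \<le> (\<Sum>a\<in>letters. \<Sum>b\<in>letters - {a}. 1)"
    unfolding cross_moment_def by (intro sum_mono) auto
  also have "\<dots> \<le> (\<Sum>a\<in>letters. 3)"
    by (intro sum_mono) (auto simp: letters_def)
  finally show ?thesis by simp
qed

text \<open>With g the moment of exponent 2 \<beta>, the bound is stable under the recursion: g (1 +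
  9 / (1 - g)) + 9 = g + 9 / (1 - g).\<close>

lemma second_moment_le:
  assumes "0 \<le> \<beta>" "moment (2 * \<beta>) < 1"
  shows "second_moment \<beta> n \<le> 1 + 9 / (1 - moment (2 * \<beta>))"
proof (induction n)
  case 0
  show ?case using assms by simp
next
  case (Suc n)
  let ?g = "moment (2 * \<beta>)"
  have "second_moment \<beta> (Suc n) \<le> ?g * (1 + 9 / (1 - ?g)) + 9"
    using Suc moment_nonneg[of "2 * \<beta>"] cross_moment_le[OF assms(1)]
    by (simp only: second_moment.simps) (intro add_mono mult_left_mono; simp)
  also have "\<dots> = ?g + 9 / (1 - ?g)" using assms(2) by (simp add: field_simps)
  also have "\<dots> \<le> 1 + 9 / (1 - ?g)" using assms(2) by simp
  finally show ?case .
qed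

definition fluctuation :: "real \<Rightarrow> nat \<Rightarrow> nat \<Rightarrow> 'a \<Rightarrow> real" where
  "fluctuation \<alpha> k n \<omega> = (\<Sum>i\<in>words letters k. level_sum (sub \<omega> i) \<alpha> n - 1)"

text \<open>Level sums of different subtrees are independent and become centred after subtracting 1,
  so only the 3^k diagonal terms survive. Averaged over the 3^k subtrees the variance is of order
  3^(-k), uniformly in \<open>n\<close>.\<close>

lemma expectation_fluctuation:
  assumes \<alpha>: "0 \<le> \<alpha>" "moment \<alpha> = 1" "moment (2 * \<alpha>) < 1"
  shows "expectation (\<lambda>\<omega>. (fluctuation \<alpha> k n \<omega>)\<^sup>2) \<le> 3 ^ k * (9 / (1 - moment (2 * \<alpha>)))"
proof -
  define Y where "Y i \<omega> = level_sum (sub \<omega> i) \<alpha> n - 1" for i \<omega>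
  have l: "i \<in> lists letters" "length i = k" if "i \<in> words letters k" for i using that by (auto simp: words_iff)
  have T: "subtree i \<subseteq> lists letters" if "i \<in> words letters k" for i using l[OF that] subtree_subset by blast
  have Y: "bounded_rv (subtree i) (Y i)" if "i \<in> words letters k" for i
    using bounded_rv_add[OF bounded_rv_level_sum[OF l(1)[OF that] \<alpha>(1)] bounded_rv_const[of _ "-1"]]
    by (simp add: Y_def[abs_def])
  have int: "integrable M (\<lambda>\<omega>. Y i \<omega> * Y j \<omega>)" if "i \<in> words letters k" "j \<in> words letters k" for i j
    by (intro bounded_rv_integrable[of "lists letters"] bounded_rv_mult bounded_rv_mono[OF Y T] that order_refl)
  have S: "integrable M (\<lambda>\<omega>. level_sum (sub \<omega> i) \<alpha> n)" "integrable M (\<lambda>\<omega>. (level_sum (sub \<omega> i) \<alpha> n)\<^sup>2)"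
    if "i \<in> words letters k" for i
  proof -
    note r = bounded_rv_level_sum[OF l(1)[OF that] \<alpha>(1)]
    show "integrable M (\<lambda>\<omega>. level_sum (sub \<omega> i) \<alpha> n)"
      by (rule bounded_rv_integrable[OF r T[OF that]])
    show "integrable M (\<lambda>\<omega>. (level_sum (sub \<omega> i) \<alpha> n)\<^sup>2)"
      by (rule bounded_rv_integrable[OF bounded_rv_power[OF r] T[OF that]])
  qed
  have E: "expectation (\<lambda>\<omega>. Y i \<omega> * Y j \<omega>) \<le> (if i = j then 9 / (1 - moment (2 * \<alpha>)) else 0)"
    if ij: "i \<in> words letters k" "j \<in> words letters k" for i j
  proof (cases "i = j")
    case True
    have "expectation (\<lambda>\<omega>. Y i \<omega> * Y i \<omega>) =
      expectation (\<lambda>\<omega>. (level_sum (sub \<omega> i) \<alpha> n)\<^sup>2 - 2 * level_sum (sub \<omega> i) \<alpha> n + 1)"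
      by (simp add: Y_def power2_eq_square algebra_simps)
    also have "\<dots> = second_moment \<alpha> n - 2 * 1 + 1"
      using S[OF ij(1)] expectation_level_sum[OF l(1)[OF ij(1)] \<alpha>(1), of n] \<alpha>(2)
        expectation_level_sum_square[OF \<alpha>(1,2) l(1)[OF ij(1)], of n]
      by (simp add: prob_space)
    finally show ?thesis using True second_moment_le[OF \<alpha>(1,3), of n] by simp
  next
    case False
    have "expectation (\<lambda>\<omega>. Y i \<omega> * Y j \<omega>) = expectation (Y i) * expectation (Y j)"
      using ij False l by (intro expectation_indep[OF Y Y subtree_disjoint T T]) auto
    moreover have "expectation (Y i) = 0"
      unfolding Y_def using S[OF ij(1)] expectation_level_sum[OF l(1)[OF ij(1)] \<alpha>(1), of n] \<alpha>(2)
      by (simp add: prob_space)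
    ultimately show ?thesis using False by simp
  qed
  have "expectation (\<lambda>\<omega>. (fluctuation \<alpha> k n \<omega>)\<^sup>2) =
      (\<Sum>i\<in>words letters k. \<Sum>j\<in>words letters k. expectation (\<lambda>\<omega>. Y i \<omega> * Y j \<omega>))"
    unfolding fluctuation_def Y_def[symmetric] power2_eq_square sum_product
    using int by (subst Bochner_Integration.integral_sum) (auto intro!: sum.cong Bochner_Integration.integral_sum)
  also have "\<dots> \<le> (\<Sum>i\<in>words letters k. \<Sum>j\<in>words letters k. (if i = j then 9 / (1 - moment (2 * \<alpha>)) else 0))"
    using E by (intro sum_mono) auto
  also have "\<dots> = 3 ^ k * (9 / (1 - moment (2 * \<alpha>)))"
    by (simp add: card_words)
  finally show ?thesis .
qed

lemma bounded_rv_overflow: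
  assumes "0 \<le> \<alpha>" "0 \<le> \<gamma>" "i \<in> lists letters"
  shows "bounded_rv (subtree i) (\<lambda>\<omega>. overflow \<alpha> \<gamma> k n (sub \<omega> i))"
  unfolding overflow_def subcascade_append using assms
  by (intro bounded_rv_sum bounded_rv_weighted_sum[where h = "\<lambda>j \<omega>. (level_sum (sub \<omega> j) \<alpha> (n - _))\<^sup>2"]
      bounded_rv_power bounded_rv_level_sum) auto

text \<open>The inner squares have uniformly bounded expectation, so the sum over the levels is
  dominated by a geometric tail starting at \<open>k\<close>.\<close>

lemma expectation_overflow:
  assumes \<alpha>: "0 \<le> \<alpha>" "moment \<alpha> = 1" "moment (2 * \<alpha>) < 1" and \<gamma>: "0 \<le> \<gamma>" "moment \<gamma> < 1"
    and i: "i \<in> lists letters"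
  shows "expectation (\<lambda>\<omega>. overflow \<alpha> \<gamma> k n (sub \<omega> i)) \<le>
    moment \<gamma> ^ k / (1 - moment \<gamma>) * (1 + 9 / (1 - moment (2 * \<alpha>)))"
proof -
  let ?C = "1 + 9 / (1 - moment (2 * \<alpha>))"
  have C: "0 \<le> ?C" using \<alpha>(3) by simp
  let ?h = "\<lambda>m j \<omega>. (level_sum (sub \<omega> j) \<alpha> (n - m))\<^sup>2"
  have h: "bounded_rv (subtree (i @ j)) (?h m (i @ j))" if "j \<in> lists letters" for m j
    using that i \<alpha> by (intro bounded_rv_power bounded_rv_level_sum) auto
  have Eh: "expectation (?h m (i @ j)) = second_moment \<alpha> (n - m)" if "j \<in> lists letters" for m j
    using that i by (intro expectation_level_sum_square \<alpha>) auto
  have "expectation (\<lambda>\<omega>. overflow \<alpha> \<gamma> k n (sub \<omega> i)) =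
      (\<Sum>m\<in>{k..n}. expectation (\<lambda>\<omega>. weighted_sum (sub \<omega> i) \<gamma> (\<lambda>j. ?h m (i @ j) \<omega>) m))"
    unfolding overflow_def subcascade_append
    using bounded_rv_weighted_sum[of i, OF h i \<gamma>(1)] subtree_subset[OF i]
    by (intro Bochner_Integration.integral_sum bounded_rv_integrable[of "subtree i"]) auto
  also have "\<dots> = (\<Sum>m\<in>{k..n}. moment \<gamma> ^ m * second_moment \<alpha> (n - m))"
    using expectation_weighted_sum[of i, OF h Eh i \<gamma>(1)] by simp
  also have "\<dots> \<le> (\<Sum>m\<in>{k..n}. moment \<gamma> ^ m * ?C)"
    using moment_nonneg second_moment_le[OF \<alpha>(1,3)] by (intro sum_mono mult_left_mono) auto
  also have "\<dots> = (\<Sum>m\<in>{k..n}. moment \<gamma> ^ m) * ?C" by (simp only: sum_distrib_right)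
  also have "\<dots> \<le> moment \<gamma> ^ k / (1 - moment \<gamma>) * ?C"
  proof (intro mult_right_mono C)
    have "(\<Sum>m\<in>{k..n}. moment \<gamma> ^ m) \<le> (\<Sum>m. moment \<gamma> ^ (m + k))"
    proof (cases "k \<le> n")
      case True
      have "(\<Sum>m\<in>{k..n}. moment \<gamma> ^ m) = (\<Sum>m\<in>{0..n - k}. moment \<gamma> ^ (m + k))"
        using sum.shift_bounds_cl_nat_ivl[of "\<lambda>m. moment \<gamma> ^ m" 0 k "n - k"] True by simp
      also have "\<dots> \<le> (\<Sum>m. moment \<gamma> ^ (m + k))"
        using moment_nonneg \<gamma> by (intro sum_le_suminf summable_ignore_initial_segment summable_geometric) auto
      finally show ?thesis .
    qed (use moment_nonneg \<gamma> in \<open>auto intro!: suminf_nonneg summable_ignore_initial_segment summable_geometric\<close>)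
    also have "\<dots> = moment \<gamma> ^ k / (1 - moment \<gamma>)"
      using moment_nonneg[of \<gamma>] \<gamma> by (simp add: power_add suminf_mult2[symmetric] suminf_geometric)
    finally show "(\<Sum>m\<in>{k..n}. moment \<gamma> ^ m) \<le> moment \<gamma> ^ k / (1 - moment \<gamma>)" .
  qed
  finally show ?thesis .
qed

text \<open>The factors 4 are chosen so that a value below 1 forces the averaged fluctuation below 1
  / 2 in modulus and the averaged overflow below 1 / 4.\<close>

definition deviation :: "real \<Rightarrow> real \<Rightarrow> nat \<Rightarrow> nat \<Rightarrow> 'a \<Rightarrow> real" where
  "deviation \<alpha> \<gamma> k n \<omega> = 4 * (fluctuation \<alpha> k n \<omega> / 3 ^ k)\<^sup>2 +
    4 * ((\<Sum>i\<in>words letters k. overflow \<alpha> \<gamma> k n (sub \<omega> i)) / 3 ^ k)"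

lemma deviation_small:
  assumes \<alpha>: "0 \<le> \<alpha>" "moment \<alpha> = 1" "moment (2 * \<alpha>) < 1" and \<gamma>: "0 \<le> \<gamma>" "moment \<gamma> < 1"
  shows "AE \<omega> in M. \<exists>k. \<forall>m. \<exists>n\<ge>m. deviation \<alpha> \<gamma> k n \<omega> < 1"
proof -
  let ?C = "9 / (1 - moment (2 * \<alpha>))"
  let ?e = "\<lambda>k. 4 * ?C * (1 / 3) ^ k + 4 * (1 + ?C) / (1 - moment \<gamma>) * moment \<gamma> ^ k"
  have T: "subtree i \<subseteq> lists letters" if "i \<in> words letters k" for i k
    using that subtree_subset by (auto simp: words_iff)
  have ov: "bounded_rv (lists letters) (\<lambda>\<omega>. overflow \<alpha> \<gamma> k n (sub \<omega> i))" if "i \<in> words letters k" for i k n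
    using that \<alpha> \<gamma> by (intro bounded_rv_mono[OF bounded_rv_overflow T]) (auto simp: words_iff)
  have fl: "bounded_rv (lists letters) (fluctuation \<alpha> k n)" for k n
  proof -
    have "bounded_rv (lists letters) (\<lambda>\<omega>. level_sum (sub \<omega> i) \<alpha> n + - 1)" if "i \<in> words letters k" for i
      using that \<alpha> by (intro bounded_rv_add bounded_rv_const bounded_rv_mono[OF bounded_rv_level_sum T]) (auto simp: words_iff)
    then show ?thesis unfolding fluctuation_def[abs_def] by (intro bounded_rv_sum) simp
  qed
  have int_fl: "integrable M (\<lambda>\<omega>. (fluctuation \<alpha> k n \<omega>)\<^sup>2)" for k n
    by (rule bounded_rv_integrable[OF bounded_rv_power[OF fl]]) simp
  have int_ov: "integrable M (\<lambda>\<omega>. overflow \<alpha> \<gamma> k n (sub \<omega> i))" if "i \<in> words letters k" for i k n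
    by (rule bounded_rv_integrable[OF ov[OF that]]) simp
  show ?thesis
  proof (rule AE_infinitely_often_small[where e = ?e])
    fix k n
    show "integrable M (deviation \<alpha> \<gamma> k n)"
      unfolding deviation_def[abs_def] power_divide using int_fl int_ov by auto
    show "0 \<le> deviation \<alpha> \<gamma> k n \<omega>" for \<omega>
      unfolding deviation_def overflow_def weighted_sum_def
      by (intro add_nonneg_nonneg mult_nonneg_nonneg divide_nonneg_nonneg sum_nonneg) auto
    have "expectation (deviation \<alpha> \<gamma> k n) = 4 * (expectation (\<lambda>\<omega>. (fluctuation \<alpha> k n \<omega>)\<^sup>2) / (3 ^ k)\<^sup>2) +
        4 * ((\<Sum>i\<in>words letters k. expectation (\<lambda>\<omega>. overflow \<alpha> \<gamma> k n (sub \<omega> i))) / 3 ^ k)"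
      unfolding deviation_def[abs_def] power_divide using int_fl int_ov by (subst Bochner_Integration.integral_add) auto
    also have "\<dots> \<le> 4 * (3 ^ k * ?C / (3 ^ k)\<^sup>2) +
        4 * ((\<Sum>i\<in>words letters k. moment \<gamma> ^ k / (1 - moment \<gamma>) * (1 + ?C)) / 3 ^ k)"
      using expectation_fluctuation[OF \<alpha>] expectation_overflow[OF \<alpha> \<gamma>]
      by (intro add_mono mult_left_mono divide_right_mono sum_mono) (auto simp: words_iff)
    also have "\<dots> = ?e k"
      by (simp add: card_words power2_eq_square power_divide)
    finally show "expectation (deviation \<alpha> \<gamma> k n) \<le> ?e k" .
  next
    have "(\<lambda>k. 4 * ?C * (1 / 3) ^ k + 4 * (1 + ?C) / (1 - moment \<gamma>) * moment \<gamma> ^ k) \<longlonglongrightarrow>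
        4 * ?C * 0 + 4 * (1 + ?C) / (1 - moment \<gamma>) * 0"
      using moment_nonneg[of \<gamma>] \<gamma> by (intro tendsto_add tendsto_mult tendsto_const LIMSEQ_power_zero) auto
    then show "?e \<longlonglongrightarrow> 0" by simp
  qed
qed

end

section \<open>Lower bounds for sums over cuts\<close>

text \<open>Words of level \<open>n\<close> are grouped by a prefix in \<open>F\<close>, and the
  group of \<open>i\<close> sums to l(i)^\<alpha> times the level sum of its subtree.\<close>

lemma level_sum_le_cut:
  assumes bal: "balanced \<epsilon> u" and F: "finite F" "F \<subseteq> lists letters" "\<And>i. i \<in> F \<Longrightarrow> k \<le> length i \<and> length i \<le> n"
    and cover: "\<And>j. j \<in> words letters n \<Longrightarrow> \<exists>i\<in>F. prefix i j" and s: "s + \<gamma> = 2 * \<alpha>"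
  shows "level_sum u \<alpha> n \<le> (\<Sum>i\<in>F. cell_length u i powr s) + overflow \<alpha> \<gamma> k n u"
proof -
  let ?S = "\<lambda>i. level_sum (subcascade u i) \<alpha> (n - length i)"
  have "words letters n \<subseteq> (\<Union>i\<in>F. (\<lambda>j. i @ j) ` words letters (n - length i))"
  proof
    fix j assume j: "j \<in> words letters n"
    then obtain i where "i \<in> F" "prefix i j" using cover by blast
    then obtain j' where i: "i \<in> F" "j = i @ j'" by (auto simp: prefix_def)
    then have "j' \<in> words letters (n - length i)" using j by (auto simp: words_def)
    then show "j \<in> (\<Union>i\<in>F. (\<lambda>j. i @ j) ` words letters (n - length i))" using i by blast
  qed
  then have "level_sum u \<alpha> n \<le>
      (\<Sum>j\<in>(\<Union>i\<in>F. (\<lambda>j. i @ j) ` words letters (n - length i)). cell_length u j powr \<alpha>)"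
    unfolding level_sum_def using F(1) by (intro sum_mono2) auto
  also have "\<dots> \<le> (\<Sum>i\<in>F. \<Sum>j\<in>(\<lambda>j. i @ j) ` words letters (n - length i). cell_length u j powr \<alpha>)"
    using F(1) by (intro sum_UN_le) auto
  also have "\<dots> = (\<Sum>i\<in>F. cell_length u i powr \<alpha> * ?S i)"
  proof (rule sum.cong[OF refl])
    fix i
    have inj: "inj_on (\<lambda>j. i @ j) (words letters (n - length i))" by (simp add: inj_on_def)
    show "(\<Sum>j\<in>(\<lambda>j. i @ j) ` words letters (n - length i). cell_length u j powr \<alpha>) = cell_length u i powr \<alpha> * ?S i"
      unfolding sum.reindex[OF inj] level_sum_def sum_distrib_left o_def cell_length_append powr_mult ..
  qed
  also have "\<dots> \<le> (\<Sum>i\<in>F. cell_length u i powr s + cell_length u i powr \<gamma> * (?S i)\<^sup>2)"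
  proof (rule sum_mono)
    fix i assume "i \<in> F"
    then have l: "0 < cell_length u i" using F(2) cell_length_pos[OF bal] by blast
    \<comment> \<open>As \<alpha> = s / 2 + \<gamma> / 2, the summand splits into a factor whose
      square belongs to the cut sum and one whose square belongs to the overflow.\<close>
    let ?p = "cell_length u i powr (s / 2)" and ?r = "cell_length u i powr (\<gamma> / 2)"
    have "cell_length u i powr \<alpha> = ?p * ?r"
      using s by (simp add: powr_add[symmetric] add_divide_distrib[symmetric])
    moreover have "?p * (?r * ?S i) \<le> ?p\<^sup>2 + (?r * ?S i)\<^sup>2"
    proof -
      have "0 \<le> ?p * (?r * ?S i)" by (simp add: level_sum_nonneg)
      moreover have "2 * (?p * (?r * ?S i)) \<le> ?p\<^sup>2 + (?r * ?S i)\<^sup>2"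
        using sum_squares_bound[of ?p "?r * ?S i"] by (simp only: mult.assoc)
      ultimately show ?thesis by linarith
    qed
    moreover have "?p\<^sup>2 = cell_length u i powr s" "?r\<^sup>2 = cell_length u i powr \<gamma>"
      by (simp_all add: power2_eq_square powr_add[symmetric])
    ultimately show "cell_length u i powr \<alpha> * ?S i \<le> cell_length u i powr s + cell_length u i powr \<gamma> * (?S i)\<^sup>2"
      by (simp only: power_mult_distrib mult.assoc)
  qed
  also have "\<dots> = (\<Sum>i\<in>F. cell_length u i powr s) + (\<Sum>i\<in>F. cell_length u i powr \<gamma> * (?S i)\<^sup>2)"
    by (simp only: sum.distrib)
  \<comment> \<open>The error over the unknown cut is enlarged to all words of levels
    \<open>k\<close> to \<open>n\<close>, which removes its dependence on \<open>F\<close>.\<close>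
  also have "(\<Sum>i\<in>F. cell_length u i powr \<gamma> * (?S i)\<^sup>2) \<le>
      (\<Sum>i\<in>(\<Union>m\<in>{k..n}. words letters m). cell_length u i powr \<gamma> * (?S i)\<^sup>2)"
    using F by (intro sum_mono2) (auto simp: words_iff)
  also have "\<dots> \<le> (\<Sum>m\<in>{k..n}. \<Sum>i\<in>words letters m. cell_length u i powr \<gamma> * (?S i)\<^sup>2)"
    by (intro sum_UN_le) auto
  also have "\<dots> = overflow \<alpha> \<gamma> k n u"
    unfolding overflow_def weighted_sum_def by (intro sum.cong) (auto simp: words_iff)
  finally show ?thesis by simp
qed

context random_cascade
begin

text \<open>Below each word of level \<open>k\<close> the set \<open>F\<close> induces a cut of that
  subtree; lying below level 2 k, it is at least \<open>k\<close> deep there, as the overflow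
  requires. The factor (\<epsilon>^k)^s passes from lengths inside the subtrees to lengths in the
  whole tree.\<close>

lemma cut_sum_ge:
  assumes bal: "balanced \<epsilon> (realization \<omega>)" and dev: "deviation \<alpha> \<gamma> k n \<omega> < 1"
    and F: "finite F" "F \<subseteq> lists letters" "\<And>i. i \<in> F \<Longrightarrow> 2 * k \<le> length i \<and> length i \<le> k + n"
    and cover: "\<And>j. j \<in> words letters (k + n) \<Longrightarrow> \<exists>i\<in>F. prefix i j"
    and s: "s + \<gamma> = 2 * \<alpha>" "0 \<le> s"
  shows "(\<epsilon> ^ k) powr s * (3 ^ k / 4) \<le> (\<Sum>i\<in>F. cell_length (realization \<omega>) i powr s)"
proof -
  let ?l = "cell_length (realization \<omega>)"
  define G where "G h = {j \<in> lists letters. h @ j \<in> F}" for h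
  have finG: "finite (G h)" for h
  proof (rule finite_imageD)
    show "finite ((\<lambda>j. h @ j) ` G h)" by (rule finite_subset[OF _ F(1)]) (auto simp: G_def)
  qed (simp add: inj_on_def)
  have hl: "h \<in> lists letters" "length h = k" if "h \<in> words letters k" for h
    using that by (auto simp: words_iff)
  have bal_sub: "balanced \<epsilon> (sub \<omega> h)" if "h \<in> words letters k" for h
    using balanced_subcascade[OF bal hl(1)[OF that]] .
  have cut: "level_sum (sub \<omega> h) \<alpha> n - overflow \<alpha> \<gamma> k n (sub \<omega> h) \<le> (\<Sum>j\<in>G h. cell_length (sub \<omega> h) j powr s)"
    if h: "h \<in> words letters k" for h
  proof -
    have "\<exists>i\<in>G h. prefix i j" if j: "j \<in> words letters n" for j
    proof -
      obtain i where i: "i \<in> F" "prefix i (h @ j)" using cover[OF words_appendI[OF h j]] by blast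
      have "length h \<le> length i" using F(3)[OF i(1)] hl(2)[OF h] by simp
      then obtain i' where i': "i = h @ i'" "prefix i' j"
        using i(2) by (auto simp: prefix_append) (auto simp: prefix_def)
      moreover have "h @ i' \<in> lists letters" using i i' F(2) by blast
      ultimately show ?thesis using i by (auto simp: G_def)
    qed
    moreover have "k \<le> length i \<and> length i \<le> n" if "i \<in> G h" for i
      using F(3)[of "h @ i"] that hl(2)[OF h] by (simp add: G_def)
    ultimately have "level_sum (sub \<omega> h) \<alpha> n \<le> (\<Sum>j\<in>G h. cell_length (sub \<omega> h) j powr s) + overflow \<alpha> \<gamma> k n (sub \<omega> h)"
      using finG s(1) by (intro level_sum_le_cut[OF bal_sub[OF h]]) (auto simp: G_def)
    then show ?thesis by simp
  qed
  define t o' where "t = fluctuation \<alpha> k n \<omega> / 3 ^ k"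
    and "o' = (\<Sum>i\<in>words letters k. overflow \<alpha> \<gamma> k n (sub \<omega> i)) / 3 ^ k"
  have o': "0 \<le> o'"
    unfolding o'_def overflow_def weighted_sum_def
    by (intro divide_nonneg_nonneg sum_nonneg mult_nonneg_nonneg) auto
  have d: "4 * t\<^sup>2 + 4 * o' < 1" using dev by (simp add: deviation_def t_def o'_def)
  have "4 * o' < 1" using d zero_le_power2[of t] by linarith
  moreover have "t\<^sup>2 < (1 / 2)\<^sup>2" using d o' by (simp add: power2_eq_square)
  then have "\<bar>t\<bar> < 1 / 2" by (intro power2_less_imp_less[of "\<bar>t\<bar>" "1 / 2"]) auto
  \<comment> \<open>The averaged level sum is t + 1; losing 1 / 2 by fluctuation and 1 / 4 by
    overflow leaves 1 / 4.\<close>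
  ultimately have "1 / 4 < t + 1 - o'" by linarith
  then have "3 ^ k / 4 \<le> 3 ^ k * (t + 1 - o')" by simp
  also have "\<dots> = (\<Sum>h\<in>words letters k. level_sum (sub \<omega> h) \<alpha> n - overflow \<alpha> \<gamma> k n (sub \<omega> h))"
  proof -
    have "fluctuation \<alpha> k n \<omega> = (\<Sum>h\<in>words letters k. level_sum (sub \<omega> h) \<alpha> n) - 3 ^ k"
      by (simp add: fluctuation_def sum_subtractf card_words)
    moreover have "3 ^ k * (t + 1 - o') =
        fluctuation \<alpha> k n \<omega> + 3 ^ k - (\<Sum>h\<in>words letters k. overflow \<alpha> \<gamma> k n (sub \<omega> h))"
      by (simp add: t_def o'_def right_diff_distrib distrib_left)
    ultimately show ?thesis by (simp add: sum_subtractf)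
  qed
  also have "\<dots> \<le> (\<Sum>h\<in>words letters k. \<Sum>j\<in>G h. cell_length (sub \<omega> h) j powr s)"
    using cut by (rule sum_mono)
  finally have "(\<epsilon> ^ k) powr s * (3 ^ k / 4) \<le>
      (\<epsilon> ^ k) powr s * (\<Sum>h\<in>words letters k. \<Sum>j\<in>G h. cell_length (sub \<omega> h) j powr s)"
    by (intro mult_left_mono) auto
  also have "\<dots> \<le> (\<Sum>h\<in>words letters k. \<Sum>j\<in>G h. ?l (h @ j) powr s)"
    unfolding sum_distrib_left
  proof (intro sum_mono)
    fix h j assume h: "h \<in> words letters k"
    have "(\<epsilon> ^ k) powr s \<le> ?l h powr s"
      using cell_length_ge[OF bal hl(1)[OF h]] hl(2)[OF h] balancedD(1)[OF bal] s(2) by (intro powr_mono2) auto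
    then show "(\<epsilon> ^ k) powr s * cell_length (sub \<omega> h) j powr s \<le> ?l (h @ j) powr s"
      by (simp add: cell_length_append powr_mult mult_right_mono)
  qed
  also have "\<dots> = (\<Sum>(h, j)\<in>Sigma (words letters k) G. ?l (h @ j) powr s)"
    using finG by (simp add: sum.Sigma)
  also have "\<dots> = (\<Sum>i\<in>(\<lambda>(h, j). h @ j) ` Sigma (words letters k) G. ?l i powr s)"
  proof -
    have "inj_on (\<lambda>(h, j). h @ j) (Sigma (words letters k) G)"
      using hl(2) by (auto simp: inj_on_def)
    then show ?thesis by (simp add: sum.reindex case_prod_unfold)
  qed
  also have "\<dots> \<le> (\<Sum>i\<in>F. ?l i powr s)"
    using F(1) by (intro sum_mono2) (auto simp: G_def)
  finally show ?thesis .
qed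

text \<open>The level \<open>k\<close>, and with it the bound and the depth threshold, depends on
  the realization but is fixed before the cut.\<close>

lemma cut_property:
  assumes \<alpha>: "0 \<le> \<alpha>" "moment \<alpha> = 1" "moment (2 * \<alpha>) < 1" and \<gamma>: "0 \<le> \<gamma>" "moment \<gamma> < 1"
    and s: "s + \<gamma> = 2 * \<alpha>" "0 \<le> s" and bal: "AE \<omega> in M. balanced \<epsilon> (realization \<omega>)"
  shows "AE \<omega> in M. cut_sums_bounded (realization \<omega>) s"
  using deviation_small[OF \<alpha> \<gamma>] bal
proof eventually_elim
  case (elim \<omega>)
  then obtain k where k: "\<And>m. \<exists>n\<ge>m. deviation \<alpha> \<gamma> k n \<omega> < 1" by blast
  show ?case
    unfolding cut_sums_bounded_def
  proof (intro exI[of _ "(\<epsilon> ^ k) powr s * (3 ^ k / 4)"] conjI exI[of _ "2 * k"] allI impI)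
    show "0 < (\<epsilon> ^ k) powr s * (3 ^ k / 4)" using balancedD(1)[OF elim(2)] by simp
    fix F assume F: "finite F" "F \<subseteq> lists letters" "\<forall>i\<in>F. 2 * k \<le> length i"
      "\<exists>n. \<forall>j\<in>words letters n. \<exists>i\<in>F. prefix i j"
    then obtain n0 where n0: "\<And>j. j \<in> words letters n0 \<Longrightarrow> \<exists>i\<in>F. prefix i j" by blast
    \<comment> \<open>Since good values of \<open>n\<close> are unbounded, one can be taken beyond
      the depth of this particular cut.\<close>
    obtain n where n: "Max (insert n0 (length ` F)) \<le> n" "deviation \<alpha> \<gamma> k n \<omega> < 1" using k by blast
    have len: "n0 \<le> n" "\<And>i. i \<in> F \<Longrightarrow> length i \<le> n" using n(1) F(1) by auto
    have cover: "\<exists>i\<in>F. prefix i j" if j: "j \<in> words letters (k + n)" for j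
    proof -
      have "take n0 j \<in> words letters n0" using j len(1) by (auto simp: words_def dest: in_set_takeD)
      then show ?thesis using n0 take_is_prefix prefix_order.trans by blast
    qed
    show "(\<epsilon> ^ k) powr s * (3 ^ k / 4) \<le> (\<Sum>i\<in>F. cell_length (realization \<omega>) i powr s)"
    proof (rule cut_sum_ge[OF elim(2) n(2) F(1,2) _ cover s])
      show "2 * k \<le> length i \<and> length i \<le> k + n" if "i \<in> F" for i
        using F(3) len(2)[OF that] that by simp
    qed
  qed
qed

text \<open>Divided by \<rho>^n, with \<rho> strictly between m(\<theta>) and 1, the level sums have
  summable expectations. Their series is almost surely finite, and its value serves as
  \<open>K\<close>.\<close>

lemma decay_property:
  assumes \<theta>: "0 \<le> \<theta>" "moment \<theta> < 1"
  shows "AE \<omega> in M. \<exists>K \<rho>. 0 < \<rho> \<and> \<rho> < 1 \<and>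
    (\<forall>n. (\<Sum>i\<in>words letters n. cell_length (realization \<omega>) i powr \<theta>) \<le> K * \<rho> ^ n)"
proof -
  define \<rho> where "\<rho> = (1 + moment \<theta>) / 2"
  have \<rho>: "0 < \<rho>" "\<rho> < 1" "moment \<theta> < \<rho>" using moment_nonneg[of \<theta>] \<theta>(2) by (auto simp: \<rho>_def)
  define Z where "Z n \<omega> = level_sum (realization \<omega>) \<theta> n / \<rho> ^ n" for n \<omega>
  have level: "integrable M (\<lambda>\<omega>. level_sum (realization \<omega>) \<theta> n)"
    "expectation (\<lambda>\<omega>. level_sum (realization \<omega>) \<theta> n) = moment \<theta> ^ n" for n
    using bounded_rv_integrable[OF bounded_rv_level_sum[of "[]" \<theta> n]] expectation_level_sum[of "[]" \<theta> n] \<theta>(1)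
    by (simp_all add: subtree_subset)
  have Z: "integrable M (Z n)" "expectation (Z n) = (moment \<theta> / \<rho>) ^ n" "0 \<le> Z n \<omega>" for n \<omega>
    using level[of n] level_sum_nonneg \<rho> by (simp_all add: Z_def[abs_def] power_divide)
  have [measurable]: "Z n \<in> borel_measurable M" for n using Z(1) by blast
  have "(\<integral>\<^sup>+\<omega>. (\<Sum>n. ennreal (Z n \<omega>)) \<partial>M) = (\<Sum>n. \<integral>\<^sup>+\<omega>. ennreal (Z n \<omega>) \<partial>M)"
    by (intro nn_integral_suminf) auto
  also have "\<dots> = (\<Sum>n. ennreal ((moment \<theta> / \<rho>) ^ n))"
    using Z by (simp add: nn_integral_eq_integral)
  also have "\<dots> \<noteq> \<infinity>"
    unfolding infinity_ennreal_def
  proof (rule ennreal_suminf_neq_top)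
    show "summable (\<lambda>n. (moment \<theta> / \<rho>) ^ n)"
      using moment_nonneg[of \<theta>] \<rho> by (intro summable_geometric) simp
    show "0 \<le> (moment \<theta> / \<rho>) ^ n" for n using moment_nonneg[of \<theta>] \<rho> by simp
  qed
  finally have "AE \<omega> in M. (\<Sum>n. ennreal (Z n \<omega>)) \<noteq> \<infinity>"
    by (intro nn_integral_PInf_AE) auto
  then show ?thesis
  proof eventually_elim
    case (elim \<omega>)
    define K where "K = enn2real (\<Sum>n. ennreal (Z n \<omega>))"
    have K: "ennreal K = (\<Sum>n. ennreal (Z n \<omega>))" using elim unfolding K_def by (simp add: less_top)
    have "Z n \<omega> \<le> K" for n
    proof -
      have "ennreal (Z n \<omega>) \<le> (\<Sum>n. ennreal (Z n \<omega>))"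
        using sum_le_suminf[OF summableI, of "{n}" "\<lambda>n. ennreal (Z n \<omega>)"] by simp
      then show ?thesis unfolding K[symmetric] by (simp add: ennreal_le_iff K_def)
    qed
    then have "level_sum (realization \<omega>) \<theta> n \<le> K * \<rho> ^ n" for n
      using \<rho>(1) by (simp add: Z_def divide_le_eq)
    then show ?case using \<rho> unfolding level_sum_def by blast
  qed
qed

text \<open>The conditions concern one triple at a time, so they pass from the root to each word by
  equality in law; there are countably many words.\<close>

lemma AE_balanced:
  assumes "AE \<omega> in M. w [1] \<omega> + w [2] \<omega> = 1" "AE \<omega> in M. \<forall>a\<in>letters. \<epsilon> < w [a] \<omega>" "0 < \<epsilon>"
  shows "AE \<omega> in M. balanced \<epsilon> (realization \<omega>)"
proof -
  define P where "P t \<longleftrightarrow> coord 1 t + coord 2 t = 1 \<and> \<epsilon> < coord 1 t \<and> \<epsilon> < coord 2 t \<and> \<epsilon> < coord 3 t" for t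
  have P: "{t \<in> space borel. P t} \<in> sets borel" unfolding P_def by measurable
  have "AE \<omega> in M. P (triple [] \<omega>)"
    using assms(1,2) by eventually_elim (simp add: P_def coord_triple)
  then have root: "AE t in distr M borel (triple []). P t" using P by (subst AE_distr_iff) auto
  have same: "distr M borel (triple i) = distr M borel (triple [])" if "i \<in> lists letters" for i
    using triples_distr[OF that] by (simp add: triple_def[abs_def])
  have "AE \<omega> in M. P (triple i \<omega>)" if "i \<in> lists letters" for i
    using root unfolding same[OF that, symmetric] AE_distr_iff[OF triple_rv[OF that] P] .
  then have "AE \<omega> in M. \<forall>i\<in>lists letters. P (triple i \<omega>)"
    by (subst AE_ball_countable) auto
  moreover have "AE \<omega> in M. \<omega> \<in> space M" by simp
  ultimately show ?thesis
  proof eventually_elim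
    case (elim \<omega>)
    have "w (i @ [a]) \<omega> \<le> 1" if "i \<in> lists letters" "a \<in> letters" for i a
      using w_range[of "i @ [a]" \<omega>] elim(2) that by auto
    moreover have "\<epsilon> < w (i @ [a]) \<omega>" if "i \<in> lists letters" "a \<in> letters" for i a
      using elim(1) that by (auto simp: P_def coord_triple letters_def)
    moreover have "w (i @ [1]) \<omega> + w (i @ [2]) \<omega> = 1" if "i \<in> lists letters" for i
      using elim(1) that by (auto simp: P_def coord_triple)
    ultimately show ?case using assms(3) by (simp add: balanced_def)
  qed
qed

section \<open>The moment function and the critical exponent\<close>

lemma integrable_moment: "0 \<le> x \<Longrightarrow> integrable M (\<lambda>\<omega>. \<Sum>a\<in>letters. w [a] \<omega> powr x)"
  by (intro Bochner_Integration.integrable_sum integrable_w)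

text \<open>Strictness comes from letter 1 alone: its weight is below 1 because the weight of letter
  2 is positive.\<close>

lemma moment_strict_antimono:
  assumes bal: "AE \<omega> in M. balanced \<epsilon> (realization \<omega>)" and "0 \<le> x" "x < y"
  shows "moment y < moment x"
  unfolding moment_def
proof (rule integral_less_AE_space)
  show "AE \<omega> in M. (\<Sum>a\<in>letters. w [a] \<omega> powr y) < (\<Sum>a\<in>letters. w [a] \<omega> powr x)"
    using bal
  proof eventually_elim
    case (elim \<omega>)
    note b = balancedD[OF elim]
    have "w [1] \<omega> < 1" using b(5) b(3)[of 2] by simp
    then have "w [1] \<omega> powr y < w [1] \<omega> powr x" using b(3)[of 1] assms by (intro powr_less_mono') auto
    moreover have "w [a] \<omega> powr y \<le> w [a] \<omega> powr x" if "a \<in> letters" for a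
      using b(3,4)[OF that] assms by (intro powr_mono') auto
    from this[of 2] this[of 3] have "w [2] \<omega> powr y \<le> w [2] \<omega> powr x" "w [3] \<omega> powr y \<le> w [3] \<omega> powr x" by simp_all
    ultimately show ?case unfolding sum_letters by linarith
  qed
qed (use assms in \<open>auto intro!: integrable_moment simp: emeasure_space_1\<close>)

lemma moment_tendsto_integral:
  assumes x: "\<And>n. 0 \<le> x n" and g: "g \<in> borel_measurable M"
    and lim: "AE \<omega> in M. (\<lambda>n. \<Sum>a\<in>letters. w [a] \<omega> powr x n) \<longlonglongrightarrow> g \<omega>"
  shows "(\<lambda>n. moment (x n)) \<longlonglongrightarrow> expectation g"
  unfolding moment_def
proof (rule integral_dominated_convergence[where w = "\<lambda>_. 3", OF g _ _ lim])
  show "(\<lambda>\<omega>. \<Sum>a\<in>letters. w [a] \<omega> powr x n) \<in> borel_measurable M" for n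
    using integrable_moment[OF x] by (rule borel_measurable_integrable)
  show "AE \<omega> in M. norm (\<Sum>a\<in>letters. w [a] \<omega> powr x n) \<le> 3" for n
  proof (rule AE_I2)
    fix \<omega> assume "\<omega> \<in> space M"
    then have "(\<Sum>a\<in>letters. w [a] \<omega> powr x n) \<le> (\<Sum>a\<in>letters. 1)"
      using w_bounds x by (intro sum_mono powr_le1) auto
    moreover have "0 \<le> (\<Sum>a\<in>letters. w [a] \<omega> powr x n)" by (simp add: sum_nonneg)
    ultimately show "norm (\<Sum>a\<in>letters. w [a] \<omega> powr x n) \<le> 3" by simp
  qed
qed simp

lemma moment_tendsto:
  assumes bal: "AE \<omega> in M. balanced \<epsilon> (realization \<omega>)" and x: "\<And>n. 0 \<le> x n" "x \<longlonglongrightarrow> y" "0 \<le> y"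
  shows "(\<lambda>n. moment (x n)) \<longlonglongrightarrow> moment y"
  unfolding moment_def[of y]
proof (rule moment_tendsto_integral[OF x(1) borel_measurable_integrable[OF integrable_moment[OF x(3)]]])
  show "AE \<omega> in M. (\<lambda>n. \<Sum>a\<in>letters. w [a] \<omega> powr x n) \<longlonglongrightarrow> (\<Sum>a\<in>letters. w [a] \<omega> powr y)"
    using bal
  proof eventually_elim
    case (elim \<omega>)
    show ?case
    proof (intro tendsto_sum tendsto_powr tendsto_const x(2))
      fix a assume "a \<in> letters"
      then show "w [a] \<omega> \<noteq> 0" using balancedD(3)[OF elim, of a] by simp
    qed
  qed
qed

text \<open>Powers of a weight in the unit interval tend to the indicator of its being 1. This is
  where the hypothesis on the probabilities of weight 1 takes effect: it makes some moment less than
  1.\<close>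

lemma moment_tendsto_at_top:
  assumes bal: "AE \<omega> in M. balanced \<epsilon> (realization \<omega>)"
  shows "(\<lambda>n. moment (real n)) \<longlonglongrightarrow> (\<Sum>a\<in>letters. measure M {\<omega> \<in> space M. w [a] \<omega> = 1})"
proof -
  let ?S = "\<lambda>a. {\<omega> \<in> space M. w [a] \<omega> = 1}"
  have sets: "?S a \<in> sets M" if "a \<in> letters" for a
  proof -
    have [measurable]: "w [a] \<in> borel_measurable M" using w_measurable[of "[a]"] that by auto
    show ?thesis by measurable
  qed
  have "AE \<omega> in M. \<omega> \<in> space M" by simp
  then have "AE \<omega> in M. (\<lambda>n. \<Sum>a\<in>letters. w [a] \<omega> powr real n) \<longlonglongrightarrow> (\<Sum>a\<in>letters. indicator (?S a) \<omega>)"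
    using bal
  proof eventually_elim
    case (elim \<omega>)
    show ?case
    proof (rule tendsto_sum)
      fix a assume a: "a \<in> letters"
      note b = balancedD(3,4)[OF elim(2) a]
      show "(\<lambda>n. w [a] \<omega> powr real n) \<longlonglongrightarrow> indicator (?S a) \<omega>"
      proof (cases "w [a] \<omega> = 1")
        case True
        then show ?thesis using elim(1) by simp
      next
        case False
        then have "(\<lambda>n. w [a] \<omega> ^ n) \<longlonglongrightarrow> 0" using b by (intro LIMSEQ_power_zero) auto
        then show ?thesis using False b by (simp add: powr_realpow)
      qed
    qed
  qed
  then have "(\<lambda>n. moment (real n)) \<longlonglongrightarrow> expectation (\<lambda>\<omega>. \<Sum>a\<in>letters. indicator (?S a) \<omega>)"
    using sets by (intro moment_tendsto_integral borel_measurable_sum borel_measurable_indicator) auto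
  moreover have "expectation (\<lambda>\<omega>. \<Sum>a\<in>letters. indicator (?S a) \<omega>) = (\<Sum>a\<in>letters. measure M (?S a))"
    using sets by (subst Bochner_Integration.integral_sum) (auto simp: emeasure_eq_measure Int_absorb1)
  ultimately show ?thesis by simp
qed

text \<open>The moment of exponent 1 is at least 1 since the first two weights sum to 1. Continuity
  gives a solution beyond 1, and strict monotonicity makes it unique, which resolves the definite
  description.\<close>

lemma cascade_exponent:
  assumes bal: "AE \<omega> in M. balanced \<epsilon> (realization \<omega>)"
    and one: "(\<Sum>a\<in>letters. measure M {\<omega> \<in> space M. w [a] \<omega> = 1}) < 1"
  shows "1 \<le> cascade_exponent M w" "moment (cascade_exponent M w) = 1"
proof -
  have 1: "1 \<le> moment 1"
    unfolding moment_def
  proof (rule integral_ge_const)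
    show "AE \<omega> in M. 1 \<le> (\<Sum>a\<in>letters. w [a] \<omega> powr 1)"
      using bal
    proof eventually_elim
      case (elim \<omega>)
      show ?case using balancedD(3)[OF elim, of 1] balancedD(3)[OF elim, of 2] balancedD(3)[OF elim, of 3]
          balancedD(5)[OF elim] by (simp add: sum_letters)
    qed
  qed (rule integrable_moment, simp)
  obtain n where n: "moment (real n) < 1"
    using order_tendstoD(2)[OF moment_tendsto_at_top[OF bal] one] by (auto simp: eventually_sequentially)
  have n1: "1 \<le> real n"
    using n 1 moment_strict_antimono[OF bal, of "real n" 1] by (cases "real n < 1") auto
  have "continuous_on {1..real n} moment"
    unfolding continuous_on_sequentially o_def by (auto intro!: moment_tendsto[OF bal] intro: order_trans[OF zero_le_one])
  then obtain x where x: "1 \<le> x" "moment x = 1"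
    using IVT2'[of moment "real n" 1 1] n 1 n1 by auto
  have "cascade_exponent M w = x"
    unfolding cascade_exponent_def moment_def[symmetric]
  proof (rule the_equality)
    fix \<theta> assume "0 < \<theta> \<and> moment \<theta> = 1"
    then show "\<theta> = x"
      using moment_strict_antimono[OF bal, of \<theta> x] moment_strict_antimono[OF bal, of x \<theta>] x
      by (cases \<theta> x rule: linorder_cases) auto
  qed (use x in auto)
  then show "1 \<le> cascade_exponent M w" "moment (cascade_exponent M w) = 1" using x by auto
qed

end

section \<open>The Hausdorff dimension\<close>

text \<open>Above \<alpha> only a sequence of exponents is tested, so that countably many almost
  sure statements suffice.\<close>

lemma hausdorff_dim_eqI:
  assumes "0 < \<alpha>" "\<And>n. hausdorff_measure X d (\<alpha> + 1 / real (Suc n)) = 0"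
    "\<And>s. 0 < s \<Longrightarrow> s < \<alpha> \<Longrightarrow> hausdorff_measure X d s \<noteq> 0"
  shows "hausdorff_dim X d = ereal \<alpha>"
proof (rule antisym)
  have "hausdorff_dim X d \<le> ereal (\<alpha> + 1 / real (Suc n))" for n
    unfolding hausdorff_dim_def using assms(1) assms(2)[of n]
    by (intro Inf_lower imageI CollectI conjI add_pos_pos) auto
  then have le: "\<exists>N. \<forall>n\<ge>N. hausdorff_dim X d \<le> ereal (\<alpha> + 1 / real (Suc n))" by blast
  have "(\<lambda>n. ereal (\<alpha> + 1 / real (Suc n))) \<longlonglongrightarrow> ereal (\<alpha> + 0)"
    using LIMSEQ_inverse_real_of_nat by (intro tendsto_ereal tendsto_intros) (simp add: inverse_eq_divide)
  from LIMSEQ_le_const[OF this] le show "hausdorff_dim X d \<le> ereal \<alpha>" by simp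
  show "ereal \<alpha> \<le> hausdorff_dim X d"
    unfolding hausdorff_dim_def using assms(3) by (intro Inf_greatest) (force simp: not_less[symmetric])
qed

theorem theorem5:
  fixes M :: "'a measure" and w :: "nat list \<Rightarrow> 'a \<Rightarrow> real" and c :: real
  assumes "0 < c" and "c < 1 / 2"
    and "random_cascade M w"
    and "AE \<omega> in M. w [1] \<omega> + w [2] \<omega> = 1"
    and "(\<Sum>a\<in>letters. measure M {\<omega> \<in> space M. w [a] \<omega> = 1}) < 1"
    and "\<exists>\<epsilon>>0. measure M {\<omega> \<in> space M. \<forall>a\<in>letters. w [a] \<omega> > \<epsilon>} = 1"
  shows "AE \<omega> in M. hausdorff_dim (fractal c) (resistance_metric c (\<lambda>i. w i \<omega>)) =
           ereal (cascade_exponent M w)"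
proof -
  interpret random_cascade M w by (rule assms(3))
  obtain \<epsilon> where \<epsilon>: "0 < \<epsilon>" "prob {\<omega> \<in> space M. \<forall>a\<in>letters. w [a] \<omega> > \<epsilon>} = 1" using assms(6) by blast
  have "AE \<omega> in M. \<forall>a\<in>letters. \<epsilon> < w [a] \<omega>" using AE_prob_1[OF \<epsilon>(2)] by eventually_elim simp
  then have bal: "AE \<omega> in M. balanced \<epsilon> (realization \<omega>)" by (rule AE_balanced[OF assms(4) _ \<epsilon>(1)])
  define \<alpha> where "\<alpha> = cascade_exponent M w"
  have \<alpha>: "1 \<le> \<alpha>" "moment \<alpha> = 1" using cascade_exponent[OF bal assms(5)] by (auto simp: \<alpha>_def)
  have less: "moment x < 1" if "\<alpha> < x" for x
    using moment_strict_antimono[OF bal _ that] \<alpha> by simp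
  \<comment> \<open>One sequence serves both sides: countably many exceptional null sets are united,
    and \<delta> n \<le> 1 \<le> \<alpha> keeps \<alpha> - \<delta> n nonnegative.\<close>
  define \<delta> where "\<delta> n = 1 / real (Suc n)" for n
  have \<delta>: "0 < \<delta> n" "\<delta> n \<le> 1" for n by (auto simp: \<delta>_def)
  have decay: "AE \<omega> in M. \<forall>n. \<exists>K \<rho>. 0 < \<rho> \<and> \<rho> < 1 \<and>
      (\<forall>m. (\<Sum>i\<in>words letters m. cell_length (realization \<omega>) i powr (\<alpha> + \<delta> n)) \<le> K * \<rho> ^ m)"
    unfolding AE_all_countable
  proof
    fix n
    have "0 \<le> \<alpha> + \<delta> n" using \<alpha>(1) \<delta>(1)[of n] by linarith
    then show "AE \<omega> in M. \<exists>K \<rho>. 0 < \<rho> \<and> \<rho> < 1 \<and>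
      (\<forall>m. (\<Sum>i\<in>words letters m. cell_length (realization \<omega>) i powr (\<alpha> + \<delta> n)) \<le> K * \<rho> ^ m)"
      using less[of "\<alpha> + \<delta> n"] \<delta>(1)[of n] by (intro decay_property) auto
  qed
  have cuts: "AE \<omega> in M. \<forall>n. cut_sums_bounded (realization \<omega>) (\<alpha> - \<delta> n)"
    unfolding AE_all_countable
  proof
    fix n
    show "AE \<omega> in M. cut_sums_bounded (realization \<omega>) (\<alpha> - \<delta> n)"
      using \<alpha> \<delta>[of n] less[of "2 * \<alpha>"] less[of "\<alpha> + \<delta> n"]
      by (intro cut_property[where \<alpha> = \<alpha> and \<gamma> = "\<alpha> + \<delta> n", OF _ _ _ _ _ _ _ bal]) auto
  qed
  show ?thesis
    using bal decay cuts
  proof eventually_elim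
    case (elim \<omega>)
    let ?d = "resistance_metric c (realization \<omega>)"
    have network: "\<exists>K \<rho>. decaying_network c \<epsilon> (realization \<omega>) (\<alpha> + \<delta> n) K \<rho>" for n
    proof -
      obtain K \<rho> where "0 < \<rho>" "\<rho> < 1"
        "\<And>m. (\<Sum>i\<in>words letters m. cell_length (realization \<omega>) i powr (\<alpha> + \<delta> n)) \<le> K * \<rho> ^ m"
        using elim(2) by blast
      then have "decaying_network c \<epsilon> (realization \<omega>) (\<alpha> + \<delta> n) K \<rho>"
        using assms(1,2) elim(1) \<alpha>(1) \<delta>[of n] by unfold_locales auto
      then show ?thesis by blast
    qed
    have "hausdorff_dim (fractal c) ?d = ereal \<alpha>"
    proof (rule hausdorff_dim_eqI)
      show "0 < \<alpha>" using \<alpha> by simp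
      show "hausdorff_measure (fractal c) ?d (\<alpha> + 1 / real (Suc n)) = 0" for n
        using network[of n] decaying_network.hausdorff_measure_decay unfolding \<delta>_def by blast
      fix s assume s: "0 < s" "s < \<alpha>"
      then obtain n where n: "\<delta> n < \<alpha> - s"
        using reals_Archimedean[of "\<alpha> - s"] by (auto simp: \<delta>_def inverse_eq_divide)
      then have "cut_sums_bounded (realization \<omega>) s"
        using cut_sums_bounded_antimono[OF elim(1) elim(3)[rule_format, of n], of s] n by simp
      \<comment> \<open>The decay exponent here only controls the metric and the finite depth of
        cuts; it is unrelated to \<open>s\<close>.\<close>
      moreover obtain K \<rho> where "decaying_network c \<epsilon> (realization \<omega>) (\<alpha> + \<delta> n) K \<rho>"
        using network by blast
      ultimately show "hausdorff_measure (fractal c) ?d s \<noteq> 0"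
        using decaying_network.hausdorff_measure_nonzero[OF _ s(1)] by blast
    qed
    then show ?case by (simp add: \<alpha>_def)
  qed
qed

end
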